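(* Let $u\in H(\mathbb D)$ and $\varphi\in S(\mathbb D)$ be such that $uC_\varphi:\mathcal B\to\mathcal B$ is bounded. Then \[ \|uC_\varphi\|_{e,\mathcal B\to\mathcal B}\approx \limsup_{n\to\infty}\|u\varphi^n\|_{\mathcal B}+\limsup_{|\varphi(a)|\to1}\|uC_\varphi g_a\|_{\mathcal B} \approx \tilde\alpha+\tilde\beta+\tilde\gamma \approx \tilde\alpha+\limsup_{|\varphi(a)|\to1}\|uC_\varphi g_a\|_{\mathcal B}+\tilde\gamma \approx \limsup_{n\to\infty}\|u\varphi^n\|_{\mathcal B}+\tilde\beta, \] where $\tilde\alpha=\limsup_{|\varphi(a)|\to1}|u(a)|\,\|\sigma_{\varphi(a)}\circ\varphi\circ\sigma_a\|_{A^2}$, $\tilde\beta=\limsup_{|\varphi(a)|\to1}\log\frac{2}{1-|\varphi(a)|^2}\,\|u\circ\sigma_a-u(a)\|_{A^2}$, \[ \tilde\gamma=\limsup_{r\to1}\limsup_{t\to1}\sup_{|\varphi(a)|\le r}\Big(\int_{E(\varphi,a,t)}|u(\sigma_a(z))|^4\,dA(z)\Big)^{1/4}, \] with $E(\varphi,a,t)=\{z\in\mathbb D:|(\sigma_{\varphi(a)}\circ\varphi\circ\sigma_a)(z)|>t\}$ for $t\in(0,1)$, and \[ g_a(z)=\Big(\log\frac{2}{1-\overline{\varphi(a)}z}\Big)^2\Big(\log\frac{2}{1-|\varphi(a)|^2}\Big)^{-1}. \]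
   Context: $\mathbb D$ is the open unit disk, $H(\mathbb D)$ the analytic functions on $\mathbb D$, and $S(\mathbb D)$ the set of analytic self-maps of $\mathbb D$. For $a\in\mathbb D$, $\sigma_a(z)=\frac{a-z}{1-\bar a z}$. $dA=\frac1\pi\,dx\,dy$ is normalized area measure on $\mathbb D$, and $\|f\|_{A^2}=(\int_{\mathbb D}|f|^2\,dA)^{1/2}$. The Bloch space $\mathcal B$ consists of $f\in H(\mathbb D)$ with $\sup_{z\in\mathbb D}(1-|z|^2)|f'(z)|<\infty$, normed by $\|f\|_{\mathcal B}=|f(0)|+\sup_{z}(1-|z|^2)|f'(z)|$. $(uC_\varphi f)(z)=u(z)f(\varphi(z))$ and $u\varphi^n$ denotes $z\mapsto u(z)\varphi(z)^n$. The logarithm is the principal branch. The essential norm $\|T\|_{e,\mathcal B\to\mathcal B}$ of a bounded operator $T$ on $\mathcal B$ is $\inf\{\|T-K\|_{\mathcal B\to\mathcal B}: K \text{ compact on }\mathcal B\}$. For a quantity $Q(a)$, $\limsup_{|\varphi(a)|\to1}Q(a)=\lim_{s\to1^-}\sup\{Q(a): a\in\mathbb D,\ |\varphi(a)|>s\}$. $X\approx Y$ means there are positive constants $c,C$ independent of $u$ and $\varphi$ with $cY\le X\le CY$. *)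

theory Defs
  imports "HOL-Analysis.Analysis"
begin

definition unit_disc :: "complex set" where
  "unit_disc = ball 0 1"

definition sigma :: "complex \<Rightarrow> complex \<Rightarrow> complex" where
  "sigma a z = (a - z) / (1 - cnj a * z)"

definition enn_powr :: "ennreal \<Rightarrow> real \<Rightarrow> ennreal" where
  "enn_powr x p = (if x = \<infinity> then \<infinity> else ennreal (enn2real x powr p))"

definition bloch_norm :: "(complex \<Rightarrow> complex) \<Rightarrow> ennreal" where
  "bloch_norm f = ennreal (cmod (f 0)) +
     (SUP z\<in>unit_disc. ennreal ((1 - (cmod z)\<^sup>2) * cmod (deriv f z)))"

definition bloch_space :: "(complex \<Rightarrow> complex) set" where
  "bloch_space = {f. f holomorphic_on unit_disc \<and>
     (SUP z\<in>unit_disc. ennreal ((1 - (cmod z)\<^sup>2) * cmod (deriv f z))) < \<infinity>}"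

text \<open>Norm in the Bergman space A^2 with dA = (1/pi) dx dy.\<close>
definition A2_norm :: "(complex \<Rightarrow> complex) \<Rightarrow> ennreal" where
  "A2_norm f = enn_powr (set_nn_integral lborel unit_disc
                 (\<lambda>z. ennreal ((cmod (f z))\<^sup>2 / pi))) (1/2)"

definition wcomp :: "(complex \<Rightarrow> complex) \<Rightarrow> (complex \<Rightarrow> complex) \<Rightarrow>
    (complex \<Rightarrow> complex) \<Rightarrow> (complex \<Rightarrow> complex)" where
  "wcomp u \<phi> f = (\<lambda>z. u z * f (\<phi> z))"

definition wcomp_bounded_bloch :: "(complex \<Rightarrow> complex) \<Rightarrow> (complex \<Rightarrow> complex) \<Rightarrow> bool" where
  "wcomp_bounded_bloch u \<phi> \<longleftrightarrow>
     (\<forall>f\<in>bloch_space. wcomp u \<phi> f \<in> bloch_space) \<and>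
     (\<exists>C::real. \<forall>f\<in>bloch_space. bloch_norm (wcomp u \<phi> f) \<le> ennreal C * bloch_norm f)"

text \<open>Compact (linear) operators on the Bloch space; functions are only relevant on the disk.\<close>
definition compact_bloch_op :: "((complex \<Rightarrow> complex) \<Rightarrow> (complex \<Rightarrow> complex)) \<Rightarrow> bool" where
  "compact_bloch_op K \<longleftrightarrow>
     (\<forall>f\<in>bloch_space. K f \<in> bloch_space) \<and>
     (\<forall>f\<in>bloch_space. \<forall>g\<in>bloch_space. \<forall>a b::complex. \<forall>z\<in>unit_disc.
         K (\<lambda>w. a * f w + b * g w) z = a * K f z + b * K g z) \<and>
     (\<forall>f::nat \<Rightarrow> complex \<Rightarrow> complex. (\<forall>n. f n \<in> bloch_space) \<and>
         (\<exists>M::real. \<forall>n. bloch_norm (f n) \<le> ennreal M) \<longrightarrow>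
        (\<exists>r g. strict_mono r \<and> g \<in> bloch_space \<and>
           (\<lambda>n. bloch_norm (\<lambda>z. K (f (r n)) z - g z)) \<longlonglongrightarrow> 0))"

definition bloch_opnorm_diff :: "((complex \<Rightarrow> complex) \<Rightarrow> (complex \<Rightarrow> complex)) \<Rightarrow>
    ((complex \<Rightarrow> complex) \<Rightarrow> (complex \<Rightarrow> complex)) \<Rightarrow> ennreal" where
  "bloch_opnorm_diff T K =
     (SUP f\<in>{f\<in>bloch_space. bloch_norm f \<le> 1}. bloch_norm (\<lambda>z. T f z - K f z))"

definition bloch_ess_norm :: "((complex \<Rightarrow> complex) \<Rightarrow> (complex \<Rightarrow> complex)) \<Rightarrow> ennreal" where
  "bloch_ess_norm T = (INF K\<in>{K. compact_bloch_op K}. bloch_opnorm_diff T K)"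

text \<open>limsup as |phi(a)| -> 1: lim_{s->1-} sup{Q a : a in D, |phi a| > s}
  (the sup is decreasing in s, so the limit is the infimum; sup of empty set is 0).\<close>
definition limsup_bdry :: "(complex \<Rightarrow> complex) \<Rightarrow> (complex \<Rightarrow> ennreal) \<Rightarrow> ennreal" where
  "limsup_bdry \<phi> Q = (INF s\<in>{0<..<1::real}. SUP a\<in>{a\<in>unit_disc. cmod (\<phi> a) > s}. Q a)"

definition g_fun :: "(complex \<Rightarrow> complex) \<Rightarrow> complex \<Rightarrow> complex \<Rightarrow> complex" where
  "g_fun \<phi> a z = (Ln (2 / (1 - cnj (\<phi> a) * z)))\<^sup>2 /
                  complex_of_real (ln (2 / (1 - (cmod (\<phi> a))\<^sup>2)))"

definition alpha_t :: "(complex \<Rightarrow> complex) \<Rightarrow> (complex \<Rightarrow> complex) \<Rightarrow> ennreal" where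
  "alpha_t u \<phi> = limsup_bdry \<phi>
     (\<lambda>a. ennreal (cmod (u a)) * A2_norm (sigma (\<phi> a) \<circ> \<phi> \<circ> sigma a))"

definition beta_t :: "(complex \<Rightarrow> complex) \<Rightarrow> (complex \<Rightarrow> complex) \<Rightarrow> ennreal" where
  "beta_t u \<phi> = limsup_bdry \<phi>
     (\<lambda>a. ennreal (ln (2 / (1 - (cmod (\<phi> a))\<^sup>2))) * A2_norm (\<lambda>z. u (sigma a z) - u a))"

definition E_set :: "(complex \<Rightarrow> complex) \<Rightarrow> complex \<Rightarrow> real \<Rightarrow> complex set" where
  "E_set \<phi> a t = {z\<in>unit_disc. cmod ((sigma (\<phi> a) \<circ> \<phi> \<circ> sigma a) z) > t}"

definition gamma_t :: "(complex \<Rightarrow> complex) \<Rightarrow> (complex \<Rightarrow> complex) \<Rightarrow> ennreal" where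
  "gamma_t u \<phi> = Limsup (at_left (1::real)) (\<lambda>r. Limsup (at_left (1::real)) (\<lambda>t.
     SUP a\<in>{a\<in>unit_disc. cmod (\<phi> a) \<le> r}.
       enn_powr (set_nn_integral lborel (E_set \<phi> a t)
                   (\<lambda>z. ennreal ((cmod (u (sigma a z))) ^ 4 / pi))) (1/4)))"

end

theory Submission
  imports Defs "HOL-Complex_Analysis.Complex_Analysis"
begin

text \<open>Everything is compared with the boundary limits \<open>A\<close> and \<open>B\<close> of the pointwise quantities
  \<open>tau a = \<bar>u a\<bar> (1 - \<bar>a\<bar>\<^sup>2) \<bar>\<phi>' a\<bar> / (1 - \<bar>\<phi> a\<bar>\<^sup>2)\<close> and
  \<open>bL a = (1 - \<bar>a\<bar>\<^sup>2) \<bar>u' a\<bar> log (2 / (1 - \<bar>\<phi> a\<bar>\<^sup>2))\<close>.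
  The essential norm is at most a multiple of \<open>A + B\<close>, by approximating \<open>f \<mapsto> u (f \<circ> \<phi>)\<close> with the
  compact operators obtained from the dilations \<open>f (r z)\<close>. Each of the four right-hand sides dominates
  \<open>A + B\<close>: evaluate the derivatives of \<open>u \<phi>^n\<close> and \<open>u (g_a \<circ> \<phi>)\<close> at \<open>a\<close>, and bound a derivative at the
  origin by the Bergman norm. Conversely, a compact operator maps weakly null sequences to norm null
  sequences (proved by a gliding hump), which bounds the terms with \<open>u \<phi>^n\<close> and \<open>g_a\<close>, and the
  term \<open>gamma_t\<close> via powers of \<open>sigma (\<phi> a)\<close>, by the essential norm. The terms \<open>alpha_t\<close> and
  \<open>beta_t\<close> are bounded by \<open>A + B\<close> by integrating pointwise bounds along radii: Schwarz--Pick transports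
  the bounds from \<open>sigma a w\<close> to \<open>a\<close> at the cost of a factor logarithmic in \<open>1 - \<bar>w\<bar>\<close>, which is
  square integrable.\<close>

section \<open>Disc automorphisms and the Schwarz--Pick lemma\<close>

text \<open>The obstacle: smallness of \<open>tau\<close> and \<open>bL\<close> is known only where
  \<open>\<phi> a\<close> is close to the circle, whereas the integrals in \<open>alpha_t\<close>
  and \<open>beta_t\<close> see all points \<open>sigma a w\<close>. For
  \<open>cmod w \<le> R\<close>, Schwarz--Pick pushes \<open>\<phi> (sigma a w)\<close> to the
  circle together with \<open>\<phi> a\<close>. For larger \<open>w\<close> only the global bound
  from the boundedness of the operator is left; it is harmless because the weight has little mass
  there, and \<open>R\<close> can be fixed before \<open>a\<close> is. The logarithmic loss is
  traded for \<open>(1 - cmod w) powr (- 1/8)\<close>. Both the square and the fourth power of this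
  weight are integrable, so it serves the Bergman norms as well as the fourth powers in
  \<open>gamma_t\<close>. Squaring the logarithm in \<open>g_a\<close> and dividing once by its size
  keeps a logarithmic value and a derivative of order
  \<open>1 / (1 - \<bar>\<phi> a\<bar>^2)\<close> at \<open>\<phi> a\<close>, and makes the
  functions tend to 0 on compact sets, which a single logarithm would not do. Comparisons are run in
  the form "\<open>X < k\<close> implies \<open>Y \<le> C * k\<close>" for real \<open>k\<close>, so
  constants simply multiply along the chain.\<close>

lemma unit_disc_iff [simp]: "z \<in> unit_disc \<longleftrightarrow> cmod z < 1"
  by (simp add: unit_disc_def)

lemma open_unit_disc [simp]: "open unit_disc"
  by (simp add: unit_disc_def)

lemma one_minus_sq_bounds:
  fixes x :: real
  assumes "0 \<le> x" "x < 1"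
  shows "0 < 1 - x\<^sup>2" "1 - x \<le> 1 - x\<^sup>2" "1 - x\<^sup>2 \<le> 2 * (1 - x)" "1 - x\<^sup>2 \<le> 1"
proof -
  have eq: "1 - x\<^sup>2 = (1 - x) * (1 + x)" by (simp add: power2_eq_square algebra_simps)
  show "1 - x\<^sup>2 \<le> 1" by simp
  show "0 < 1 - x\<^sup>2" using assms by (auto simp: eq)
  show "1 - x \<le> 1 - x\<^sup>2" using mult_left_mono[of 1 "1 + x" "1 - x"] assms by (simp add: eq)
  show "1 - x\<^sup>2 \<le> 2 * (1 - x)" using mult_left_mono[of "1 + x" 2 "1 - x"] assms by (simp add: eq)
qed

lemmas norm_sq_bounds = one_minus_sq_bounds[OF norm_ge_zero]

section \<open>Growth of a function along a radius from a bound on its derivative\<close>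

lemma growth_comparison:
  assumes hol: "g holomorphic_on unit_disc" and z: "cmod z < 1"
    and G: "\<And>t. 0 \<le> t \<Longrightarrow> t \<le> cmod z \<Longrightarrow> (G has_real_derivative G' t) (at t)"
    and bd: "\<And>w. cmod w \<le> cmod z \<Longrightarrow> cmod (deriv g w) \<le> G' (cmod w)"
  shows "cmod (g z - g 0) \<le> G (cmod z) - G 0"
proof (cases "z = 0")
  case False
  \<comment> \<open>\<open>e\<close> is the direction of \<open>z\<close>. The mean value inequality
    compares the curve \<open>g (t e)\<close> with the real majorant \<open>G\<close>, whose
    derivative dominates the speed of the curve.\<close>
  define e where "e = z / of_real (cmod z)"
  have ne: "cmod e = 1" using False by (simp add: e_def norm_divide)
  have ze: "of_real (cmod z) * e = z" using False by (simp add: e_def)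
  have der: "((\<lambda>t. g (of_real t * e)) has_vector_derivative (deriv g (of_real t * e) * e)) (at t)"
    if "0 \<le> t" "t \<le> cmod z" for t
  proof -
    have "(g has_field_derivative deriv g (of_real t * e)) (at (of_real t * e))"
      using that z ne by (intro holomorphic_derivI[OF hol]) (auto simp: norm_mult)
    then have "(g has_field_derivative deriv g (of_real t * e)) (at (of_real t * e) within range (\<lambda>t. of_real t * e))"
      by (rule has_field_derivative_at_within)
    moreover have "((\<lambda>t. of_real t * e) has_vector_derivative e) (at t)"
      by (auto intro!: derivative_eq_intros simp: has_vector_derivative_def scaleR_conv_of_real)
    ultimately show ?thesis
      using field_vector_diff_chain_within[of "\<lambda>t. of_real t * e" e t UNIV g "deriv g (of_real t * e)"]
      by (simp add: o_def mult.commute)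
  qed
  have "norm (g (of_real (cmod z) * e) - g (of_real 0 * e)) \<le> G (cmod z) - G 0"
  proof (rule differentiable_bound_general[where f' = "\<lambda>t. deriv g (of_real t * e) * e" and \<phi>' = G'])
    show "0 < cmod z" using False by simp
    show "continuous_on {0..cmod z} (\<lambda>t. g (of_real t * e))"
      by (rule continuous_at_imp_continuous_on) (use der has_vector_derivative_continuous in fastforce)
    show "continuous_on {0..cmod z} G"
      by (rule continuous_at_imp_continuous_on) (use G DERIV_isCont in fastforce)
    show "(G has_vector_derivative G' x) (at x)" if "0 < x" "x < cmod z" for x
      using G[of x] that by (simp add: has_real_derivative_iff_has_vector_derivative)
    show "norm (deriv g (of_real x * e) * e) \<le> G' x" if "0 < x" "x < cmod z" for x
      using bd[of "of_real x * e"] that ne by (simp add: norm_mult)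
  qed (use der in auto)
  then show ?thesis by (simp add: ze)
qed simp

text \<open>The antiderivative of \<open>(1 - t) powr (- 9/8)\<close> is
  \<open>8 * (1 - t) powr (- 1/8)\<close>, so the weight lost in the derivative bound reappears
  unchanged in the bound of the function, at the price of the factor 8.\<close>

lemma power_growth:
  assumes hol: "g holomorphic_on unit_disc" and z: "cmod z < 1" and M: "0 \<le> M"
    and bd: "\<And>w. cmod w \<le> cmod z \<Longrightarrow>
       (1 - (cmod w)\<^sup>2) * cmod (deriv g w) \<le> M * (1 - cmod w) powr (- 1/8)"
  shows "cmod (g z - g 0) \<le> 8 * M * (1 - cmod z) powr (- 1/8)"
proof -
  have "cmod (g z - g 0) \<le> 8 * M * (1 - cmod z) powr (- 1/8) - 8 * M * (1 - 0) powr (-1/8)"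
  proof (rule growth_comparison[OF hol z, where G' = "\<lambda>t. M * (1 - t) powr (- 9/8)"])
    fix t :: real assume t: "0 \<le> t" "t \<le> cmod z"
    then have "1 - t > 0" using z by simp
    then show "((\<lambda>t. 8 * M * (1 - t) powr (- 1/8)) has_real_derivative M * (1 - t) powr (- 9/8)) (at t)"
      by (auto intro!: derivative_eq_intros)
  next
    fix w assume w: "cmod w \<le> cmod z"
    then have p: "1 - cmod w > 0" using z by simp
    have "(1 - cmod w) * cmod (deriv g w) \<le> (1 - (cmod w)\<^sup>2) * cmod (deriv g w)"
      using norm_sq_bounds[of w] p by (intro mult_right_mono) auto
    also note bd[OF w]
    also have "(1 - cmod w) powr (-1/8) = (1 - cmod w) * (1 - cmod w) powr (- 9/8)"
      using p powr_add[of "1 - cmod w" 1 "-9/8"] by simp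
    finally show "cmod (deriv g w) \<le> M * (1 - cmod w) powr (- 9/8)"
      using p by (simp add: mult.left_commute mult_le_cancel_left)
  qed
  then show ?thesis using M by simp
qed

section \<open>Disc automorphisms\<close>

lemma cnj_mult_neq_1:
  assumes "cmod a < 1" "cmod z < 1"
  shows "1 - cnj a * z \<noteq> 0"
proof
  assume "1 - cnj a * z = 0"
  then have "cmod (cnj a * z) = 1" by simp
  then have "cmod a * cmod z = 1" by (simp add: norm_mult)
  moreover have "cmod a * cmod z \<le> cmod a" using assms by (intro mult_left_le) auto
  ultimately show False using assms by simp
qed

lemma norm_one_minus_cnj_mult:
  assumes "cmod a < 1" "cmod z < 1"
  shows "1 - cmod z \<le> cmod (1 - cnj a * z)" "1 - cmod a \<le> cmod (1 - cnj a * z)"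
    "cmod (1 - cnj a * z) \<le> 2"
proof -
  have *: "cmod (cnj a * z) = cmod a * cmod z" by (simp add: norm_mult)
  have "cmod a * cmod z \<le> cmod z" "cmod a * cmod z \<le> cmod a" 
    using assms by (auto intro: mult_left_le_one_le mult_left_le)
  moreover have "1 - cmod (cnj a * z) \<le> cmod (1 - cnj a * z)"
    "cmod (1 - cnj a * z) \<le> 1 + cmod (cnj a * z)"
    using norm_triangle_ineq2[of 1 "cnj a * z"] norm_triangle_ineq4[of 1 "cnj a * z"] by auto
  ultimately show "1 - cmod z \<le> cmod (1 - cnj a * z)" "1 - cmod a \<le> cmod (1 - cnj a * z)"
    "cmod (1 - cnj a * z) \<le> 2" using assms unfolding * by linarith+
qed

lemma one_minus_norm_sigma:
  assumes "cmod a < 1" "cmod z < 1"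
  shows "1 - (cmod (sigma a z))\<^sup>2 = (1 - (cmod a)\<^sup>2) * (1 - (cmod z)\<^sup>2) / (cmod (1 - cnj a * z))\<^sup>2"
proof -
  have ne: "(cmod (1 - cnj a * z))\<^sup>2 \<noteq> 0" using cnj_mult_neq_1[OF assms] by simp
  have "(cmod (1 - cnj a * z))\<^sup>2 - (cmod (a - z))\<^sup>2 = (1 - (cmod a)\<^sup>2) * (1 - (cmod z)\<^sup>2)"
    unfolding cmod_power2 by (simp add: power2_eq_square algebra_simps)
  moreover have "(cmod (sigma a z))\<^sup>2 = (cmod (a - z))\<^sup>2 / (cmod (1 - cnj a * z))\<^sup>2"
    by (simp add: sigma_def norm_divide power_divide)
  ultimately show ?thesis using ne by (simp add: diff_divide_distrib flip: \<open>_ = (1 - (cmod a)\<^sup>2) * _\<close>)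
qed

lemma norm_sigma_less_1 [simp]:
  assumes "cmod a < 1" "cmod z < 1"
  shows "cmod (sigma a z) < 1"
proof -
  have "0 < 1 - (cmod (sigma a z))\<^sup>2"
    unfolding one_minus_norm_sigma[OF assms] 
    by (intro divide_pos_pos mult_pos_pos norm_sq_bounds(1) assms) (simp add: cnj_mult_neq_1[OF assms, simplified])
  then show ?thesis by (simp add: abs_square_less_1)
qed

lemma sigma_0 [simp]: "sigma a 0 = a" and sigma_self [simp]: "sigma a a = 0"
  and sigma_zero_left: "sigma 0 z = - z"
  by (simp_all add: sigma_def)

lemma sigma_has_derivative:
  assumes "cmod a < 1" "cmod z < 1"
  shows "(sigma a has_field_derivative - of_real (1 - (cmod a)\<^sup>2) / (1 - cnj a * z)\<^sup>2) (at z)"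
proof -
  have "((\<lambda>z. (a - z) / (1 - cnj a * z)) has_field_derivative - of_real (1 - (cmod a)\<^sup>2) / (1 - cnj a * z)\<^sup>2) (at z)"
  proof (rule derivative_eq_intros)+
    show "1 - cnj a * z \<noteq> 0" by (rule cnj_mult_neq_1[OF assms])
    show "((0 - 1) * (1 - cnj a * z) - (a - z) * (0 - (0 * z + 1 * cnj a))) / ((1 - cnj a * z) * (1 - cnj a * z)) =
       - of_real (1 - (cmod a)\<^sup>2) / (1 - cnj a * z)\<^sup>2"
      unfolding power2_eq_square[of "1 - cnj a * z"]
      by (rule arg_cong2[where f = "(/)"]) (simp_all add: complex_norm_square algebra_simps del: of_real_power)
  qed (auto intro!: derivative_eq_intros)
  then show ?thesis by (simp add: sigma_def[abs_def])
qed

lemma sigma_holomorphic: "cmod a < 1 \<Longrightarrow> sigma a holomorphic_on unit_disc"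
  unfolding holomorphic_on_open[OF open_unit_disc] using sigma_has_derivative unit_disc_iff by blast

text \<open>Automorphisms are isometries of the hyperbolic metric. By the chain rule the Bloch
  quantity is therefore merely moved from \<open>z\<close> to \<open>sigma a z\<close> under
  composition with \<open>sigma a\<close>.\<close>

lemma norm_deriv_sigma:
  assumes "cmod a < 1" "cmod z < 1"
  shows "(1 - (cmod z)\<^sup>2) * cmod (deriv (sigma a) z) = 1 - (cmod (sigma a z))\<^sup>2"
proof -
  have "cmod (deriv (sigma a) z) = (1 - (cmod a)\<^sup>2) / (cmod (1 - cnj a * z))\<^sup>2"
    using norm_sq_bounds(1)[OF assms(1)]
    by (simp only: DERIV_imp_deriv[OF sigma_has_derivative[OF assms]] norm_divide norm_minus_cancel norm_of_real norm_power)
  then show ?thesis using one_minus_norm_sigma[OF assms] by (simp add: mult.commute)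
qed

lemma deriv_compose_disc:
  assumes f: "f holomorphic_on unit_disc" and g: "g holomorphic_on unit_disc"
    and g1: "\<And>w. cmod w < 1 \<Longrightarrow> cmod (g w) < 1" and z: "cmod z < 1"
  shows "deriv (\<lambda>w. f (g w)) z = deriv f (g z) * deriv g z"
proof -
  have "deriv (f \<circ> g) z = deriv f (g z) * deriv g z"
    by (rule deriv_chain) (use z g1 holomorphic_on_imp_differentiable_at[OF f] holomorphic_on_imp_differentiable_at[OF g] in auto)
  then show ?thesis by (simp add: o_def)
qed

lemma holomorphic_compose_disc:
  assumes "f holomorphic_on unit_disc" "g holomorphic_on unit_disc" "\<And>w. cmod w < 1 \<Longrightarrow> cmod (g w) < 1"
  shows "(\<lambda>w. f (g w)) holomorphic_on unit_disc"
  using holomorphic_on_compose_gen[OF assms(2,1)] assms(3) by (auto simp: o_def image_subset_iff)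

lemma norm_deriv_compose_sigma:
  assumes f: "f holomorphic_on unit_disc" and a: "cmod a < 1" and z: "cmod z < 1"
  shows "(1 - (cmod z)\<^sup>2) * cmod (deriv (\<lambda>w. f (sigma a w)) z)
       = (1 - (cmod (sigma a z))\<^sup>2) * cmod (deriv f (sigma a z))"
proof -
  have "deriv (\<lambda>w. f (sigma a w)) z = deriv f (sigma a z) * deriv (sigma a) z"
    by (rule deriv_compose_disc[OF f sigma_holomorphic[OF a] _ z]) (simp add: a)
  then show ?thesis
    unfolding norm_deriv_sigma[OF a z, symmetric] by (simp add: norm_mult)
qed

text \<open>Conjugating by disc automorphisms reduces Schwarz--Pick to the Schwarz lemma for
  \<open>sigma (\<phi> a) \<circ> \<phi> \<circ> sigma a\<close>, which fixes the origin.\<close>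

lemma conjugate_self_map:
  assumes \<phi>: "\<phi> holomorphic_on unit_disc" "\<phi> ` unit_disc \<subseteq> unit_disc" and a: "cmod a < 1"
  shows "(sigma (\<phi> a) \<circ> \<phi> \<circ> sigma a) holomorphic_on unit_disc" (is ?A)
    and "\<And>z. cmod z < 1 \<Longrightarrow> (1 - (cmod z)\<^sup>2) * cmod (deriv (sigma (\<phi> a) \<circ> \<phi> \<circ> sigma a) z) =
       (1 - (cmod ((sigma (\<phi> a) \<circ> \<phi> \<circ> sigma a) z))\<^sup>2) / (1 - (cmod (\<phi> (sigma a z)))\<^sup>2)
         * ((1 - (cmod (sigma a z))\<^sup>2) * cmod (deriv \<phi> (sigma a z)))" (is "PROP ?B")
    and "\<And>z. cmod z < 1 \<Longrightarrow> cmod ((sigma (\<phi> a) \<circ> \<phi> \<circ> sigma a) z) \<le> cmod z" (is "PROP ?C")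
    and "cmod (deriv (sigma (\<phi> a) \<circ> \<phi> \<circ> sigma a) 0) \<le> 1" (is ?D)
    and "(sigma (\<phi> a) \<circ> \<phi> \<circ> sigma a) 0 = 0" (is ?E)
proof -
  have \<phi>1: "cmod (\<phi> w) < 1" if "cmod w < 1" for w using \<phi>(2) that by (auto simp: image_subset_iff)
  have h1: "(\<lambda>w. \<phi> (sigma a w)) holomorphic_on unit_disc"
    by (rule holomorphic_compose_disc[OF \<phi>(1) sigma_holomorphic[OF a]]) (simp add: a)
  have h2: "(\<lambda>w. sigma (\<phi> a) (\<phi> (sigma a w))) holomorphic_on unit_disc"
    by (rule holomorphic_compose_disc[OF sigma_holomorphic h1]) (simp_all add: a \<phi>1)
  then show ?A by (simp add: o_def)
  show ?E by simp
  show "PROP ?B"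
  proof -
    fix z assume z: "cmod z < 1"
    let ?q = "\<phi> (sigma a z)"
    have d1: "deriv (\<lambda>w. sigma (\<phi> a) (\<phi> (sigma a w))) z = deriv (sigma (\<phi> a)) ?q * deriv (\<lambda>w. \<phi> (sigma a w)) z"
      by (rule deriv_compose_disc[OF sigma_holomorphic h1 _ z]) (simp_all add: a \<phi>1)
    have q: "cmod ?q < 1" using a z \<phi>1 by auto
    have "cmod (deriv (sigma (\<phi> a)) ?q) = (1 - (cmod (sigma (\<phi> a) ?q))\<^sup>2) / (1 - (cmod ?q)\<^sup>2)"
      unfolding norm_deriv_sigma[OF \<phi>1[OF a] q, symmetric] using norm_sq_bounds(1)[OF q] by simp
    then show "(1 - (cmod z)\<^sup>2) * cmod (deriv (sigma (\<phi> a) \<circ> \<phi> \<circ> sigma a) z) =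
       (1 - (cmod ((sigma (\<phi> a) \<circ> \<phi> \<circ> sigma a) z))\<^sup>2) / (1 - (cmod (\<phi> (sigma a z)))\<^sup>2)
         * ((1 - (cmod (sigma a z))\<^sup>2) * cmod (deriv \<phi> (sigma a z)))"
      unfolding norm_deriv_compose_sigma[OF \<phi>(1) a z, symmetric] using d1 by (simp add: o_def norm_mult)
  qed
  have h: "(sigma (\<phi> a) \<circ> \<phi> \<circ> sigma a) holomorphic_on ball 0 1" using \<open>?A\<close> by (simp add: unit_disc_def)
  have n: "cmod ((sigma (\<phi> a) \<circ> \<phi> \<circ> sigma a) z) < 1" if "cmod z < 1" for z using that a \<phi>1 by simp
  show "PROP ?C" by (rule Schwarz_Lemma(1)[OF h \<open>?E\<close> n])
  show "?D" by (rule Schwarz_Lemma(2)[OF h \<open>?E\<close> n, of 0]) auto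
qed

lemma Schwarz_Pick:
  assumes \<phi>: "\<phi> holomorphic_on unit_disc" "\<phi> ` unit_disc \<subseteq> unit_disc" and a: "cmod a < 1"
  shows "(1 - (cmod a)\<^sup>2) * cmod (deriv \<phi> a) / (1 - (cmod (\<phi> a))\<^sup>2)
           = cmod (deriv (sigma (\<phi> a) \<circ> \<phi> \<circ> sigma a) 0)"
    and "(1 - (cmod a)\<^sup>2) * cmod (deriv \<phi> a) / (1 - (cmod (\<phi> a))\<^sup>2) \<le> 1"
  using conjugate_self_map(2)[OF assms, of 0] conjugate_self_map(4)[OF assms] by auto

text \<open>The pseudo-hyperbolic distance of \<open>\<phi> a\<close> and
  \<open>\<phi> (sigma a z)\<close> is at most \<open>cmod z\<close>. In the identity for
  \<open>1 - \<bar>sigma\<bar>^2\<close> the denominator is at least a quarter of the squared factor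
  belonging to \<open>\<phi> (sigma a z)\<close>, and one copy of that factor cancels. The result
  forces \<open>\<phi> (sigma a z)\<close> to the circle along with \<open>\<phi> a\<close>.\<close>

lemma Schwarz_Pick_distance:
  assumes \<phi>: "\<phi> holomorphic_on unit_disc" "\<phi> ` unit_disc \<subseteq> unit_disc" and a: "cmod a < 1" and z: "cmod z < 1"
  shows "(1 - (cmod (\<phi> (sigma a z)))\<^sup>2) * (1 - (cmod z)\<^sup>2) \<le> 4 * (1 - (cmod (\<phi> a))\<^sup>2)"
proof -
  let ?p = "\<phi> a" and ?q = "\<phi> (sigma a z)"
  have p: "cmod ?p < 1" and q: "cmod ?q < 1" using \<phi>(2) a z norm_sigma_less_1[OF a z] by (auto simp: image_subset_iff)
  have "cmod (sigma ?p ?q) \<le> cmod z" using conjugate_self_map(3)[OF \<phi> a z] by simp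
  then have "1 - (cmod z)\<^sup>2 \<le> 1 - (cmod (sigma ?p ?q))\<^sup>2" by (simp add: power_mono)
  also have "\<dots> = (1 - (cmod ?p)\<^sup>2) * (1 - (cmod ?q)\<^sup>2) / (cmod (1 - cnj ?p * ?q))\<^sup>2"
    by (rule one_minus_norm_sigma[OF p q])
  finally have 1: "(1 - (cmod z)\<^sup>2) * (cmod (1 - cnj ?p * ?q))\<^sup>2 \<le> (1 - (cmod ?p)\<^sup>2) * (1 - (cmod ?q)\<^sup>2)"
    using cnj_mult_neq_1[OF p q] by (simp add: field_simps)
  have qp: "0 < 1 - (cmod ?q)\<^sup>2" using norm_sq_bounds(1)[OF q] .
  have "(1 - (cmod ?q)\<^sup>2) / 2 \<le> cmod (1 - cnj ?p * ?q)"
    using norm_sq_bounds(3)[OF q] norm_one_minus_cnj_mult(1)[OF p q] by simp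
  then have "((1 - (cmod ?q)\<^sup>2) / 2)\<^sup>2 \<le> (cmod (1 - cnj ?p * ?q))\<^sup>2"
    using qp by (intro power_mono) auto
  then have "(1 - (cmod z)\<^sup>2) * ((1 - (cmod ?q)\<^sup>2) / 2)\<^sup>2 \<le> (1 - (cmod ?p)\<^sup>2) * (1 - (cmod ?q)\<^sup>2)"
    using 1 norm_sq_bounds(1)[OF z] by (meson mult_left_mono order_trans less_imp_le)
  moreover have "Q * A \<le> 4 * P" if "A * (Q / 2)\<^sup>2 \<le> P * Q" "0 < Q" for A P Q :: real
  proof -
    have "(Q * A) * Q \<le> (4 * P) * Q" using that(1) by (simp add: power2_eq_square field_simps)
    then show ?thesis using that(2) by (rule mult_right_le_imp_le)
  qed
  ultimately show ?thesis using qp by blast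
qed

section \<open>Bloch norms and weakly null sequences\<close>

abbreviation bderiv :: "(complex \<Rightarrow> complex) \<Rightarrow> complex \<Rightarrow> real" where
  "bderiv f z \<equiv> (1 - (cmod z)\<^sup>2) * cmod (deriv f z)"

text \<open>\<open>enn2real\<close> sends infinity to 0, so the real norm carries information only
  for members of \<open>bloch_space\<close>; this is why membership accompanies every
  estimate.\<close>

definition bnorm :: "(complex \<Rightarrow> complex) \<Rightarrow> real" where
  "bnorm f = enn2real (bloch_norm f)"

lemma bderiv_nonneg: "cmod z < 1 \<Longrightarrow> 0 \<le> bderiv f z"
  using norm_sq_bounds(1)[of z] by simp

lemma bderiv_le_bloch_norm:
  assumes "cmod z < 1"
  shows "ennreal (cmod (f 0) + bderiv f z) \<le> bloch_norm f"
proof -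
  have "ennreal (cmod (f 0)) + ennreal (bderiv f z) \<le> bloch_norm f"
    unfolding bloch_norm_def using assms by (intro add_left_mono SUP_upper) simp
  then show ?thesis using bderiv_nonneg[OF assms, of f] by (simp add: ennreal_plus)
qed

lemma bloch_norm_le_iff:
  assumes "0 \<le> C"
  shows "bloch_norm f \<le> ennreal C \<longleftrightarrow> (\<forall>z. cmod z < 1 \<longrightarrow> cmod (f 0) + bderiv f z \<le> C)"
proof
  assume "bloch_norm f \<le> ennreal C"
  then have "ennreal (cmod (f 0) + bderiv f z) \<le> ennreal C" if "cmod z < 1" for z
    using order_trans[OF bderiv_le_bloch_norm[OF that]] by blast
  then show "\<forall>z. cmod z < 1 \<longrightarrow> cmod (f 0) + bderiv f z \<le> C"
    by (simp add: ennreal_le_iff[OF assms])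
next
  assume *: "\<forall>z. cmod z < 1 \<longrightarrow> cmod (f 0) + bderiv f z \<le> C"
  have "cmod (f 0) + cmod (deriv f 0) \<le> C" using *[rule_format, of 0] by simp
  then have "cmod (f 0) \<le> C" using norm_ge_zero[of "deriv f 0"] by linarith
  have "(SUP z\<in>unit_disc. ennreal (bderiv f z)) \<le> ennreal (C - cmod (f 0))"
    using * by (intro SUP_least ennreal_leI) (auto simp: algebra_simps)
  then have "bloch_norm f \<le> ennreal (cmod (f 0)) + ennreal (C - cmod (f 0))"
    unfolding bloch_norm_def by (rule add_left_mono)
  then show "bloch_norm f \<le> ennreal C"
    using \<open>cmod (f 0) \<le> C\<close> by (simp flip: ennreal_plus)
qed

lemma bloch_spaceI:
  assumes "f holomorphic_on unit_disc" "\<And>z. cmod z < 1 \<Longrightarrow> bderiv f z \<le> B"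
  shows "f \<in> bloch_space"
proof -
  have "(SUP z\<in>unit_disc. ennreal (bderiv f z)) \<le> ennreal B"
    using assms(2) by (intro SUP_least ennreal_leI) auto
  then have "(SUP z\<in>unit_disc. ennreal (bderiv f z)) < \<infinity>"
    by (rule order_le_less_trans) simp
  then show ?thesis using assms(1) unfolding bloch_space_def by simp
qed

lemma bloch_space_holomorphic: "f \<in> bloch_space \<Longrightarrow> f holomorphic_on unit_disc"
  by (simp add: bloch_space_def)

lemma bloch_norm_eq_bnorm: "f \<in> bloch_space \<Longrightarrow> bloch_norm f = ennreal (bnorm f)"
  unfolding bloch_space_def bloch_norm_def bnorm_def by (simp add: ennreal_add_eq_top less_top[symmetric])

lemma bnorm_nonneg [simp]: "0 \<le> bnorm f"
  by (simp add: bnorm_def)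

lemma bnorm_bound:
  assumes "f \<in> bloch_space" "cmod z < 1"
  shows "cmod (f 0) + bderiv f z \<le> bnorm f"
  using bderiv_le_bloch_norm[OF assms(2), of f] by (simp add: bloch_norm_eq_bnorm[OF assms(1)])

lemma bnorm_le:
  assumes "f \<in> bloch_space" "\<And>z. cmod z < 1 \<Longrightarrow> cmod (f 0) + bderiv f z \<le> C"
  shows "bnorm f \<le> C"
proof -
  have "cmod (f 0) + cmod (deriv f 0) \<le> C" using assms(2)[of 0] by simp
  then have "0 \<le> C" using norm_ge_zero[of "f 0"] norm_ge_zero[of "deriv f 0"] by linarith
  then have "bloch_norm f \<le> ennreal C" using assms(2) by (simp add: bloch_norm_le_iff)
  then show ?thesis using \<open>0 \<le> C\<close> by (simp add: bloch_norm_eq_bnorm[OF assms(1)])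
qed

lemma deriv_cong_disc:
  assumes "\<And>z. cmod z < 1 \<Longrightarrow> f z = g z" "cmod z < 1"
  shows "deriv f z = deriv g z"
proof (rule deriv_cong_ev)
  show "\<forall>\<^sub>F x in nhds z. f x = g x"
    using eventually_nhds_in_open[of unit_disc z] assms by (auto elim: eventually_mono)
qed simp

text \<open>The linearity clause of \<open>compact_bloch_op\<close> equates values inside the disc
  only, so norms have to be insensitive to values outside it.\<close>

lemma bloch_norm_cong:
  assumes "\<And>z. cmod z < 1 \<Longrightarrow> f z = g z"
  shows "bloch_norm f = bloch_norm g"
proof -
  have "(SUP z\<in>unit_disc. ennreal (bderiv f z)) = (SUP z\<in>unit_disc. ennreal (bderiv g z))"
    using deriv_cong_disc[of f g] assms by (intro SUP_cong) auto
  then show ?thesis unfolding bloch_norm_def using assms[of 0] by simp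
qed

lemma bnorm_cong: "(\<And>z. cmod z < 1 \<Longrightarrow> f z = g z) \<Longrightarrow> bnorm f = bnorm g"
  unfolding bnorm_def using bloch_norm_cong[of f g] by simp

lemma differentiable_disc:
  "f holomorphic_on unit_disc \<Longrightarrow> cmod z < 1 \<Longrightarrow> f field_differentiable at z"
  by (rule holomorphic_on_imp_differentiable_at[of _ unit_disc]) auto

lemma bloch_lincomb:
  assumes f: "f \<in> bloch_space" and g: "g \<in> bloch_space"
  shows "(\<lambda>z. a * f z + b * g z) \<in> bloch_space" (is ?A)
    and "bnorm (\<lambda>z. a * f z + b * g z) \<le> cmod a * bnorm f + cmod b * bnorm g" (is ?B)
proof -
  note h = bloch_space_holomorphic[OF f] bloch_space_holomorphic[OF g]
  have bd: "cmod (a * f 0 + b * g 0) + bderiv (\<lambda>z. a * f z + b * g z) z \<le> cmod a * bnorm f + cmod b * bnorm g"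
    if z: "cmod z < 1" for z
  proof -
    have d: "deriv (\<lambda>z. a * f z + b * g z) z = a * deriv f z + b * deriv g z"
      by (rule DERIV_imp_deriv)
        (rule derivative_eq_intros field_differentiable_derivI[OF differentiable_disc[OF h(1) z]]
          field_differentiable_derivI[OF differentiable_disc[OF h(2) z]] refl | simp)+
    have "bderiv (\<lambda>z. a * f z + b * g z) z \<le> (1 - (cmod z)\<^sup>2) * (cmod a * cmod (deriv f z) + cmod b * cmod (deriv g z))"
      unfolding d using norm_sq_bounds(1)[OF z] norm_triangle_ineq[of "a * deriv f z" "b * deriv g z"]
      by (intro mult_left_mono) (auto simp: norm_mult)
    also have "\<dots> = cmod a * bderiv f z + cmod b * bderiv g z" by (simp add: algebra_simps)
    finally have 1: "bderiv (\<lambda>z. a * f z + b * g z) z \<le> cmod a * bderiv f z + cmod b * bderiv g z" .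
    have 2: "cmod (a * f 0 + b * g 0) \<le> cmod a * cmod (f 0) + cmod b * cmod (g 0)"
      using norm_triangle_ineq[of "a * f 0" "b * g 0"] by (simp add: norm_mult)
    have "cmod a * (cmod (f 0) + bderiv f z) \<le> cmod a * bnorm f" "cmod b * (cmod (g 0) + bderiv g z) \<le> cmod b * bnorm g"
      using bnorm_bound[OF f z] bnorm_bound[OF g z] by (auto intro: mult_left_mono)
    then show ?thesis using 1 2 by (simp add: distrib_left)
  qed
  show A: ?A
  proof (rule bloch_spaceI)
    show "(\<lambda>z. a * f z + b * g z) holomorphic_on unit_disc" using h by (intro holomorphic_intros)
    show "bderiv (\<lambda>z. a * f z + b * g z) z \<le> cmod a * bnorm f + cmod b * bnorm g" if "cmod z < 1" for z
      using bd[OF that] norm_ge_zero[of "a * f 0 + b * g 0"] by linarith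
  qed
  show ?B by (rule bnorm_le[OF A bd])
qed

lemma bloch_diff:
  assumes "f \<in> bloch_space" "g \<in> bloch_space"
  shows "(\<lambda>z. f z - g z) \<in> bloch_space" "bnorm (\<lambda>z. f z - g z) \<le> bnorm f + bnorm g"
  using bloch_lincomb[OF assms, of 1 "-1"] by simp_all

lemma bloch_add:
  assumes "f \<in> bloch_space" "g \<in> bloch_space"
  shows "(\<lambda>z. f z + g z) \<in> bloch_space" "bnorm (\<lambda>z. f z + g z) \<le> bnorm f + bnorm g"
  using bloch_lincomb[OF assms, of 1 1] by simp_all

lemma bloch_const: "(\<lambda>z. c) \<in> bloch_space" "bnorm (\<lambda>z. c) = cmod c"
proof -
  show A: "(\<lambda>z. c) \<in> bloch_space" by (rule bloch_spaceI[of _ 0]) auto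
  show "bnorm (\<lambda>z. c) = cmod c"
    using bnorm_bound[OF A, of 0] bnorm_le[OF A, of "cmod c"] by simp
qed

lemma bloch_scale:
  assumes f: "f \<in> bloch_space"
  shows "(\<lambda>z. c * f z) \<in> bloch_space" "bnorm (\<lambda>z. c * f z) \<le> cmod c * bnorm f"
  using bloch_lincomb[OF f bloch_const(1), of c 0 0] by (simp_all add: bloch_const)

lemma bloch_sum:
  assumes "\<And>j. F j \<in> bloch_space"
  shows "(\<lambda>z. \<Sum>j<N. F j z) \<in> bloch_space \<and> bnorm (\<lambda>z. \<Sum>j<(N::nat). F j z) \<le> (\<Sum>j<N. bnorm (F j))"
proof (induction N)
  case 0
  show ?case using bloch_const[of 0] by simp
next
  case (Suc N)
  then show ?case using bloch_add[of "\<lambda>z. \<Sum>j<N. F j z" "F N"] assms[of N] by simp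
qed

text \<open>The clauses are the ones the gliding hump consumes: a uniform norm bound, membership of
  each function in the little Bloch space, and convergence to 0 on compact discs. The second makes
  every hump die out near the circle, the third makes late humps small inside.\<close>

definition weakly_null :: "real \<Rightarrow> (nat \<Rightarrow> complex \<Rightarrow> complex) \<Rightarrow> bool" where
  "weakly_null M F \<longleftrightarrow>
     (\<forall>n. F n \<in> bloch_space \<and> bnorm (F n) \<le> M) \<and>
     (\<forall>n e. e > 0 \<longrightarrow> (\<exists>r<1. \<forall>z. r < cmod z \<longrightarrow> cmod z < 1 \<longrightarrow> bderiv (F n) z \<le> e)) \<and>
     (\<forall>r e. r < 1 \<longrightarrow> e > 0 \<longrightarrow>
        (\<forall>\<^sub>F n in sequentially. cmod (F n 0) \<le> e \<and> (\<forall>z. cmod z \<le> r \<longrightarrow> bderiv (F n) z \<le> e)))"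

lemma weakly_null_subseq:
  assumes "weakly_null M F" "strict_mono r"
  shows "weakly_null M (\<lambda>n. F (r n))"
proof -
  have "\<forall>\<^sub>F n in sequentially. cmod (F (r n) 0) \<le> e \<and> (\<forall>z. cmod z \<le> s \<longrightarrow> bderiv (F (r n)) z \<le> e)"
    if "s < 1" "e > 0" for s e
  proof (rule eventually_subseq[OF assms(2)])
    show "\<forall>\<^sub>F n in sequentially. cmod (F n 0) \<le> e \<and> (\<forall>z. cmod z \<le> s \<longrightarrow> bderiv (F n) z \<le> e)"
      using assms(1) that unfolding weakly_null_def by simp
  qed
  then show ?thesis using assms(1) unfolding weakly_null_def by simp
qed

text \<open>The half-open intervals from \<open>R j\<close> to \<open>R (Suc j)\<close> tile the
  interval from \<open>R 0\<close> to \<open>R N\<close>, so no point is counted twice.\<close>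

lemma sliding_sum_le:
  fixes R :: "nat \<Rightarrow> real"
  assumes "mono R"
  shows "(\<Sum>j<N. if R j < x \<and> x \<le> R (Suc j) then M else 0) = (if R 0 < x \<and> x \<le> R N then M else (0::real))"
proof (induction N)
  case (Suc N)
  then show ?case using monoD[OF assms, of N "Suc N"] monoD[OF assms, of 0 N] by auto
qed simp

lemma sum_half_powers: "(\<Sum>j<N. (1/2) ^ j) \<le> (2::real)"
proof -
  have "(\<Sum>j<N. (1/2) ^ j) = 2 - 2 * (1/2::real) ^ N" by (induction N) auto
  then show ?thesis by simp
qed

text \<open>Gliding hump: a weakly null sequence has a subsequence (possibly with repetitions) whose
  partial sums stay bounded, since at every point at most one of the summands is not tiny.\<close>

lemma weakly_null_bounded_sums:
  assumes W: "weakly_null M H"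
  obtains k :: "nat \<Rightarrow> nat" where "\<forall>N. bnorm (\<lambda>z. \<Sum>j<N. H (k j) z) \<le> M + 4"
proof -
  have HB: "H n \<in> bloch_space" "bnorm (H n) \<le> M" for n using W unfolding weakly_null_def by auto
  have M0: "0 \<le> M" using bnorm_nonneg[of "H 0"] HB(2)[of 0] by linarith
  have little: "\<exists>r<1. \<forall>z. r < cmod z \<longrightarrow> cmod z < 1 \<longrightarrow> bderiv (H n) z \<le> e" if "e > 0" for n e
    using W that unfolding weakly_null_def by simp
  have small: "\<exists>n. cmod (H n 0) \<le> e \<and> (\<forall>z. cmod z \<le> r \<longrightarrow> bderiv (H n) z \<le> e)" if "r < 1" "e > 0" for r e
  proof -
    have "\<forall>\<^sub>F n in sequentially. cmod (H n 0) \<le> e \<and> (\<forall>z. cmod z \<le> r \<longrightarrow> bderiv (H n) z \<le> e)"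
      using W that unfolding weakly_null_def by simp
    from eventually_happens[OF this] show ?thesis by simp
  qed
  \<comment> \<open>The state is a pair of an index and a radius. \<open>P j\<close> makes the hump
    small inside its own radius, \<open>Q j\<close> makes it small outside the next radius, so it
    can be large only on the annulus between the two.\<close>
  define P :: "nat \<Rightarrow> nat \<times> real \<Rightarrow> bool" where
    "P j x \<longleftrightarrow> snd x < 1 \<and> cmod (H (fst x) 0) \<le> (1/2) ^ j \<and> (\<forall>z. cmod z \<le> snd x \<longrightarrow> bderiv (H (fst x)) z \<le> (1/2) ^ j)" for j x
  define Q :: "nat \<Rightarrow> nat \<times> real \<Rightarrow> nat \<times> real \<Rightarrow> bool" where
    "Q j x y \<longleftrightarrow> snd x \<le> snd y \<and> (\<forall>z. snd y < cmod z \<longrightarrow> cmod z < 1 \<longrightarrow> bderiv (H (fst x)) z \<le> (1/2) ^ j)" for j x y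
  have "\<exists>f. \<forall>j. P j (f j) \<and> Q j (f j) (f (Suc j))"
  proof (rule dependent_nat_choice)
    from small[of 0 1] obtain n where "cmod (H n 0) \<le> 1" "\<forall>z. cmod z \<le> 0 \<longrightarrow> bderiv (H n) z \<le> 1" by auto
    then have "P 0 (n, 0)" by (simp add: P_def)
    then show "\<exists>x. P 0 x" ..
  next
    fix x j assume x: "P j x"
    obtain r where r: "r < 1" "\<forall>z. r < cmod z \<longrightarrow> cmod z < 1 \<longrightarrow> bderiv (H (fst x)) z \<le> (1/2) ^ j"
      using little[of "(1/2) ^ j" "fst x"] by auto
    let ?R = "max r (snd x)"
    have R: "?R < 1" using r x by (simp add: P_def)
    obtain n where "cmod (H n 0) \<le> (1/2) ^ Suc j" "\<forall>z. cmod z \<le> ?R \<longrightarrow> bderiv (H n) z \<le> (1/2) ^ Suc j"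
      using small[OF R, of "(1/2) ^ Suc j"] by auto
    then have "P (Suc j) (n, ?R)" using R by (simp add: P_def)
    moreover have "Q j x (n, ?R)" using r by (simp add: Q_def)
    ultimately show "\<exists>y. P (Suc j) y \<and> Q j x y" by blast
  qed
  then obtain f where f: "\<And>j. P j (f j)" "\<And>j. Q j (f j) (f (Suc j))" by blast
  define k R where "k = (\<lambda>j. fst (f j))" and "R = (\<lambda>j. snd (f j))"
  have monoR: "mono R" using f(2) by (intro mono_iff_le_Suc[THEN iffD2]) (auto simp: R_def Q_def)
  have 0: "cmod (H (k j) 0) \<le> (1/2) ^ j" for j using f(1)[of j] by (simp add: P_def k_def)
  have d: "bderiv (H (k j)) z \<le> (1/2) ^ j + (if R j < cmod z \<and> cmod z \<le> R (Suc j) then M else 0)" if z: "cmod z < 1" for j z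
  proof -
    have M: "bderiv (H (k j)) z \<le> M"
      using bnorm_bound[OF HB(1)[of "k j"] z] HB(2)[of "k j"] norm_ge_zero[of "H (k j) 0"] by linarith
    have p: "(0::real) \<le> (1/2) ^ j" by simp
    show ?thesis
    proof (cases "R j < cmod z \<and> cmod z \<le> R (Suc j)")
      case True
      then have "(if R j < cmod z \<and> cmod z \<le> R (Suc j) then M else 0) = M" by simp
      then show ?thesis using M p by linarith
    next
      case False
      then show ?thesis using f[of j] z unfolding P_def Q_def k_def R_def by auto
    qed
  qed
  have "bnorm (\<lambda>z. \<Sum>j<N. H (k j) z) \<le> M + 4" for N
  proof (rule bnorm_le)
    show "(\<lambda>z. \<Sum>j<N. H (k j) z) \<in> bloch_space" using bloch_sum[of "\<lambda>j. H (k j)"] HB(1) by blast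
    fix z :: complex assume z: "cmod z < 1"
    have "cmod (\<Sum>j<N. H (k j) 0) \<le> (\<Sum>j<N. (1/2) ^ j)" using 0 by (intro sum_norm_le) auto
    then have 1: "cmod (\<Sum>j<N. H (k j) 0) \<le> 2" using sum_half_powers[of N] by simp
    have "deriv (\<lambda>z. \<Sum>j<N. H (k j) z) z = (\<Sum>j<N. deriv (H (k j)) z)"
      using differentiable_disc[OF bloch_space_holomorphic[OF HB(1)] z] by (intro deriv_sum) auto
    then have "bderiv (\<lambda>z. \<Sum>j<N. H (k j) z) z \<le> (1 - (cmod z)\<^sup>2) * (\<Sum>j<N. cmod (deriv (H (k j)) z))"
      using norm_sq_bounds(1)[OF z] norm_sum by (intro mult_left_mono) auto
    also have "\<dots> = (\<Sum>j<N. bderiv (H (k j)) z)" by (simp add: sum_distrib_left)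
    also have "\<dots> \<le> (\<Sum>j<N. (1/2) ^ j + (if R j < cmod z \<and> cmod z \<le> R (Suc j) then M else 0))"
      by (intro sum_mono d z)
    also have "\<dots> = (\<Sum>j<N. (1/2) ^ j) + (if R 0 < cmod z \<and> cmod z \<le> R N then M else 0)"
      by (simp only: sum.distrib sliding_sum_le[OF monoR])
    \<comment> \<open>At most one hump contributes \<open>M\<close> and the tails sum to at most 2;
      the values at the origin contribute another 2, whence \<open>M + 4\<close>.\<close>
    also have "\<dots> \<le> 2 + M" using sum_half_powers[of N] M0 by (intro add_mono) auto
    finally show "cmod (\<Sum>j<N. H (k j) 0) + bderiv (\<lambda>z. \<Sum>j<N. H (k j) z) z \<le> M + 4" using 1 by simp
  qed
  then show thesis using that by blast
qed

section \<open>Compact operators on weakly null sequences\<close>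

lemma compact_bloch_op_lincomb:
  assumes "compact_bloch_op K" "f \<in> bloch_space" "g \<in> bloch_space" "cmod z < 1"
  shows "K (\<lambda>w. a * f w + b * g w) z = a * K f z + b * K g z"
  using assms unfolding compact_bloch_op_def by auto

lemma compact_bloch_op_sum:
  assumes K: "compact_bloch_op K" and F: "\<And>j. F j \<in> bloch_space" and z: "cmod z < 1"
  shows "K (\<lambda>w. \<Sum>j<(N::nat). F j w) z = (\<Sum>j<N. K (F j) z)"
proof (induction N)
  case 0
  show ?case using compact_bloch_op_lincomb[OF K bloch_const(1) bloch_const(1) z, of 0 0 0 0] by simp
next
  case (Suc N)
  have "(\<lambda>w. \<Sum>j<N. F j w) \<in> bloch_space" using bloch_sum[of F] F by blast
  then show ?case using compact_bloch_op_lincomb[OF K _ F[of N] z, of "\<lambda>w. \<Sum>j<N. F j w" 1 1] Suc by simp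
qed

lemma compact_bloch_opD:
  fixes F :: "nat \<Rightarrow> complex \<Rightarrow> complex"
  assumes K: "compact_bloch_op K" and F: "\<And>n. F n \<in> bloch_space" "\<And>n. bnorm (F n) \<le> M"
  obtains r g where "strict_mono r" "g \<in> bloch_space" "(\<lambda>n. bnorm (\<lambda>z. K (F (r n)) z - g z)) \<longlonglongrightarrow> 0"
proof -
  have "\<forall>n. bloch_norm (F n) \<le> ennreal M" using F by (simp add: bloch_norm_eq_bnorm ennreal_leI)
  moreover have "(\<forall>n. F n \<in> bloch_space) \<and> (\<exists>M::real. \<forall>n. bloch_norm (F n) \<le> ennreal M) \<longrightarrow>
      (\<exists>r g. strict_mono r \<and> g \<in> bloch_space \<and> (\<lambda>n. bloch_norm (\<lambda>z. K (F (r n)) z - g z)) \<longlonglongrightarrow> 0)"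
    by (rule K[unfolded compact_bloch_op_def, THEN conjunct2, THEN conjunct2, THEN spec, of F])
  ultimately obtain r g where rg: "strict_mono r" "g \<in> bloch_space" "(\<lambda>n. bloch_norm (\<lambda>z. K (F (r n)) z - g z)) \<longlonglongrightarrow> 0"
    using F(1) by blast
  have KF: "K (F n) \<in> bloch_space" for n using K F(1) unfolding compact_bloch_op_def by blast
  have "(\<lambda>n. ennreal (bnorm (\<lambda>z. K (F (r n)) z - g z))) \<longlonglongrightarrow> ennreal 0"
    using rg(3) bloch_norm_eq_bnorm[OF bloch_diff(1)[OF KF rg(2)]] by simp
  then have "(\<lambda>n. bnorm (\<lambda>z. K (F (r n)) z - g z)) \<longlonglongrightarrow> 0"
    by (subst (asm) tendsto_ennreal_iff) auto
  with rg show thesis using that by blast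
qed

text \<open>Otherwise a subsequence of the images stays close to one nonzero \<open>g\<close>.
  Partial sums of a gliding hump then remain bounded while their images grow like \<open>N\<close>
  times \<open>g\<close>, which contradicts compactness. No description of the dual space is needed
  for this argument.\<close>

lemma compact_bloch_op_weakly_null:
  assumes K: "compact_bloch_op K" and W: "weakly_null M F"
  shows "(\<lambda>n. bnorm (K (F n))) \<longlonglongrightarrow> 0"
proof (rule ccontr)
  assume "\<not> ?thesis"
  then obtain e where e: "e > 0" and "\<not> (\<forall>\<^sub>F n in sequentially. dist (bnorm (K (F n))) 0 < e)"
    unfolding tendsto_iff by blast
  then have ev: "\<not> (\<forall>\<^sub>F n in sequentially. bnorm (K (F n)) < e)" by simp
  have "infinite {n. e \<le> bnorm (K (F n))}"
  proof
    assume "finite {n. e \<le> bnorm (K (F n))}"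
    then have "\<forall>\<^sub>F n in sequentially. n \<notin> {n. e \<le> bnorm (K (F n))}"
      unfolding cofinite_eq_sequentially[symmetric] eventually_cofinite by simp
    with ev show False by (auto simp: not_le)
  qed
  then obtain r1 where r1: "strict_mono (r1 :: nat \<Rightarrow> nat)" "\<And>n. e \<le> bnorm (K (F (r1 n)))"
    using infinite_enumerate[of "{n. e \<le> bnorm (K (F n))}"] by auto
  have W1: "weakly_null M (\<lambda>n. F (r1 n))" by (rule weakly_null_subseq[OF W r1(1)])
  have F1: "F (r1 n) \<in> bloch_space" "bnorm (F (r1 n)) \<le> M" for n using W1 unfolding weakly_null_def by auto
  obtain r2 g where r2: "strict_mono r2" "g \<in> bloch_space"
    "(\<lambda>n. bnorm (\<lambda>z. K (F (r1 (r2 n))) z - g z)) \<longlonglongrightarrow> 0"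
    by (rule compact_bloch_opD[OF K F1])
  have "\<forall>\<^sub>F n in sequentially. bnorm (\<lambda>z. K (F (r1 (r2 n))) z - g z) < e/4"
    using r2(3) e by (intro order_tendstoD(2)) auto
  then obtain N0 where N0: "\<And>n. N0 \<le> n \<Longrightarrow> bnorm (\<lambda>z. K (F (r1 (r2 n))) z - g z) < e/4"
    unfolding eventually_sequentially by blast
  \<comment> \<open>Dropping the first \<open>N0\<close> terms puts every image within
    \<open>e/4\<close> of \<open>g\<close>, so \<open>g\<close> has norm at least
    \<open>3/4 * e\<close>.\<close>
  define H where "H = (\<lambda>n. F (r1 (r2 (n + N0))))"
  have "strict_mono (\<lambda>n. r2 (n + N0))" using r2(1) by (auto simp: strict_mono_def)
  then have WH: "weakly_null M H" unfolding H_def using weakly_null_subseq[OF W1] by blast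
  have HB: "H n \<in> bloch_space" for n using WH unfolding weakly_null_def by auto
  have KB: "K f \<in> bloch_space" if "f \<in> bloch_space" for f using K that unfolding compact_bloch_op_def by blast
  have He: "bnorm (\<lambda>z. K (H n) z - g z) \<le> e/4" for n using N0[of "n + N0"] by (simp add: H_def)
  have "e \<le> bnorm (K (H 0))" using r1(2) by (simp add: H_def)
  also have "\<dots> = bnorm (\<lambda>z. (K (H 0) z - g z) + g z)" by simp
  also have "\<dots> \<le> bnorm (\<lambda>z. K (H 0) z - g z) + bnorm g"
    by (intro bloch_add(2) bloch_diff(1) KB HB r2(2))
  finally have g: "3/4 * e \<le> bnorm g" using He[of 0] by simp
  obtain k :: "nat \<Rightarrow> nat" where k: "\<forall>N. bnorm (\<lambda>z. \<Sum>j<N. H (k j) z) \<le> M + 4"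
    by (rule weakly_null_bounded_sums[OF WH])
  define S where "S = (\<lambda>N::nat. \<lambda>z. \<Sum>j<N. H (k j) z)"
  have SB: "S N \<in> bloch_space" "bnorm (S N) \<le> M + 4" for N
    using k bloch_sum[of "\<lambda>j. H (k j)"] HB by (auto simp: S_def)
  \<comment> \<open>\<open>K (S N)\<close> differs from \<open>N\<close> times \<open>g\<close> by
    \<open>N\<close> errors of norm at most \<open>e/4\<close>; the norm left is \<open>N\<close>
    times \<open>3/4 * e - e/4\<close>.\<close>
  have KS: "real N * (e/2) \<le> bnorm (K (S N))" for N
  proof -
    have KSz: "K (S N) z = (\<Sum>j<N. K (H (k j)) z)" if "cmod z < 1" for z
      unfolding S_def by (rule compact_bloch_op_sum[OF K HB that])
    have DB: "(\<lambda>z. K (H (k j)) z - g z) \<in> bloch_space" for j by (intro bloch_diff(1) KB HB r2(2))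
    \<comment> \<open>\<open>bloch_scale\<close> is only an upper bound; scaling back by
      \<open>1 / N\<close> supplies the reverse inequality.\<close>
    have "real N * bnorm g = bnorm (\<lambda>z. of_nat N * g z)"
    proof (cases "N = 0")
      case True then show ?thesis using bloch_const(2)[of 0] by simp
    next
      case False
      have "bnorm g = bnorm (\<lambda>z. (1 / of_nat N) * (of_nat N * g z))" using False by simp
      also have "\<dots> \<le> (1 / real N) * bnorm (\<lambda>z. of_nat N * g z)"
        using bloch_scale(2)[OF bloch_scale(1)[OF r2(2)], of "1 / of_nat N" "of_nat N"] by (simp add: norm_divide)
      finally have "real N * bnorm g \<le> bnorm (\<lambda>z. of_nat N * g z)" using False by (simp add: field_simps)
      then show ?thesis using bloch_scale(2)[OF r2(2), of "of_nat N"] by simp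
    qed
    also have "\<dots> = bnorm (\<lambda>z. K (S N) z - (\<Sum>j<N. K (H (k j)) z - g z))"
      by (rule bnorm_cong) (simp add: KSz sum_subtractf)
    also have "\<dots> \<le> bnorm (K (S N)) + bnorm (\<lambda>z. \<Sum>j<N. K (H (k j)) z - g z)"
      using bloch_sum[of "\<lambda>j z. K (H (k j)) z - g z" N] DB by (intro bloch_diff(2) KB SB) auto
    also have "bnorm (\<lambda>z. \<Sum>j<N. K (H (k j)) z - g z) \<le> (\<Sum>j<N. bnorm (\<lambda>z. K (H (k j)) z - g z))"
      using bloch_sum[of "\<lambda>j z. K (H (k j)) z - g z" N] DB by auto
    also have "\<dots> \<le> real N * (e/4)" using sum_bounded_above[of "{..<N}" "\<lambda>j. bnorm (\<lambda>z. K (H (k j)) z - g z)" "e/4"] He by simp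
    finally have "real N * bnorm g \<le> bnorm (K (S N)) + real N * (e/4)" by simp
    moreover have "real N * (3/4 * e) \<le> real N * bnorm g" using g by (intro mult_left_mono) auto
    ultimately show ?thesis by (simp add: field_simps)
  qed
  obtain r G where r: "strict_mono r" "G \<in> bloch_space" "(\<lambda>n. bnorm (\<lambda>z. K (S (r n)) z - G z)) \<longlonglongrightarrow> 0"
    by (rule compact_bloch_opD[OF K SB])
  have "\<forall>\<^sub>F n in sequentially. bnorm (\<lambda>z. K (S (r n)) z - G z) < 1"
    using r(3) by (intro order_tendstoD(2)) auto
  then obtain n0 where n0: "\<And>n. n0 \<le> n \<Longrightarrow> bnorm (\<lambda>z. K (S (r n)) z - G z) < 1"
    unfolding eventually_sequentially by blast
  obtain m :: nat where m: "1 + bnorm G < real m * (e/2)"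
    \<comment> \<open>Near the limit \<open>G\<close> the images have norm below
      \<open>1 + bnorm G\<close>, whereas \<open>r n \<ge> n\<close> makes their lower bound
      arbitrarily large.\<close>
    using ex_less_of_nat_mult[of "e/2" "1 + bnorm G"] e by auto
  define n where "n = max m n0"
  have n: "m \<le> n" "bnorm (\<lambda>z. K (S (r n)) z - G z) < 1" using n0[of n] by (auto simp: n_def)
  have "bnorm (K (S (r n))) = bnorm (\<lambda>z. (K (S (r n)) z - G z) + G z)" by simp
  also have "\<dots> \<le> bnorm (\<lambda>z. K (S (r n)) z - G z) + bnorm G"
    by (intro bloch_add(2) bloch_diff(1) KB SB r(2))
  finally have "bnorm (K (S (r n))) < real m * (e/2)" using n(2) m by simp
  moreover have "real m * (e/2) \<le> real (r n) * (e/2)"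
    using n(1) seq_suble[OF r(1), of n] e by (intro mult_right_mono) auto
  ultimately show False using KS[of "r n"] by simp
qed

lemma wcomp_mem_bloch: "wcomp_bounded_bloch u \<phi> \<Longrightarrow> f \<in> bloch_space \<Longrightarrow> wcomp u \<phi> f \<in> bloch_space"
  by (simp add: wcomp_bounded_bloch_def)

text \<open>A compact \<open>K\<close> within \<open>k\<close> of the operator exists because the
  infimum is strictly below \<open>k\<close>. The difference contributes \<open>M * k\<close> by
  homogeneity, and the image under \<open>K\<close> is eventually below a further
  \<open>k\<close>.\<close>

lemma ess_norm_weakly_null:
  assumes T: "wcomp_bounded_bloch u \<phi>" and ess: "bloch_ess_norm (wcomp u \<phi>) < ennreal k"
    and W: "weakly_null M F" and M: "0 < M"
  shows "\<forall>\<^sub>F n in sequentially. bnorm (wcomp u \<phi> (F n)) \<le> (M + 1) * k"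
proof -
  have "0 < ennreal k" using ess by (rule order_le_less_trans[OF zero_le])
  then have k: "0 < k" by simp
  obtain K where K: "compact_bloch_op K" and opn: "bloch_opnorm_diff (wcomp u \<phi>) K < ennreal k"
    using ess unfolding bloch_ess_norm_def INF_less_iff by auto
  have FB: "F n \<in> bloch_space" "bnorm (F n) \<le> M" for n using W unfolding weakly_null_def by auto
  have TF: "wcomp u \<phi> (F n) \<in> bloch_space" for n by (rule wcomp_mem_bloch[OF T FB(1)])
  have KF: "K (F n) \<in> bloch_space" for n using K FB(1) unfolding compact_bloch_op_def by blast
  have diff: "bnorm (\<lambda>z. wcomp u \<phi> (F n) z - K (F n) z) \<le> M * k" for n
  proof -
    \<comment> \<open>The distance of the operators is a supremum over the unit ball, so
      \<open>F n\<close> is normalised before it is tested.\<close>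
    define f where "f = (\<lambda>z. (1 / of_real M) * F n z)"
    have fB: "f \<in> bloch_space" unfolding f_def by (rule bloch_scale(1)[OF FB(1)])
    have "bnorm f \<le> cmod (1 / of_real M) * bnorm (F n)" unfolding f_def by (rule bloch_scale(2)[OF FB(1)])
    also have "\<dots> \<le> 1" using FB(2)[of n] M by (simp add: norm_divide field_simps)
    finally have "bloch_norm f \<le> 1" using bloch_norm_eq_bnorm[OF fB] ennreal_leI[of "bnorm f" 1] by simp
    then have "bloch_norm (\<lambda>z. wcomp u \<phi> f z - K f z) \<le> bloch_opnorm_diff (wcomp u \<phi>) K"
      unfolding bloch_opnorm_diff_def using fB by (intro SUP_upper) auto
    also have "\<dots> \<le> ennreal k" using opn by simp
    finally have 1: "bloch_norm (\<lambda>z. wcomp u \<phi> f z - K f z) \<le> ennreal k" .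
    have DB: "(\<lambda>z. wcomp u \<phi> f z - K f z) \<in> bloch_space"
      using K fB by (intro bloch_diff(1) wcomp_mem_bloch[OF T]) (auto simp: compact_bloch_op_def)
    have 2: "bnorm (\<lambda>z. wcomp u \<phi> f z - K f z) \<le> k"
      using 1 k by (simp add: bloch_norm_eq_bnorm[OF DB])
    have "K f z = (1 / of_real M) * K (F n) z" if "cmod z < 1" for z
      using compact_bloch_op_lincomb[OF K FB(1)[of n] bloch_const(1) that, of "1 / of_real M" 0 0] by (simp add: f_def)
    then have "bnorm (\<lambda>z. wcomp u \<phi> (F n) z - K (F n) z) = bnorm (\<lambda>z. of_real M * (wcomp u \<phi> f z - K f z))"
      using M by (intro bnorm_cong) (simp add: wcomp_def f_def algebra_simps)
    also have "\<dots> \<le> M * bnorm (\<lambda>z. wcomp u \<phi> f z - K f z)" using bloch_scale(2)[OF DB, of "of_real M"] M by simp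
    also have "\<dots> \<le> M * k" using 2 M by (intro mult_left_mono) auto
    finally show ?thesis .
  qed
  have "\<forall>\<^sub>F n in sequentially. bnorm (K (F n)) < k"
    using compact_bloch_op_weakly_null[OF K W] k by (intro order_tendstoD(2)) auto
  then show ?thesis
  proof eventually_elim
    case (elim n)
    have "bnorm (wcomp u \<phi> (F n)) = bnorm (\<lambda>z. (wcomp u \<phi> (F n) z - K (F n) z) + K (F n) z)" by simp
    also have "\<dots> \<le> bnorm (\<lambda>z. wcomp u \<phi> (F n) z - K (F n) z) + bnorm (K (F n))"
      by (intro bloch_add(2) bloch_diff(1) TF KF)
    finally show ?case using diff[of n] elim by (simp add: algebra_simps)
  qed
qed

section \<open>Area integrals over the disc\<close>

lemma enn_powr_le_iff:
  assumes "0 \<le> c" "0 < p"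
  shows "enn_powr x p \<le> ennreal c \<longleftrightarrow> x \<le> ennreal (c powr (1/p))"
proof (cases x)
  case (real r)
  have "r powr p \<le> c \<longleftrightarrow> r \<le> c powr (1/p)"
  proof
    assume "r powr p \<le> c"
    then have "(r powr p) powr (1/p) \<le> c powr (1/p)" using assms by (intro powr_mono2) auto
    then show "r \<le> c powr (1/p)" using assms real by (simp add: powr_powr)
  next
    assume "r \<le> c powr (1/p)"
    then have "r powr p \<le> (c powr (1/p)) powr p" using assms real by (intro powr_mono2) auto
    then show "r powr p \<le> c" using assms by (simp add: powr_powr)
  qed
  then show ?thesis using real assms by (simp add: enn_powr_def)
next
  case top
  then show ?thesis by (simp add: enn_powr_def top_unique)
qed

lemma A2_norm_le_iff:
  assumes "0 \<le> c"
  shows "A2_norm f \<le> ennreal c \<longleftrightarrow>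
    set_nn_integral lborel unit_disc (\<lambda>z. ennreal ((cmod (f z))\<^sup>2 / pi)) \<le> ennreal (c\<^sup>2)"
  unfolding A2_norm_def using enn_powr_le_iff[OF assms, of "1/2"] assms by (simp add: powr_numeral)

lemma emeasure_disc: "0 \<le> r \<Longrightarrow> emeasure lborel (ball (0::complex) r) = ennreal (pi * r\<^sup>2)"
  by (simp add: emeasure_ball unit_ball_vol_2)

lemma emeasure_annulus:
  assumes "0 \<le> r" "r \<le> 1"
  shows "emeasure lborel (ball 0 1 - ball (0::complex) r) = ennreal (pi * (1 - r\<^sup>2))"
proof -
  have "emeasure lborel (ball 0 1 - ball (0::complex) r) = emeasure lborel (ball (0::complex) 1) - emeasure lborel (ball (0::complex) r)"
    using assms by (intro emeasure_Diff) (auto simp: emeasure_disc)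
  also have "\<dots> = ennreal (pi * 1\<^sup>2) - ennreal (pi * r\<^sup>2)" using assms by (simp only: emeasure_disc)
  also have "\<dots> = ennreal (pi * (1 - r\<^sup>2))" using assms
    by (subst ennreal_minus) (auto simp: algebra_simps)
  finally show ?thesis .
qed

lemma term_le_suminf: "f k \<le> (\<Sum>k. f k)" for f :: "nat \<Rightarrow> ennreal"
  using sum_le_suminf[of f "{k}"] by simp

text \<open>Annuli with inner radius \<open>1 - (1/4)^k\<close> replace polar coordinates. In the
  layer between annulus \<open>k\<close> and the next one the weight is at most
  \<open>2^(k+1)\<close>, and annulus \<open>k\<close> has normalised area at most
  \<open>2 * (1/4)^k\<close>, so the sum is dominated by the geometric series of
  \<open>4 * (1/2)^k\<close>.\<close>

lemma nn_integral_disc_weight: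
  "set_nn_integral lborel unit_disc (\<lambda>z. ennreal ((1 - cmod z) powr (- 1/2) / pi)) \<le> ennreal 8"
proof -
  define A where "A k = ball 0 1 - ball (0::complex) (1 - (1/4) ^ k)" for k :: nat
  have [measurable]: "A k \<in> sets borel" for k by (simp add: A_def)
  have le: "ennreal ((1 - cmod z) powr (- 1/2) / pi) * indicator unit_disc z
     \<le> (\<Sum>k. ennreal (2 ^ (k + 1) / pi) * indicator (A k) z)" for z
  proof (cases "cmod z < 1")
    case True
    define d where "d = 1 - cmod z"
    have d: "0 < d" "d \<le> 1" using True by (auto simp: d_def)
    have "\<exists>k. (1/4) ^ k < d" using real_arch_pow_inv[of d "1/4"] d by auto
    \<comment> \<open>\<open>m\<close> is the first exponent with \<open>(1/4)^m\<close> below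
      \<open>d\<close>. The point lies in the annulus with index \<open>m - 1\<close>, which
      explains the exponent \<open>k + 1\<close> of the weight.\<close>
    define m where "m = (LEAST k. (1/4) ^ k < d)"
    have m: "(1/4) ^ m < d" unfolding m_def using \<open>\<exists>k. (1/4) ^ k < d\<close> by (rule LeastI_ex)
    have "m \<noteq> 0" using m d by (cases m) auto
    then obtain k where k: "m = Suc k" by (cases m) auto
    have dk: "d \<le> (1/4) ^ k" using not_less_Least[of k "\<lambda>k. (1/4) ^ k < d"] k by (simp add: m_def)
    have zA: "z \<in> A k" using dk True by (simp add: A_def d_def)
    have "d powr (-1/2) \<le> ((1/4) ^ m) powr (-1/2)" using m d by (intro powr_mono2') auto
    also have "\<dots> = 2 ^ m"
    proof -
      have q: "(4::real) ^ m = (2 ^ m)\<^sup>2" by (simp add: power2_eq_square flip: power_mult_distrib)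
      have "((1/4::real) ^ m) = (2 ^ m) powr (-2)"
        by (simp add: powr_minus powr_numeral power_one_over q inverse_eq_divide)
      then show ?thesis by (simp add: powr_powr)
    qed
    finally have "(1 - cmod z) powr (-1/2) / pi \<le> 2 ^ (k + 1) / pi" by (simp add: d_def k divide_right_mono)
    then have "ennreal ((1 - cmod z) powr (- 1/2) / pi) * indicator unit_disc z \<le> ennreal (2 ^ (k + 1) / pi) * indicator (A k) z"
      using zA True by (simp add: ennreal_leI)
    also have "\<dots> \<le> (\<Sum>k. ennreal (2 ^ (k + 1) / pi) * indicator (A k) z)" by (rule term_le_suminf)
    finally show ?thesis .
  qed simp
  have "set_nn_integral lborel unit_disc (\<lambda>z. ennreal ((1 - cmod z) powr (- 1/2) / pi))
     \<le> (\<integral>\<^sup>+z. (\<Sum>k. ennreal (2 ^ (k + 1) / pi) * indicator (A k) z) \<partial>lborel)"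
    by (intro nn_integral_mono le)
  also have "\<dots> = (\<Sum>k. \<integral>\<^sup>+z. ennreal (2 ^ (k + 1) / pi) * indicator (A k) z \<partial>lborel)"
    by (rule nn_integral_suminf) simp
  also have "\<dots> = (\<Sum>k. ennreal (2 ^ (k + 1) / pi) * emeasure lborel (A k))"
    by (intro suminf_cong nn_integral_cmult_indicator) (simp add: A_def)
  also have "\<dots> \<le> (\<Sum>k. ennreal (4 * (1/2) ^ k))"
  proof (intro suminf_le)
    fix k :: nat
    define q where "q = (1/4::real) ^ k"
    have q: "0 \<le> q" "q \<le> 1" by (auto simp: q_def power_le_one)
    have "1 - (1 - q)\<^sup>2 \<le> 2 * q" by (simp add: power2_eq_square algebra_simps)
    then have 1: "2 ^ (k + 1) / pi * (pi * (1 - (1 - q)\<^sup>2)) \<le> 2 ^ (k + 1) * (2 * q)" by simp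
    have "2 ^ (k + 1) * (2 * q) = 4 * (1/2) ^ k"
    proof -
      have "(2::real) ^ k * (1/4) ^ k = (1/2) ^ k" by (simp flip: power_mult_distrib)
      then show ?thesis by (simp add: q_def)
    qed
    with 1 have "2 ^ (k + 1) / pi * (pi * (1 - (1 - q)\<^sup>2)) \<le> 4 * (1/2) ^ k" by (simp only:)
    moreover have "ennreal (2 ^ (k + 1) / pi) * emeasure lborel (A k) = ennreal (2 ^ (k + 1) / pi * (pi * (1 - (1 - q)\<^sup>2)))"
    proof -
      have "emeasure lborel (A k) = ennreal (pi * (1 - (1 - q)\<^sup>2))"
        unfolding A_def q_def[symmetric] using q by (intro emeasure_annulus) auto
      then show ?thesis by (simp only: ennreal_mult'[symmetric] divide_nonneg_nonneg zero_le_power zero_le_numeral pi_ge_zero)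
    qed
    ultimately show "ennreal (2 ^ (k + 1) / pi) * emeasure lborel (A k) \<le> ennreal (4 * (1/2) ^ k)"
      by (simp only: ennreal_leI)
  qed auto
  also have "\<dots> = ennreal (\<Sum>k. 4 * (1/2) ^ k)"
    by (intro suminf_ennreal2) (auto intro!: summable_mult summable_geometric)
  also have "(\<Sum>k. 4 * (1/2::real) ^ k) = 8" by (simp add: suminf_mult suminf_geometric summable_geometric)
  finally show ?thesis .
qed

text \<open>Beyond \<open>R\<close> the squared weight is written as
  \<open>(1 - cmod z) powr (1/4)\<close> times the integrable weight with exponent
  \<open>- 1/2\<close>. The first factor is at most \<open>(1 - R) powr (1/4)\<close>, so the crude
  bound \<open>M\<close> enters only with a small coefficient.\<close>

lemma A2_norm_split:
  assumes K: "0 \<le> K" and M: "0 \<le> M" and R: "R < 1"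
    and F1: "\<And>z. cmod z < 1 \<Longrightarrow> cmod z \<le> R \<Longrightarrow> cmod (F z) \<le> K * (1 - cmod z) powr (- 1/8)"
    and F2: "\<And>z. cmod z < 1 \<Longrightarrow> cmod (F z) \<le> M * (1 - cmod z) powr (- 1/8)"
  shows "A2_norm F \<le> ennreal (sqrt (8 * (K\<^sup>2 + M\<^sup>2 * (1 - R) powr (1/4))))"
proof -
  define c where "c = K\<^sup>2 + M\<^sup>2 * (1 - R) powr (1/4)"
  have c: "0 \<le> c" by (simp add: c_def)
  have bd: "(cmod (F z))\<^sup>2 \<le> c * (1 - cmod z) powr (-1/2)" if z: "cmod z < 1" for z
  proof -
    have d: "0 < 1 - cmod z" "1 - cmod z \<le> 1" using z by auto
    have sq: "((1 - cmod z) powr (-1/8))\<^sup>2 = (1 - cmod z) powr (-1/4)"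
      using d by (simp add: power2_eq_square flip: powr_add)
    have eq: "(1 - cmod z) powr (-1/4) = (1 - cmod z) powr (1/4) * (1 - cmod z) powr (-1/2)"
      using d by (simp flip: powr_add)
    show ?thesis
    proof (cases "cmod z \<le> R")
      case True
      have "(cmod (F z))\<^sup>2 \<le> (K * (1 - cmod z) powr (- 1/8))\<^sup>2" using F1[OF z True] by (intro power_mono) auto
      also have "\<dots> = K\<^sup>2 * ((1 - cmod z) powr (1/4) * (1 - cmod z) powr (-1/2))" unfolding power_mult_distrib sq eq ..
      also have "\<dots> \<le> K\<^sup>2 * (1 * (1 - cmod z) powr (-1/2))" using d by (intro mult_left_mono mult_right_mono powr_le1) auto
      also have "\<dots> \<le> c * (1 - cmod z) powr (-1/2)" by (auto simp: c_def intro!: mult_right_mono)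
      finally show ?thesis .
    next
      case False
      have "(cmod (F z))\<^sup>2 \<le> (M * (1 - cmod z) powr (- 1/8))\<^sup>2" using F2[OF z] by (intro power_mono) auto
      also have "\<dots> = M\<^sup>2 * ((1 - cmod z) powr (1/4) * (1 - cmod z) powr (-1/2))" unfolding power_mult_distrib sq eq ..
      also have "\<dots> \<le> M\<^sup>2 * ((1 - R) powr (1/4) * (1 - cmod z) powr (-1/2))"
        using d False by (intro mult_left_mono mult_right_mono powr_mono2) auto
      also have "\<dots> \<le> c * (1 - cmod z) powr (-1/2)" by (auto simp: c_def algebra_simps)
      finally show ?thesis .
    qed
  qed
  have "set_nn_integral lborel unit_disc (\<lambda>z. ennreal ((cmod (F z))\<^sup>2 / pi))
     \<le> (\<integral>\<^sup>+z. ennreal c * (ennreal ((1 - cmod z) powr (- 1/2) / pi) * indicator unit_disc z) \<partial>lborel)"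
  proof (intro nn_integral_mono)
    fix z
    show "ennreal ((cmod (F z))\<^sup>2 / pi) * indicator unit_disc z
       \<le> ennreal c * (ennreal ((1 - cmod z) powr (- 1/2) / pi) * indicator unit_disc z)"
    proof (cases "cmod z < 1")
      case True
      have "(cmod (F z))\<^sup>2 / pi \<le> c * ((1 - cmod z) powr (- 1/2) / pi)" using bd[OF True] by (simp add: divide_right_mono)
      then show ?thesis using True c by (simp add: ennreal_leI flip: ennreal_mult')
    qed simp
  qed
  also have "\<dots> = ennreal c * (\<integral>\<^sup>+z. ennreal ((1 - cmod z) powr (- 1/2) / pi) * indicator unit_disc z \<partial>lborel)"
  proof (rule nn_integral_cmult)
    have [measurable]: "unit_disc \<in> sets borel" by simp
    show "(\<lambda>z. ennreal ((1 - cmod z) powr (- 1/2) / pi) * indicator unit_disc z) \<in> borel_measurable lborel" by measurable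
  qed
  also have "\<dots> \<le> ennreal c * ennreal 8" by (intro mult_left_mono nn_integral_disc_weight) simp
  also have "\<dots> = ennreal (c * 8)" using c by (rule ennreal_mult'[symmetric])
  also have "\<dots> = ennreal ((sqrt (8 * c))\<^sup>2)" using c by (simp add: mult.commute)
  finally show ?thesis using c by (subst A2_norm_le_iff) (auto simp: c_def)
qed

section \<open>Plane Lebesgue measure as a product measure, and its invariance under
  rotations\<close>

lemma lborel_complex_eq: "lborel = distr (lborel \<Otimes>\<^sub>M lborel) borel (\<lambda>(x, y). Complex x y)"
proof (rule lborel_eqI)
  fix l u :: complex assume lu: "\<And>b. b \<in> Basis \<Longrightarrow> l \<bullet> b \<le> u \<bullet> b"
  have m: "(\<lambda>(x, y). Complex x y) \<in> borel_measurable (lborel \<Otimes>\<^sub>M lborel)"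
    unfolding Complex_eq by (simp add: split_beta')
  have Re: "Re l \<le> Re u" and Im: "Im l \<le> Im u" using lu[of 1] lu[of \<i>] by (auto simp: inner_complex_def)
  have "(\<lambda>(x, y). Complex x y) -` box l u \<inter> space (lborel \<Otimes>\<^sub>M lborel) = {Re l<..<Re u} \<times> {Im l<..<Im u}"
    by (auto simp: box_def Basis_complex_def space_pair_measure inner_complex_def)
  then have "emeasure (distr (lborel \<Otimes>\<^sub>M lborel) borel (\<lambda>(x, y). Complex x y)) (box l u)
     = emeasure (lborel \<Otimes>\<^sub>M lborel) ({Re l<..<Re u} \<times> {Im l<..<Im u})"
    using m by (subst emeasure_distr) auto
  also have "\<dots> = ennreal (Re u - Re l) * ennreal (Im u - Im l)"
    using Re Im by (subst lborel.emeasure_pair_measure_Times) auto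
  also have "\<dots> = ennreal (\<Prod>b\<in>Basis. (u - l) \<bullet> b)"
    using Re Im by (simp add: Basis_complex_def inner_complex_def ennreal_mult')
  finally show "emeasure (distr (lborel \<Otimes>\<^sub>M lborel) borel (\<lambda>(x, y). Complex x y)) (box l u)
     = ennreal (\<Prod>b\<in>Basis. (u - l) \<bullet> b)" .
qed simp

lemma nn_integral_complex:
  fixes f :: "complex \<Rightarrow> ennreal"
  assumes [measurable]: "f \<in> borel_measurable borel"
  shows "(\<integral>\<^sup>+z. f z \<partial>lborel) = (\<integral>\<^sup>+y. \<integral>\<^sup>+x. f (Complex x y) \<partial>lborel \<partial>lborel)" (is ?A)
    and "(\<integral>\<^sup>+z. f z \<partial>lborel) = (\<integral>\<^sup>+x. \<integral>\<^sup>+y. f (Complex x y) \<partial>lborel \<partial>lborel)" (is ?B)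
proof -
  have m [measurable]: "(\<lambda>(x, y). Complex x y) \<in> borel_measurable (lborel \<Otimes>\<^sub>M lborel)"
    unfolding Complex_eq by (simp add: split_beta')
  have "(\<integral>\<^sup>+z. f z \<partial>lborel) = (\<integral>\<^sup>+p. f (case p of (x, y) \<Rightarrow> Complex x y) \<partial>(lborel \<Otimes>\<^sub>M lborel))"
    by (subst lborel_complex_eq, subst nn_integral_distr) auto
  then have eq: "(\<integral>\<^sup>+z. f z \<partial>lborel) = (\<integral>\<^sup>+(x, y). f (Complex x y) \<partial>(lborel \<Otimes>\<^sub>M lborel))"
    by (simp add: split_beta')
  have fm: "(\<lambda>(x, y). f (Complex x y)) \<in> borel_measurable (lborel \<Otimes>\<^sub>M lborel)"
    using measurable_compose[OF m assms] by (simp add: split_beta')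
  show ?B unfolding eq using lborel.nn_integral_fst[OF fm] by simp
  show ?A unfolding eq using lborel_pair.nn_integral_snd[OF fm] by simp
qed

text \<open>For fixed imaginary part a shear is a translation of the real line, so Fubini reduces
  the claim to one-dimensional translation invariance.\<close>

lemma nn_integral_shear_Re:
  fixes f :: "complex \<Rightarrow> ennreal"
  assumes [measurable]: "f \<in> borel_measurable borel"
  shows "(\<integral>\<^sup>+z. f (Complex (Re z + p * Im z) (Im z)) \<partial>lborel) = (\<integral>\<^sup>+z. f z \<partial>lborel)"
proof -
  have "(\<integral>\<^sup>+z. f (Complex (Re z + p * Im z) (Im z)) \<partial>lborel) = (\<integral>\<^sup>+y. \<integral>\<^sup>+x. f (Complex (x + p * y) y) \<partial>lborel \<partial>lborel)"
    by (subst nn_integral_complex(1)) (auto simp: Complex_eq)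
  also have "\<dots> = (\<integral>\<^sup>+y. \<integral>\<^sup>+x. f (Complex x y) \<partial>lborel \<partial>lborel)"
  proof (rule nn_integral_cong)
    fix y :: real
    have "(\<lambda>x. f (Complex x y)) \<in> borel_measurable borel" by (simp add: Complex_eq)
    from nn_integral_real_affine[OF this, of 1 "p * y"]
    show "(\<integral>\<^sup>+x. f (Complex (x + p * y) y) \<partial>lborel) = (\<integral>\<^sup>+x. f (Complex x y) \<partial>lborel)" by (simp add: add.commute)
  qed
  finally show ?thesis by (simp add: nn_integral_complex(1))
qed

lemma nn_integral_shear_Im:
  fixes f :: "complex \<Rightarrow> ennreal"
  assumes [measurable]: "f \<in> borel_measurable borel"
  shows "(\<integral>\<^sup>+z. f (Complex (Re z) (Im z + p * Re z)) \<partial>lborel) = (\<integral>\<^sup>+z. f z \<partial>lborel)"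
proof -
  have "(\<integral>\<^sup>+z. f (Complex (Re z) (Im z + p * Re z)) \<partial>lborel) = (\<integral>\<^sup>+x. \<integral>\<^sup>+y. f (Complex x (y + p * x)) \<partial>lborel \<partial>lborel)"
    by (subst nn_integral_complex(2)) (auto simp: Complex_eq)
  also have "\<dots> = (\<integral>\<^sup>+x. \<integral>\<^sup>+y. f (Complex x y) \<partial>lborel \<partial>lborel)"
  proof (rule nn_integral_cong)
    fix x :: real
    have "(\<lambda>y. f (Complex x y)) \<in> borel_measurable borel" by (simp add: Complex_eq)
    from nn_integral_real_affine[OF this, of 1 "p * x"]
    show "(\<integral>\<^sup>+y. f (Complex x (y + p * x)) \<partial>lborel) = (\<integral>\<^sup>+y. f (Complex x y) \<partial>lborel)" by (simp add: add.commute)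
  qed
  finally show ?thesis by (simp add: nn_integral_complex(2))
qed

text \<open>A rotation by an angle with sine \<open>s \<noteq> 0\<close> and cosine \<open>c\<close> is a product of three shears with
  parameters \<open>(c - 1) / s\<close>, \<open>s\<close>, \<open>(c - 1) / s\<close>.\<close>

lemma nn_integral_rotate_aux:
  fixes f :: "complex \<Rightarrow> ennreal"
  assumes [measurable]: "f \<in> borel_measurable borel" and w: "cmod w = 1" "Im w \<noteq> 0"
  shows "(\<integral>\<^sup>+z. f (w * z) \<partial>lborel) = (\<integral>\<^sup>+z. f z \<partial>lborel)"
proof -
  define c s p where "c = Re w" and "s = Im w" and "p = (c - 1) / s"
  have s: "s \<noteq> 0" using w by (simp add: s_def)
  have cs: "c * c + s * s = 1" using w(1) cmod_power2[of w] by (simp add: c_def s_def power2_eq_square)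
  define X where "X z = Complex (Re z + p * Im z) (Im z)" for z
  define Y where "Y z = Complex (Re z) (Im z + s * Re z)" for z
  have [measurable]: "X \<in> borel_measurable borel" "Y \<in> borel_measurable borel"
    by (auto simp: X_def[abs_def] Y_def[abs_def] Complex_eq)
  have "X (Y (X z)) = w * z" for z
  proof (rule complex_eqI)
    have ps: "p * s = c - 1" using s by (simp add: p_def)
    have "s * (p * (1 + c)) = (p * s) * (1 + c)" by simp
    also have "\<dots> = s * (- s)" unfolding ps using cs by (simp add: algebra_simps)
    finally have "s * (p * (1 + c)) = s * (- s)" .
    then have pc: "p * (1 + c) = - s" using s by (metis mult_left_cancel)
    have "Re (X (Y (X z))) = Re z * (1 + p * s) + Im z * (p + p * (1 + p * s))" by (simp add: X_def Y_def algebra_simps)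
    also have "\<dots> = Re (w * z)" unfolding ps using pc by (simp add: c_def s_def algebra_simps)
    finally show "Re (X (Y (X z))) = Re (w * z)" .
    have "Im (X (Y (X z))) = Im z * (1 + p * s) + s * Re z" by (simp add: X_def Y_def algebra_simps)
    also have "\<dots> = Im (w * z)" unfolding ps by (simp add: c_def s_def algebra_simps)
    finally show "Im (X (Y (X z))) = Im (w * z)" .
  qed
  then have "(\<integral>\<^sup>+z. f (w * z) \<partial>lborel) = (\<integral>\<^sup>+z. f (X (Y (X z))) \<partial>lborel)" by simp
  also have "\<dots> = (\<integral>\<^sup>+z. f (X (Y z)) \<partial>lborel)"
    using nn_integral_shear_Re[of "\<lambda>z. f (X (Y z))" p] by (simp add: X_def[of "_ :: complex", symmetric])
  also have "\<dots> = (\<integral>\<^sup>+z. f (X z) \<partial>lborel)"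
    using nn_integral_shear_Im[of "\<lambda>z. f (X z)" s] by (simp add: Y_def[symmetric])
  also have "\<dots> = (\<integral>\<^sup>+z. f z \<partial>lborel)"
    using nn_integral_shear_Re[of f p] by (simp add: X_def[symmetric])
  finally show ?thesis .
qed

text \<open>The case of sine 0, that is \<open>w = 1\<close> or \<open>w = -1\<close>, is a product
  of the rotations by \<open>\<i>\<close> and \<open>- \<i> * w\<close>, both of nonzero
  sine.\<close>

lemma nn_integral_rotate:
  fixes f :: "complex \<Rightarrow> ennreal"
  assumes [measurable]: "f \<in> borel_measurable borel" and w: "cmod w = 1"
  shows "(\<integral>\<^sup>+z. f (w * z) \<partial>lborel) = (\<integral>\<^sup>+z. f z \<partial>lborel)"
proof (cases "Im w = 0")
  case True
  have 1: "Im (- \<i> * w) \<noteq> 0" "cmod (- \<i> * w) = 1" using w True by (auto simp: norm_mult cmod_def)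
  have "(\<integral>\<^sup>+z. f (\<i> * ((- \<i> * w) * z)) \<partial>lborel) = (\<integral>\<^sup>+z. f (\<i> * z) \<partial>lborel)"
    by (rule nn_integral_rotate_aux[OF _ 1(2,1)]) simp
  also have "\<dots> = (\<integral>\<^sup>+z. f z \<partial>lborel)" by (rule nn_integral_rotate_aux) auto
  finally show ?thesis by (simp add: mult.assoc[symmetric])
qed (use nn_integral_rotate_aux[OF assms] in simp)

text \<open>Cauchy's formula on the unit circle for \<open>w \<mapsto> h (w * z)\<close>, whose
  derivative at 0 is \<open>deriv h 0 * z\<close>, followed by Cauchy--Schwarz. Writing the circle
  as rotations of \<open>z\<close> prepares the average over \<open>z\<close>.\<close>

lemma circle_mean_bound:
  assumes h: "h holomorphic_on unit_disc" and z: "cmod z < 1"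
  shows "ennreal ((cmod (deriv h 0) * cmod z)\<^sup>2)
    \<le> (\<integral>\<^sup>+t. ennreal ((cmod (h (exp (2 * of_real pi * \<i> * of_real t) * z)))\<^sup>2) * indicator {0..1} t \<partial>lborel)"
proof -
  define k where "k = (\<lambda>w. h (w * z))"
  define e where "e = (\<lambda>t::real. exp (2 * of_real pi * \<i> * of_real t))"
  have e1: "cmod (e t) = 1" for t by (simp add: e_def)
  have sub: "(\<lambda>w. w * z) ` cball 0 1 \<subseteq> unit_disc"
    using z by (auto simp: norm_mult intro!: le_less_trans[OF mult_left_le_one_le])
  have kc: "k holomorphic_on cball 0 1"
    unfolding k_def using holomorphic_on_compose_gen[OF _ h sub] by (simp add: o_def holomorphic_on_mult)
  have dk: "deriv k 0 = deriv h 0 * z"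
  proof -
    have "deriv (h \<circ> (\<lambda>w. w * z)) 0 = deriv h (0 * z) * deriv (\<lambda>w. w * z) 0"
      using holomorphic_on_imp_differentiable_at[OF h open_unit_disc]
      by (intro deriv_chain) (auto intro!: derivative_intros)
    moreover have "deriv (\<lambda>w. w * z) 0 = z" by (rule DERIV_imp_deriv) (auto intro!: derivative_eq_intros)
    ultimately show ?thesis by (simp add: k_def o_def)
  qed
  have "((\<lambda>u. k u / (u - 0) ^ Suc 1) has_contour_integral ((2 * pi * \<i>) / (fact 1) * (deriv ^^ 1) k 0)) (circlepath 0 1)"
    using kc by (intro Cauchy_has_contour_integral_higher_derivative_circlepath)
      (auto intro: holomorphic_on_imp_continuous_on holomorphic_on_subset)
  moreover have ce: "circlepath 0 1 = e" by (simp add: fun_eq_iff circlepath e_def mult_ac)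
  moreover have "vector_derivative e (at t) = 2 * of_real pi * \<i> * e t" for t
    using vector_derivative_circlepath[of 0 1 t] unfolding ce by (simp add: e_def mult_ac)
  ultimately have "((\<lambda>t. k (e t) / (e t)\<^sup>2 * (2 * of_real pi * \<i> * e t)) has_integral (2 * pi * \<i> * deriv k 0)) {0..1}"
    by (simp add: has_contour_integral power2_eq_square)
  then have "((\<lambda>t. (1 / (2 * pi * \<i>)) * (k (e t) / (e t)\<^sup>2 * (2 * of_real pi * \<i> * e t))) has_integral (1 / (2 * pi * \<i>)) * (2 * pi * \<i> * deriv k 0)) {0..1}"
    by (rule has_integral_mult_right)
  moreover have "(1 / (2 * pi * \<i>)) * (k (e t) / (e t)\<^sup>2 * (2 * of_real pi * \<i> * e t)) = k (e t) / e t" for t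
    by (simp add: e_def power2_eq_square)
  ultimately have I: "((\<lambda>t. k (e t) / e t) has_integral deriv k 0) {0..1}" by simp
  have cke: "continuous_on {0..1} (\<lambda>t. k (e t))"
    by (rule continuous_on_compose2[OF holomorphic_on_imp_continuous_on[OF kc]])
      (auto simp: e_def intro!: continuous_intros)
  have i2: "(\<lambda>t. (cmod (k (e t)))\<^sup>2) integrable_on {0..1}"
    using cke by (intro integrable_continuous_interval continuous_intros)
  define Y where "Y = integral {0..1} (\<lambda>t. (cmod (k (e t)))\<^sup>2)"
  define X where "X = cmod (deriv k 0)"
  have "X \<le> integral {0..1} (\<lambda>t. cmod (k (e t)))"
  proof -
    have "norm (integral {0..1} (\<lambda>t. k (e t) / e t)) \<le> integral {0..1} (\<lambda>t. cmod (k (e t)))"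
      using I cke by (intro integral_norm_bound_integral) (auto simp: norm_divide e1 has_integral_integrable intro!: integrable_continuous_interval continuous_intros)
    then show ?thesis using integral_unique[OF I] by (simp add: X_def)
  qed
  \<comment> \<open>Cauchy--Schwarz in additive form:
    \<open>2 * X * \<bar>k\<bar> \<le> X^2 + \<bar>k\<bar>^2\<close> integrates to
    \<open>2 * X^2 \<le> X^2 + Y\<close>.\<close>
  then have "2 * (X * X) \<le> 2 * (X * integral {0..1} (\<lambda>t. cmod (k (e t))))"
    by (intro mult_left_mono) (auto simp: X_def)
  also have "\<dots> = integral {0..1} (\<lambda>t. 2 * X * cmod (k (e t)))" by (simp add: mult.assoc)
  also have "\<dots> \<le> integral {0..1} (\<lambda>t. X\<^sup>2 + (cmod (k (e t)))\<^sup>2)"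
  proof (rule integral_le)
    show "(\<lambda>t. 2 * X * cmod (k (e t))) integrable_on {0..1}" "(\<lambda>t. X\<^sup>2 + (cmod (k (e t)))\<^sup>2) integrable_on {0..1}"
      using cke by (auto intro!: integrable_continuous_interval continuous_intros)
    show "2 * X * cmod (k (e t)) \<le> X\<^sup>2 + (cmod (k (e t)))\<^sup>2" for t by (rule sum_squares_bound)
  qed
  also have "\<dots> = X\<^sup>2 + Y" using i2 by (simp add: Y_def Henstock_Kurzweil_Integration.integral_add[OF integrable_const_ivl i2])
  finally have XY: "X\<^sup>2 \<le> Y" by (simp add: power2_eq_square)
  have "ennreal (X\<^sup>2) \<le> ennreal Y" using XY by (rule ennreal_leI)
  also have "ennreal Y = (\<integral>\<^sup>+t. ennreal ((cmod (k (e t)))\<^sup>2) * indicator {0..1} t \<partial>lborel)"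
    using nn_integral_has_integral_lebesgue'[of "{0..1}" "\<lambda>t. (cmod (k (e t)))\<^sup>2" Y] integrable_integral[OF i2] by (simp add: Y_def)
  finally have "ennreal (X\<^sup>2) \<le> (\<integral>\<^sup>+t. ennreal ((cmod (k (e t)))\<^sup>2) * indicator {0..1} t \<partial>lborel)" .
  moreover have "X = cmod (deriv h 0) * cmod z" by (simp only: X_def dk norm_mult)
  ultimately show ?thesis unfolding k_def e_def by (simp only:)
qed

text \<open>Integrating the circle means over the disc and exchanging the integrals, rotation
  invariance removes the angle, so polar coordinates are avoided. On the annulus
  \<open>cmod z \<ge> 1/2\<close>, of normalised area \<open>3/4\<close>, the factor
  \<open>\<bar>z\<bar>^2\<close> is at least \<open>1/4\<close>; hence \<open>3/16\<close> of the
  squared derivative is at most the squared norm, and \<open>16/3 \<le> 9\<close> gives the constant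
  3.\<close>

lemma norm_deriv_0_le_A2:
  assumes h: "h holomorphic_on unit_disc"
  shows "ennreal (cmod (deriv h 0)) \<le> 3 * A2_norm h"
proof -
  \<comment> \<open>Nothing is known about \<open>h\<close> outside the disc; cutting off with the
    indicator makes the integrand Borel on the whole plane, as Fubini requires.\<close>
  define G where "G z = ennreal ((cmod (h z))\<^sup>2) * indicator unit_disc z" for z
  define e where "e = (\<lambda>t::real. exp (2 * of_real pi * \<i> * of_real t))"
  have e1: "cmod (e t) = 1" for t by (simp add: e_def)
  have [measurable]: "e \<in> borel_measurable borel"
    unfolding e_def by (intro borel_measurable_continuous_onI continuous_intros)
  have [measurable]: "unit_disc \<in> sets borel" by simp
  have G_eq: "G z = ennreal (indicator unit_disc z *\<^sub>R (cmod (h z))\<^sup>2)" for z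
    by (simp add: G_def indicator_def)
  have Gm [measurable]: "G \<in> borel_measurable borel"
  proof -
    have "(\<lambda>z. indicator unit_disc z *\<^sub>R (cmod (h z))\<^sup>2) \<in> borel_measurable borel"
      by (rule borel_measurable_continuous_on_indicator) (auto intro!: continuous_on_power continuous_on_norm holomorphic_on_imp_continuous_on h)
    then show ?thesis unfolding G_eq[abs_def] by (rule measurable_compose[OF _ measurable_ennreal])
  qed
  have fm: "(\<lambda>(t, z). G (e t * z) * indicator {0..1} t) \<in> borel_measurable (lborel \<Otimes>\<^sub>M lborel)"
  proof -
    let ?M = "lborel \<Otimes>\<^sub>M lborel :: (real \<times> complex) measure"
    have 1: "(\<lambda>p. e (fst p)) \<in> borel_measurable ?M"
      by (rule measurable_compose[OF measurable_fst]) simp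
    have 2: "(\<lambda>p. snd p) \<in> borel_measurable ?M" by simp
    have 3: "(\<lambda>p. G (e (fst p) * snd p)) \<in> borel_measurable ?M"
      by (rule measurable_compose[OF borel_measurable_times[OF 1 2] Gm])
    have 4: "(\<lambda>p. indicator {0..1::real} (fst p) :: ennreal) \<in> borel_measurable ?M"
      by (rule measurable_compose[OF measurable_fst]) simp
    show ?thesis using borel_measurable_times_ennreal[OF 3 4] by (simp only: split_beta')
  qed
  let ?I = "\<integral>\<^sup>+z. G z \<partial>lborel"
  have "(\<integral>\<^sup>+z. ennreal ((cmod (deriv h 0) * cmod z)\<^sup>2) * indicator unit_disc z \<partial>lborel)
     \<le> (\<integral>\<^sup>+z. \<integral>\<^sup>+t. G (e t * z) * indicator {0..1} t \<partial>lborel \<partial>lborel)"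
  proof (rule nn_integral_mono)
    fix z
    show "ennreal ((cmod (deriv h 0) * cmod z)\<^sup>2) * indicator unit_disc z \<le> (\<integral>\<^sup>+t. G (e t * z) * indicator {0..1} t \<partial>lborel)"
    proof (cases "cmod z < 1")
      case True
      have "G (e t * z) = ennreal ((cmod (h (exp (2 * of_real pi * \<i> * of_real t) * z)))\<^sup>2)" for t
        using True e1[of t] by (simp add: G_def norm_mult) (simp add: e_def)
      then show ?thesis using circle_mean_bound[OF h True] True by simp
    qed simp
  qed
  also have "\<dots> = (\<integral>\<^sup>+t. \<integral>\<^sup>+z. G (e t * z) * indicator {0..1} t \<partial>lborel \<partial>lborel)"
    by (rule lborel_pair.Fubini'[OF fm])
  also have "\<dots> = (\<integral>\<^sup>+t. ?I * indicator {0..1::real} t \<partial>lborel)"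
  proof (rule nn_integral_cong)
    fix t :: real
    have "(\<integral>\<^sup>+z. G (e t * z) * indicator {0..1} t \<partial>lborel) = (\<integral>\<^sup>+z. G (e t * z) \<partial>lborel) * indicator {0..1} t"
      by (rule nn_integral_multc) simp
    then show "(\<integral>\<^sup>+z. G (e t * z) * indicator {0..1} t \<partial>lborel) = ?I * indicator {0..1} t"
      using nn_integral_rotate[OF Gm e1[of t]] by simp
  qed
  also have "\<dots> = ?I" by (simp add: nn_integral_cmult_indicator)
  finally have 1: "(\<integral>\<^sup>+z. ennreal ((cmod (deriv h 0) * cmod z)\<^sup>2) * indicator unit_disc z \<partial>lborel) \<le> ?I" .
  define d where "d = (cmod (deriv h 0))\<^sup>2"
  have "ennreal (d / 4) * emeasure lborel (ball 0 1 - ball (0::complex) (1/2))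
     = (\<integral>\<^sup>+z. ennreal (d / 4) * indicator (ball 0 1 - ball (0::complex) (1/2)) z \<partial>lborel)"
    by (rule nn_integral_cmult_indicator[symmetric]) simp
  also have "\<dots> \<le> (\<integral>\<^sup>+z. ennreal ((cmod (deriv h 0) * cmod z)\<^sup>2) * indicator unit_disc z \<partial>lborel)"
  proof (rule nn_integral_mono)
    fix z
    show "ennreal (d / 4) * indicator (ball 0 1 - ball (0::complex) (1/2)) z \<le> ennreal ((cmod (deriv h 0) * cmod z)\<^sup>2) * indicator unit_disc z"
    proof (cases "z \<in> ball 0 1 - ball (0::complex) (1/2)")
      case True
      then have "(1/2)\<^sup>2 \<le> (cmod z)\<^sup>2" by (intro power_mono) auto
      then have "d / 4 \<le> (cmod (deriv h 0) * cmod z)\<^sup>2"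
        using mult_left_mono[of "1/4" "(cmod z)\<^sup>2" d] by (simp add: d_def power_mult_distrib power2_eq_square[of "1/2"])
      then show ?thesis using True by (simp add: ennreal_leI)
    qed simp
  qed
  also note 1
  finally have "ennreal (d / 4) * emeasure lborel (ball 0 1 - ball (0::complex) (1/2)) \<le> ?I" .
  moreover have "emeasure lborel (ball 0 1 - ball (0::complex) (1/2)) = ennreal (pi * (1 - (1/2)\<^sup>2))"
    by (rule emeasure_annulus) auto
  moreover have "ennreal (d / 4) * ennreal (pi * (1 - (1/2)\<^sup>2)) = ennreal (d / 4 * (pi * (1 - (1/2)\<^sup>2)))"
    by (rule ennreal_mult'[symmetric]) (simp add: d_def)
  moreover have "d / 4 * (pi * (1 - (1/2)\<^sup>2)) = 3 / 16 * d * pi" by (simp add: power2_eq_square)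
  ultimately have 2: "ennreal (3 / 16 * d * pi) \<le> ?I" by (simp only:)
  let ?J = "set_nn_integral lborel unit_disc (\<lambda>z. ennreal ((cmod (h z))\<^sup>2 / pi))"
  have "ennreal ((cmod (h z))\<^sup>2 / pi) * indicator unit_disc z = ennreal (1 / pi) * G z" for z
    unfolding G_def mult.assoc[symmetric] by (subst ennreal_mult'[symmetric]) simp_all
  then have "?J = (\<integral>\<^sup>+z. ennreal (1 / pi) * G z \<partial>lborel)" by simp
  also have "\<dots> = ennreal (1 / pi) * ?I" by (rule nn_integral_cmult) simp
  finally have "ennreal pi * ?J = ennreal (pi * (1 / pi)) * ?I"
    by (simp only: ennreal_mult'[OF pi_ge_zero] mult.assoc)
  then have eqI: "?I = ennreal pi * ?J" by simp
  show ?thesis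
  proof (cases "A2_norm h")
    case (real c)
    have "A2_norm h \<le> ennreal c" using real by simp
    then have "?J \<le> ennreal (c\<^sup>2)" by (rule A2_norm_le_iff[OF real(1), THEN iffD1])
    then have "ennreal pi * ?J \<le> ennreal pi * ennreal (c\<^sup>2)" by (rule mult_left_mono) simp
    also have "\<dots> = ennreal (pi * c\<^sup>2)" by (rule ennreal_mult'[symmetric]) simp
    finally have "ennreal (3 / 16 * d * pi) \<le> ennreal (pi * c\<^sup>2)" using 2 unfolding eqI by (rule order_trans[rotated])
    moreover have "0 \<le> pi * c\<^sup>2" by simp
    ultimately have "3 / 16 * d * pi \<le> pi * c\<^sup>2" by (simp only: ennreal_le_iff)
    then have "pi * (3 / 16 * d) \<le> pi * c\<^sup>2" by (simp only: mult.commute)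
    then have "3 / 16 * d \<le> c\<^sup>2" by (rule mult_left_le_imp_le) simp
    then have "d \<le> 9 * c\<^sup>2" using zero_le_power2[of c] by linarith
    then have "(cmod (deriv h 0))\<^sup>2 \<le> (3 * c)\<^sup>2" unfolding d_def by (simp add: power_mult_distrib)
    then have "cmod (deriv h 0) \<le> 3 * c" by (rule power2_le_imp_le) (use real in simp)
    then have "ennreal (cmod (deriv h 0)) \<le> ennreal (3 * c)" by (rule ennreal_leI)
    also have "\<dots> = ennreal 3 * ennreal c" by (rule ennreal_mult') simp
    finally show ?thesis using real by simp
  next
    case top
    then show ?thesis by (simp add: ennreal_mult_top)
  qed
qed

section \<open>Test functions\<close>

definition logw :: "complex \<Rightarrow> real" where
  "logw w = ln (2 / (1 - (cmod w)\<^sup>2))"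

lemma logw_ge:
  assumes "cmod w < 1"
  shows "ln 2 \<le> logw w" "1/2 \<le> logw w" "0 < logw w"
proof -
  have "2 * (1 - (cmod w)\<^sup>2) \<le> 2 * 1" using norm_sq_bounds[OF assms] by (intro mult_left_mono) auto
  then have "2 \<le> 2 / (1 - (cmod w)\<^sup>2)" using norm_sq_bounds(1)[OF assms] by (simp add: field_simps)
  then show "ln 2 \<le> logw w" unfolding logw_def using norm_sq_bounds(1)[OF assms] by (subst ln_le_cancel_iff) auto
  then show "1/2 \<le> logw w" "0 < logw w" using ln2_ge_two_thirds by linarith+
qed

lemma logw_large:
  obtains s where "s \<in> {0<..<1::real}" "\<And>w. s < cmod w \<Longrightarrow> cmod w < 1 \<Longrightarrow> X < logw w"
proof
  define s where "s = max (1/2) (1 - exp (- X))"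
  show "s \<in> {0<..<1::real}" by (auto simp: s_def)
  fix w assume w: "s < cmod w" "cmod w < 1"
  have "1 - cmod w < exp (- X)" using w by (simp add: s_def)
  then have "1 - (cmod w)\<^sup>2 < 2 * exp (- X)" using norm_sq_bounds(3)[OF w(2)] by simp
  then have "(1 - (cmod w)\<^sup>2) * exp X < 2 * exp (- X) * exp X" by (intro mult_strict_right_mono) auto
  then have "(1 - (cmod w)\<^sup>2) * exp X < 2" by (simp add: mult.assoc flip: exp_add)
  then have "exp X < 2 / (1 - (cmod w)\<^sup>2)" using norm_sq_bounds(1)[OF w(2)] by (simp add: field_simps)
  then have "ln (exp X) < logw w" unfolding logw_def using norm_sq_bounds(1)[OF w(2)] by (subst ln_less_cancel_iff) auto
  then show "X < logw w" by simp
qed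

section \<open>Powers of disc automorphisms\<close>

lemma weighted_power_le:
  fixes x :: real
  assumes "0 \<le> x" "x \<le> 1"
  shows "real n * x ^ (n - 1) * (1 - x\<^sup>2) \<le> 2"
proof -
  \<comment> \<open>Each of the \<open>n\<close> equal terms is at most the matching term of the
    geometric sum, which \<open>1 - x\<close> telescopes; the remaining factor \<open>1 + x\<close>
    is at most 2.\<close>
  have "real n * x ^ (n - 1) = (\<Sum>i<n. x ^ (n - 1))" by simp
  also have "\<dots> \<le> (\<Sum>i<n. x ^ i)" using assms by (intro sum_mono power_decreasing) auto
  finally have "(1 - x) * (real n * x ^ (n - 1)) \<le> (1 - x) * (\<Sum>i<n. x ^ i)"
    using assms by (intro mult_left_mono) auto
  also have "\<dots> = 1 - x ^ n" by (simp add: one_diff_power_eq)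
  also have "\<dots> \<le> 1" using assms by simp
  finally have "(1 + x) * ((1 - x) * (real n * x ^ (n - 1))) \<le> (1 + x) * 1" using assms by (intro mult_left_mono) auto
  also have "\<dots> \<le> 2" using assms by simp
  finally show ?thesis by (simp add: power2_eq_square algebra_simps)
qed

lemma little_bloch:
  assumes "\<And>z. cmod z < 1 \<Longrightarrow> bderiv f z \<le> C * (1 - cmod z)" "e > 0"
  shows "\<exists>r<1. \<forall>z. r < cmod z \<longrightarrow> cmod z < 1 \<longrightarrow> bderiv f z \<le> e"
proof (intro exI conjI allI impI)
  define d where "d = e / (\<bar>C\<bar> + 1)"
  have d: "d > 0" "\<bar>C\<bar> * d \<le> e" using assms(2) by (auto simp: d_def field_simps)
  show "1 - d < 1" using d by simp
  fix z assume z: "1 - d < cmod z" "cmod z < 1"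
  have "C * (1 - cmod z) \<le> \<bar>C\<bar> * d" using z by (intro mult_mono) auto
  then show "bderiv f z \<le> e" using assms(1)[OF z(2)] d by linarith
qed

lemma deriv_power_compose:
  assumes "f holomorphic_on unit_disc" "cmod z < 1"
  shows "deriv (\<lambda>z. f z ^ n) z = of_nat n * f z ^ (n - 1) * deriv f z"
proof -
  note d = field_differentiable_derivI[OF differentiable_disc[OF assms]]
  show ?thesis by (rule DERIV_imp_deriv) (rule derivative_eq_intros d refl | simp)+
qed

lemma bderiv_sigma_power:
  assumes w: "cmod w < 1" and z: "cmod z < 1"
  shows "bderiv (\<lambda>z. sigma w z ^ n) z = real n * cmod (sigma w z) ^ (n - 1) * (1 - (cmod (sigma w z))\<^sup>2)"
  unfolding deriv_power_compose[OF sigma_holomorphic[OF w] z] norm_deriv_sigma[OF w z, symmetric]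
  by (simp add: norm_mult norm_power)

lemma sigma_power_bloch:
  assumes w: "cmod w < 1"
  shows "(\<lambda>z. sigma w z ^ n) \<in> bloch_space" "bnorm (\<lambda>z. sigma w z ^ n) \<le> 3"
proof -
  have b: "bderiv (\<lambda>z. sigma w z ^ n) z \<le> 2" if "cmod z < 1" for z
    unfolding bderiv_sigma_power[OF w that] using norm_sigma_less_1[OF w that] by (intro weighted_power_le) auto
  show B: "(\<lambda>z. sigma w z ^ n) \<in> bloch_space"
    by (rule bloch_spaceI[OF _ b]) (auto intro!: holomorphic_intros sigma_holomorphic w)
  show "bnorm (\<lambda>z. sigma w z ^ n) \<le> 3"
  proof (rule bnorm_le[OF B])
    fix z :: complex assume z: "cmod z < 1"
    have "cmod (sigma w 0 ^ n) \<le> 1" using w by (simp add: norm_power power_le_one)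
    then show "cmod (sigma w 0 ^ n) + bderiv (\<lambda>z. sigma w z ^ n) z \<le> 3" using b[OF z] by linarith
  qed
qed

text \<open>The centre may change with the exponent as long as it stays in a fixed compact disc.
  This freedom later yields a single exponent that is good for all \<open>a\<close> with
  \<open>cmod (\<phi> a) \<le> r\<close>.\<close>

lemma sigma_power_weakly_null:
  assumes w: "\<And>n. cmod (w n) \<le> r" and r: "r < 1"
  shows "weakly_null 3 (\<lambda>n z. sigma (w n) z ^ n)"
  unfolding weakly_null_def
proof (intro conjI allI impI)
  have w1: "cmod (w n) < 1" for n using w[of n] r by simp
  show "(\<lambda>z. sigma (w n) z ^ n) \<in> bloch_space" "bnorm (\<lambda>z. sigma (w n) z ^ n) \<le> 3" for n
    using sigma_power_bloch[OF w1] by auto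
  show "\<exists>r<1. \<forall>z. r < cmod z \<longrightarrow> cmod z < 1 \<longrightarrow> bderiv (\<lambda>z. sigma (w n) z ^ n) z \<le> e" if "e > 0" for n e
  proof (rule little_bloch[OF _ that])
    fix z assume z: "cmod z < 1"
    let ?s = "cmod (sigma (w n) z)"
    have s: "?s < 1" using w1 z by simp
    \<comment> \<open>Little Bloch decay is required for each \<open>n\<close> separately, so the
      constant in front of \<open>1 - cmod z\<close> may depend on \<open>n\<close>.\<close>
    define B where "B = 2 * (1 - cmod z) / (1 - cmod (w n))\<^sup>2"
    have "1 - ?s\<^sup>2 = (1 - (cmod (w n))\<^sup>2) * (1 - (cmod z)\<^sup>2) / (cmod (1 - cnj (w n) * z))\<^sup>2"
      by (rule one_minus_norm_sigma[OF w1 z])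
    also have "\<dots> \<le> 1 * (2 * (1 - cmod z)) / (1 - cmod (w n))\<^sup>2"
      using w1[of n] z norm_sq_bounds[OF w1[of n]] norm_sq_bounds[OF z] norm_one_minus_cnj_mult[OF w1[of n] z]
      by (intro frac_le mult_mono power_mono) (auto simp: less_imp_le)
    finally have B: "1 - ?s\<^sup>2 \<le> B" by (simp add: B_def)
    have "real n * ?s ^ (n - 1) \<le> real n * 1" using s by (intro mult_left_mono power_le_one) auto
    from mult_mono[OF this B] have "real n * ?s ^ (n - 1) * (1 - ?s\<^sup>2) \<le> real n * 1 * B"
      using norm_sq_bounds(1)[OF s] by simp
    then show "bderiv (\<lambda>z. sigma (w n) z ^ n) z \<le> (real n * (2 / (1 - cmod (w n))\<^sup>2)) * (1 - cmod z)"
      unfolding bderiv_sigma_power[OF w1 z]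
      by (simp only: B_def mult_1_right times_divide_eq_right times_divide_eq_left mult.assoc)
  qed
  show "\<forall>\<^sub>F n in sequentially. cmod (sigma (w n) 0 ^ n) \<le> e \<and> (\<forall>z. cmod z \<le> \<rho> \<longrightarrow> bderiv (\<lambda>z. sigma (w n) z ^ n) z \<le> e)"
    if \<rho>': "\<rho> < 1" and e: "e > 0" for \<rho> e
  proof -
    \<comment> \<open>The radius \<open>\<rho>\<close> is only known to be below 1 and may be
      negative.\<close>
    define p where "p = max \<rho> 0"
    have p: "0 \<le> p" "p < 1" "\<rho> \<le> p" using \<rho>' by (auto simp: p_def)
    have r0: "0 \<le> r" using w[of 0] norm_ge_zero order_trans by blast
    \<comment> \<open>\<open>d\<close> bounds \<open>1 - \<bar>sigma (w n) z\<bar>^2\<close> from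
      below for all \<open>n\<close> and all \<open>z\<close> in the compact disc; the 4 is the
      square of the bound 2 for \<open>1 - cnj (w n) * z\<close>. Hence all moduli stay below one
      \<open>q < 1\<close>, and \<open>n * q^(n-1)\<close> tends to 0.\<close>
    define d where "d = (1 - r\<^sup>2) * (1 - p\<^sup>2) / 4"
    have d: "0 < d" "d < 1"
    proof -
      show "0 < d" using one_minus_sq_bounds(1)[OF r0 r] one_minus_sq_bounds(1)[OF p(1,2)] by (simp add: d_def)
      have "(1 - r\<^sup>2) * (1 - p\<^sup>2) \<le> 1 * 1" using one_minus_sq_bounds[OF r0 r] one_minus_sq_bounds[OF p(1,2)] by (intro mult_mono) auto
      then show "d < 1" by (simp add: d_def)
    qed
    define q where "q = sqrt (1 - d)"
    have q: "0 < q" "q < 1" "q\<^sup>2 = 1 - d" using d by (auto simp: q_def)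
    have sq: "cmod (sigma (w n) z) \<le> q" if z: "cmod z \<le> p" for n z
    proof -
      have z1: "cmod z < 1" using z p by simp
      have "d \<le> (1 - (cmod (w n))\<^sup>2) * (1 - (cmod z)\<^sup>2) / (cmod (1 - cnj (w n) * z))\<^sup>2"
        unfolding d_def
      proof (intro frac_le mult_mono)
        have "(cmod (1 - cnj (w n) * z))\<^sup>2 \<le> 2\<^sup>2" by (intro power_mono norm_one_minus_cnj_mult w1 z1) auto
        then show "(cmod (1 - cnj (w n) * z))\<^sup>2 \<le> 4" by simp
        show "0 < (cmod (1 - cnj (w n) * z))\<^sup>2" using cnj_mult_neq_1[OF w1[of n] z1] by simp
        show "1 - r\<^sup>2 \<le> 1 - (cmod (w n))\<^sup>2" "1 - p\<^sup>2 \<le> 1 - (cmod z)\<^sup>2"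
          using w[of n] z by (auto intro!: power_mono)
        show "0 \<le> 1 - (cmod (w n))\<^sup>2" "0 \<le> 1 - p\<^sup>2" using norm_sq_bounds(1)[OF w1[of n]] one_minus_sq_bounds(1)[OF p(1,2)] by auto
        show "0 \<le> (1 - (cmod (w n))\<^sup>2) * (1 - (cmod z)\<^sup>2)"
          using norm_sq_bounds(1)[OF w1[of n]] norm_sq_bounds(1)[OF z1] by simp
      qed
      then have "(cmod (sigma (w n) z))\<^sup>2 \<le> q\<^sup>2" unfolding q(3) using one_minus_norm_sigma[OF w1 z1, of n] by simp
      then show ?thesis by (rule power2_le_imp_le) (use q in simp)
    qed
    have "(\<lambda>n. of_nat n * q ^ n) \<longlonglongrightarrow> 0" using q by (intro powser_times_n_limit_0) auto
    then have "\<forall>\<^sub>F n in sequentially. of_nat n * q ^ n < e * q" using e q by (intro order_tendstoD(2)) auto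
    then show ?thesis using eventually_gt_at_top[of 0]
    proof eventually_elim
      case (elim n)
      have qn: "q ^ n = q ^ (n - 1) * q" using elim(2) by (cases n) auto
      have "(real n * q ^ (n - 1)) * q \<le> e * q" using elim(1) unfolding qn mult.assoc by (rule less_imp_le)
      then have nq: "real n * q ^ (n - 1) \<le> e" using q(1) by (rule mult_right_le_imp_le)
      have "cmod (sigma (w n) 0 ^ n) \<le> q ^ n" unfolding norm_power using sq[of 0 n] p by (intro power_mono) auto
      also have "\<dots> \<le> q ^ (n - 1) * 1" unfolding qn using q by (intro mult_left_mono) auto
      also have "\<dots> = 1 * q ^ (n - 1)" by simp
      also have "\<dots> \<le> real n * q ^ (n - 1)" using elim(2) q by (intro mult_right_mono) auto
      finally have "cmod (sigma (w n) 0 ^ n) \<le> e" using nq by simp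
      moreover have "bderiv (\<lambda>z. sigma (w n) z ^ n) z \<le> e" if "cmod z \<le> \<rho>" for z
      proof -
        have z: "cmod z < 1" "cmod z \<le> p" using that p by auto
        have s: "cmod (sigma (w n) z) < 1" using w1 z by simp
        have "bderiv (\<lambda>z. sigma (w n) z ^ n) z \<le> real n * q ^ (n - 1) * 1"
          unfolding bderiv_sigma_power[OF w1 z(1)] using sq[OF z(2), of n] norm_sq_bounds[OF s] q
          by (intro mult_mono power_mono) auto
        then show ?thesis using nq by simp
      qed
      ultimately show ?case by blast
    qed
  qed
qed

section \<open>The squared-logarithm test functions\<close>

definition log_test :: "complex \<Rightarrow> complex \<Rightarrow> complex" where
  "log_test w z = (Ln (2 / (1 - cnj w * z)))\<^sup>2 / complex_of_real (logw w)"

lemma g_fun_eq_log_test: "g_fun \<phi> a = log_test (\<phi> a)"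
  by (simp add: fun_eq_iff g_fun_def log_test_def logw_def)

text \<open>This keeps the argument of \<open>Ln\<close> away from the branch cut.\<close>

lemma Re_one_minus_cnj_mult_pos:
  assumes w: "cmod w < 1" and z: "cmod z < 1"
  shows "0 < Re (2 / (1 - cnj w * z))"
proof -
  have "cmod (cnj w * z) < 1" using mult_strict_mono'[OF w z] by (simp add: norm_mult)
  then have "Re (cnj w * z) < 1" using complex_Re_le_cmod[of "cnj w * z"] by linarith
  then have p: "0 < Re (1 - cnj w * z)" by simp
  have "Re (2 / (1 - cnj w * z)) = 2 * Re (1 - cnj w * z) / (cmod (1 - cnj w * z))\<^sup>2"
    by (simp add: Re_divide cmod_power2)
  then show ?thesis using p cnj_mult_neq_1[OF w z] by simp
qed

lemma has_derivative_Ln_test: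
  assumes w: "cmod w < 1" and z: "cmod z < 1"
  shows "((\<lambda>z. Ln (2 / (1 - cnj w * z))) has_field_derivative cnj w / (1 - cnj w * z)) (at z)"
proof -
  let ?d = "1 - cnj w * z"
  have ne: "?d \<noteq> 0" by (rule cnj_mult_neq_1[OF w z])
  have nr: "2 / ?d \<notin> \<real>\<^sub>\<le>\<^sub>0"
  proof
    assume "2 / ?d \<in> \<real>\<^sub>\<le>\<^sub>0"
    then have "Re (2 / ?d) \<le> 0" by (simp add: complex_nonpos_Reals_iff)
    then show False using Re_one_minus_cnj_mult_pos[OF w z] by linarith
  qed
  have "((\<lambda>z. 2 / (1 - cnj w * z)) has_field_derivative (2 * cnj w / (?d * ?d))) (at z)"
    by (rule derivative_eq_intros refl ne | simp)+
  from has_field_derivative_Ln[OF nr] this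
  have "((\<lambda>z. Ln (2 / (1 - cnj w * z))) has_field_derivative inverse (2 / ?d) * (2 * cnj w / (?d * ?d))) (at z)"
    by (rule DERIV_chain2)
  moreover have "inverse (2 / ?d) * (2 * cnj w / (?d * ?d)) = cnj w / ?d" using ne by simp
  ultimately show ?thesis by simp
qed

lemma has_derivative_log_test:
  assumes w: "cmod w < 1" and z: "cmod z < 1"
  shows "(log_test w has_field_derivative
    2 * Ln (2 / (1 - cnj w * z)) * (cnj w / (1 - cnj w * z)) / complex_of_real (logw w)) (at z)"
proof -
  have "((\<lambda>z. (Ln (2 / (1 - cnj w * z)))\<^sup>2 / complex_of_real (logw w)) has_field_derivative
    2 * Ln (2 / (1 - cnj w * z)) * (cnj w / (1 - cnj w * z)) / complex_of_real (logw w)) (at z)"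
    by (rule DERIV_cdivide) (rule derivative_eq_intros has_derivative_Ln_test[OF w z] refl | simp)+
  then show ?thesis by (simp add: log_test_def[abs_def])
qed

lemma log_test_holomorphic: "cmod w < 1 \<Longrightarrow> log_test w holomorphic_on unit_disc"
  unfolding holomorphic_on_open[OF open_unit_disc] using has_derivative_log_test unit_disc_iff by blast

text \<open>The first bound does not involve \<open>w\<close>, so dividing by \<open>logw w\<close>
  gives convergence to 0 on compact sets; the second makes the Bloch norms uniformly bounded. The 4
  majorises the argument, which is at most \<open>pi\<close>; the 11 collects \<open>logw w\<close>
  and \<open>ln 2 + 4 \<le> 5 \<le> 10 * logw w\<close>.\<close>

lemma norm_Ln_test_le:
  assumes w: "cmod w < 1" and z: "cmod z < 1"
  shows "cmod (Ln (2 / (1 - cnj w * z))) \<le> ln (2 / (1 - cmod z)) + 4"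
    and "cmod (Ln (2 / (1 - cnj w * z))) \<le> 11 * logw w"
proof -
  let ?x = "2 / (1 - cnj w * z)"
  note n = norm_one_minus_cnj_mult[OF w z]
  have p: "0 < cmod (1 - cnj w * z)" using cnj_mult_neq_1[OF w z] by simp
  have x0: "?x \<noteq> 0" using cnj_mult_neq_1[OF w z] by simp
  have nx: "cmod ?x = 2 / cmod (1 - cnj w * z)" by (simp add: norm_divide)
  have "1 \<le> cmod ?x" unfolding nx using n(3) p by (simp add: field_simps)
  then have "\<bar>Re (Ln ?x)\<bar> = ln (cmod ?x)" using x0 by (simp add: Re_Ln)
  moreover have "\<bar>Im (Ln ?x)\<bar> \<le> pi" using mpi_less_Im_Ln[OF x0] Im_Ln_le_pi[OF x0] by auto
  ultimately have b: "cmod (Ln ?x) \<le> ln (cmod ?x) + 4" using cmod_le[of "Ln ?x"] pi_less_4 by linarith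
  have "ln (cmod ?x) \<le> ln (2 / (1 - cmod z))" unfolding nx using n(1) p z
    by (subst ln_le_cancel_iff) (auto intro!: divide_left_mono)
  then show "cmod (Ln ?x) \<le> ln (2 / (1 - cmod z)) + 4" using b by simp
  have "ln (cmod ?x) \<le> ln (2 * (2 / (1 - (cmod w)\<^sup>2)))"
  proof (subst ln_le_cancel_iff)
    have "(1 - (cmod w)\<^sup>2) / 2 \<le> cmod (1 - cnj w * z)" using n(2) norm_sq_bounds(3)[OF w] by simp
    then have "2 / cmod (1 - cnj w * z) \<le> 2 / ((1 - (cmod w)\<^sup>2) / 2)" using norm_sq_bounds(1)[OF w] p by (intro divide_left_mono) auto
    then show "cmod ?x \<le> 2 * (2 / (1 - (cmod w)\<^sup>2))" unfolding nx by simp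
  qed (use x0 norm_sq_bounds(1)[OF w] in auto)
  also have "\<dots> = ln 2 + logw w" unfolding logw_def using norm_sq_bounds(1)[OF w] by (subst ln_mult) auto
  finally show "cmod (Ln ?x) \<le> 11 * logw w" using b logw_ge[OF w] ln_2_less_1 by linarith
qed

lemma norm_deriv_log_test:
  assumes w: "cmod w < 1" and z: "cmod z < 1"
  shows "cmod (deriv (log_test w) z) \<le> 2 * cmod (Ln (2 / (1 - cnj w * z))) / cmod (1 - cnj w * z) / logw w"
proof -
  have "cmod (deriv (log_test w) z) = 2 * cmod (Ln (2 / (1 - cnj w * z))) * (cmod w / cmod (1 - cnj w * z)) / logw w"
    unfolding DERIV_imp_deriv[OF has_derivative_log_test[OF w z]] using logw_ge(3)[OF w] by (simp add: norm_mult norm_divide)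
  also have "\<dots> \<le> 2 * cmod (Ln (2 / (1 - cnj w * z))) * (1 / cmod (1 - cnj w * z)) / logw w"
    using w logw_ge(3)[OF w] by (intro divide_right_mono mult_left_mono) auto
  finally show ?thesis by simp
qed

lemma bderiv_log_test:
  assumes w: "cmod w < 1" and z: "cmod z < 1"
  shows "bderiv (log_test w) z \<le> 22 * (1 - (cmod z)\<^sup>2) / cmod (1 - cnj w * z)"
    and "bderiv (log_test w) z \<le> 44"
    and "bderiv (log_test w) z \<le> 44 / (1 - cmod w) * (1 - cmod z)"
proof -
  have p: "0 < cmod (1 - cnj w * z)" using cnj_mult_neq_1[OF w z] by simp
  note L = logw_ge(3)[OF w]
  have "2 * cmod (Ln (2 / (1 - cnj w * z))) / cmod (1 - cnj w * z) / logw w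
     \<le> 2 * (11 * logw w) / cmod (1 - cnj w * z) / logw w"
    using norm_Ln_test_le(2)[OF w z] p L by (intro divide_right_mono mult_left_mono) auto
  also have "\<dots> = 22 / cmod (1 - cnj w * z)" using L by simp
  finally have "cmod (deriv (log_test w) z) \<le> 22 / cmod (1 - cnj w * z)" using norm_deriv_log_test[OF w z] by linarith
  then have "bderiv (log_test w) z \<le> (1 - (cmod z)\<^sup>2) * (22 / cmod (1 - cnj w * z))"
    using norm_sq_bounds(1)[OF z] by (intro mult_left_mono) auto
  then show 1: "bderiv (log_test w) z \<le> 22 * (1 - (cmod z)\<^sup>2) / cmod (1 - cnj w * z)" by (simp add: mult.commute)
  have "22 * (1 - (cmod z)\<^sup>2) / cmod (1 - cnj w * z) \<le> 44 * (1 - cmod z) / (1 - cmod z)"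
    using norm_sq_bounds[OF z] norm_one_minus_cnj_mult[OF w z] z by (intro frac_le) auto
  also have "\<dots> = 44" using z by (intro nonzero_mult_div_cancel_right) simp
  finally show "bderiv (log_test w) z \<le> 44" using 1 by linarith
  have "22 * (1 - (cmod z)\<^sup>2) / cmod (1 - cnj w * z) \<le> 44 * (1 - cmod z) / (1 - cmod w)"
    using norm_sq_bounds[OF z] norm_one_minus_cnj_mult[OF w z] z w by (intro frac_le) auto
  then show "bderiv (log_test w) z \<le> 44 / (1 - cmod w) * (1 - cmod z)" using 1 by simp
qed

lemma norm_log_test_0:
  assumes w: "cmod w < 1"
  shows "cmod (log_test w 0) \<le> 1 / logw w" "cmod (log_test w 0) \<le> 1"
proof -
  note L = logw_ge[OF w]
  have "Ln 2 = complex_of_real (ln 2)" using Ln_of_real[of 2] by simp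
  then have eq: "cmod (log_test w 0) = (ln 2)\<^sup>2 / logw w" using L by (simp add: log_test_def norm_divide norm_power)
  have "(ln 2)\<^sup>2 \<le> (1::real)" using ln_2_less_1 by (intro power_le_one) auto
  then show "cmod (log_test w 0) \<le> 1 / logw w" unfolding eq using L by (intro divide_right_mono) auto
  have "(ln 2)\<^sup>2 \<le> logw w"
    using mult_mono[of "ln 2" "logw w" "ln 2" 1] L ln_2_less_1 by (simp add: power2_eq_square)
  then show "cmod (log_test w 0) \<le> 1" unfolding eq using L by simp
qed

lemma log_test_bloch:
  assumes w: "cmod w < 1"
  shows "log_test w \<in> bloch_space" "bnorm (log_test w) \<le> 45"
proof -
  show B: "log_test w \<in> bloch_space"
    by (rule bloch_spaceI[OF log_test_holomorphic[OF w] bderiv_log_test(2)[OF w]])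
  show "bnorm (log_test w) \<le> 45"
    by (rule bnorm_le[OF B]) (use norm_log_test_0(2)[OF w] bderiv_log_test(2)[OF w] in fastforce)
qed

lemma log_test_weakly_null:
  assumes w1: "\<And>n. cmod (w n) < 1" and lim: "filterlim (\<lambda>n. logw (w n)) at_top sequentially"
  shows "weakly_null 45 (\<lambda>n. log_test (w n))"
  unfolding weakly_null_def
proof (intro conjI allI impI)
  show "log_test (w n) \<in> bloch_space" "bnorm (log_test (w n)) \<le> 45" for n
    using log_test_bloch[OF w1] by auto
  show "\<exists>r<1. \<forall>z. r < cmod z \<longrightarrow> cmod z < 1 \<longrightarrow> bderiv (log_test (w n)) z \<le> e" if "e > 0" for n e
    by (rule little_bloch[OF bderiv_log_test(3)[OF w1] that])
  show "\<forall>\<^sub>F n in sequentially. cmod (log_test (w n) 0) \<le> e \<and> (\<forall>z. cmod z \<le> \<rho> \<longrightarrow> bderiv (log_test (w n)) z \<le> e)"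
    if \<rho>: "\<rho> < 1" and e: "e > 0" for \<rho> e
  proof -
    \<comment> \<open>\<open>C\<close> bounds the numerator for all \<open>w\<close> at once on
      \<open>cmod z \<le> \<rho>\<close>; only the divisor \<open>logw (w n)\<close> moves with
      \<open>n\<close>.\<close>
    define C where "C = 2 * (ln (2 / (1 - \<rho>)) + 4) / (1 - \<rho>)"
    have "\<forall>\<^sub>F n in sequentially. max (1 / e) (C / e) \<le> logw (w n)" using lim unfolding filterlim_at_top by blast
    then show ?thesis
    proof eventually_elim
      case (elim n)
      note L = logw_ge(3)[OF w1[of n]]
      have "1 / logw (w n) \<le> e" "C / logw (w n) \<le> e" using elim L e by (auto simp: field_simps)
      moreover have "bderiv (log_test (w n)) z \<le> C / logw (w n)" if z: "cmod z \<le> \<rho>" for z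
      proof -
        have z1: "cmod z < 1" using z \<rho> by simp
        have p: "1 - \<rho> \<le> cmod (1 - cnj (w n) * z)" using norm_one_minus_cnj_mult(1)[OF w1[of n] z1] z by simp
        have "ln (2 / (1 - cmod z)) \<le> ln (2 / (1 - \<rho>))" using z \<rho> by (subst ln_le_cancel_iff) (auto intro!: divide_left_mono)
        then have Ln: "cmod (Ln (2 / (1 - cnj (w n) * z))) \<le> ln (2 / (1 - \<rho>)) + 4"
          using norm_Ln_test_le(1)[OF w1[of n] z1] by linarith
        have "2 * cmod (Ln (2 / (1 - cnj (w n) * z))) / cmod (1 - cnj (w n) * z) \<le> C"
          unfolding C_def
        proof (rule frac_le)
          show "0 \<le> 2 * (ln (2 / (1 - \<rho>)) + 4)" using order_trans[OF norm_ge_zero Ln] by (intro mult_nonneg_nonneg) simp_all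
          show "2 * cmod (Ln (2 / (1 - cnj (w n) * z))) \<le> 2 * (ln (2 / (1 - \<rho>)) + 4)" using Ln by (rule mult_left_mono) simp
        qed (use p \<rho> in linarith)+
        then have "2 * cmod (Ln (2 / (1 - cnj (w n) * z))) / cmod (1 - cnj (w n) * z) / logw (w n) \<le> C / logw (w n)"
          using L by (intro divide_right_mono) auto
        then have d: "cmod (deriv (log_test (w n)) z) \<le> C / logw (w n)" using norm_deriv_log_test[OF w1[of n] z1] by linarith
        have "bderiv (log_test (w n)) z \<le> 1 * cmod (deriv (log_test (w n)) z)"
          using norm_sq_bounds[OF z1] by (intro mult_right_mono) auto
        then show ?thesis using d by simp
      qed
      ultimately show ?case using norm_log_test_0(1)[OF w1[of n]] by (meson order_trans)
    qed
  qed
qed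

section \<open>Pointwise quantities of the operator\<close>

text \<open>Up to sign the monomials are the powers of \<open>sigma 0\<close>, so the bounds for
  automorphisms apply.\<close>

lemma monomial_bloch: "(\<lambda>z. z ^ n) \<in> bloch_space" "bnorm (\<lambda>z. z ^ n) \<le> 3"
proof -
  have eq: "(\<lambda>z::complex. (-1) ^ n * sigma 0 z ^ n) = (\<lambda>z. z ^ n)"
    by (simp add: sigma_zero_left fun_eq_iff flip: power_mult_distrib)
  show "(\<lambda>z. z ^ n) \<in> bloch_space"
    using bloch_scale(1)[OF sigma_power_bloch(1)[of 0 n], of "(-1) ^ n"] unfolding eq by simp
  have "bnorm (\<lambda>z. z ^ n) \<le> cmod ((-1) ^ n) * bnorm (\<lambda>z. sigma 0 z ^ n)"
    using bloch_scale(2)[OF sigma_power_bloch(1)[of 0 n], of "(-1) ^ n"] unfolding eq by simp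
  then show "bnorm (\<lambda>z. z ^ n) \<le> 3" using sigma_power_bloch(2)[of 0 n] by (simp add: norm_power)
qed

lemma limsup_bdry_lessE:
  assumes "limsup_bdry \<phi> Q < X"
  obtains s where "s \<in> {0<..<1::real}" "\<And>a. cmod a < 1 \<Longrightarrow> s < cmod (\<phi> a) \<Longrightarrow> Q a < X"
proof -
  obtain s where s: "s \<in> {0<..<1::real}" "(SUP a\<in>{a\<in>unit_disc. cmod (\<phi> a) > s}. Q a) < X"
    using assms unfolding limsup_bdry_def INF_less_iff by blast
  have "Q a < X" if "cmod a < 1" "s < cmod (\<phi> a)" for a
    using le_less_trans[OF SUP_upper[of a "{a\<in>unit_disc. cmod (\<phi> a) > s}" Q] s(2)] that by simp
  then show thesis using that s(1) by blast
qed

lemma limsup_bdry_le: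
  assumes "s \<in> {0<..<1::real}" "\<And>a. cmod a < 1 \<Longrightarrow> s < cmod (\<phi> a) \<Longrightarrow> Q a \<le> X"
  shows "limsup_bdry \<phi> Q \<le> X"
  unfolding limsup_bdry_def using assms by (intro INF_lower2[of s] SUP_least) auto

locale bloch_wcomp =
  fixes u \<phi> :: "complex \<Rightarrow> complex"
  assumes u: "u holomorphic_on unit_disc"
    and \<phi>: "\<phi> holomorphic_on unit_disc" "\<phi> ` unit_disc \<subseteq> unit_disc"
    and bounded: "wcomp_bounded_bloch u \<phi>"
begin

abbreviation T :: "(complex \<Rightarrow> complex) \<Rightarrow> complex \<Rightarrow> complex" where
  "T \<equiv> wcomp u \<phi>"

definition tau :: "complex \<Rightarrow> real" where
  "tau a = cmod (u a) * (bderiv \<phi> a / (1 - (cmod (\<phi> a))\<^sup>2))"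

definition bL :: "complex \<Rightarrow> real" where
  "bL a = bderiv u a * logw (\<phi> a)"

text \<open>This expresses "both boundary limits are at most \<open>K\<close>" by a uniform bound
  near the circle. It holds vacuously for every \<open>K\<close> when \<open>\<phi>\<close> stays
  away from the circle.\<close>

definition bdry :: "real \<Rightarrow> bool" where
  "bdry K \<longleftrightarrow> (\<exists>s\<in>{0<..<1}. \<forall>a. cmod a < 1 \<longrightarrow> s < cmod (\<phi> a) \<longrightarrow> tau a \<le> K \<and> bL a \<le> K)"

lemma \<phi>1: "cmod z < 1 \<Longrightarrow> cmod (\<phi> z) < 1"
  using \<phi>(2) by (auto simp: image_subset_iff)

lemma T_mem: "f \<in> bloch_space \<Longrightarrow> T f \<in> bloch_space"
  by (rule wcomp_mem_bloch[OF bounded])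

lemma T_bound:
  obtains C where "0 \<le> C" "\<And>f. f \<in> bloch_space \<Longrightarrow> bnorm (T f) \<le> C * bnorm f"
proof -
  obtain C :: real where C: "\<And>f. f \<in> bloch_space \<Longrightarrow> bloch_norm (T f) \<le> ennreal C * bloch_norm f"
    using bounded unfolding wcomp_bounded_bloch_def by blast
  have "bnorm (T f) \<le> max C 0 * bnorm f" if f: "f \<in> bloch_space" for f
  proof -
    have "ennreal (bnorm (T f)) \<le> ennreal C * ennreal (bnorm f)"
      using C[OF f] by (simp only: bloch_norm_eq_bnorm[OF f] bloch_norm_eq_bnorm[OF T_mem[OF f]])
    also have "\<dots> \<le> ennreal (max C 0) * ennreal (bnorm f)" by (intro mult_right_mono ennreal_leI) auto
    also have "\<dots> = ennreal (max C 0 * bnorm f)" by (rule ennreal_mult'[symmetric]) simp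
    finally have "ennreal (bnorm (T f)) \<le> ennreal (max C 0 * bnorm f)" .
    moreover have "0 \<le> max C 0 * bnorm f" by simp
    ultimately show ?thesis by (simp only: ennreal_le_iff)
  qed
  then show thesis using that[of "max C 0"] by simp
qed

lemma deriv_T:
  assumes f: "f holomorphic_on unit_disc" and z: "cmod z < 1"
  shows "deriv (T f) z = deriv u z * f (\<phi> z) + u z * (deriv f (\<phi> z) * deriv \<phi> z)"
proof -
  have c: "(\<lambda>z. f (\<phi> z)) holomorphic_on unit_disc" by (rule holomorphic_compose_disc[OF f \<phi>(1) \<phi>1])
  have "deriv (\<lambda>z. u z * f (\<phi> z)) z = u z * deriv (\<lambda>z. f (\<phi> z)) z + deriv u z * f (\<phi> z)"
    by (rule deriv_mult[OF differentiable_disc[OF u z] differentiable_disc[OF c z]])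
  also have "deriv (\<lambda>z. f (\<phi> z)) z = deriv f (\<phi> z) * deriv \<phi> z" by (rule deriv_compose_disc[OF f \<phi>(1) \<phi>1 z])
  finally show ?thesis by (simp add: wcomp_def[abs_def])
qed

lemma tau_nonneg: "cmod a < 1 \<Longrightarrow> 0 \<le> tau a"
  unfolding tau_def using bderiv_nonneg[of a \<phi>] norm_sq_bounds(1)[OF \<phi>1[of a]] by simp

lemma tau_eq: "cmod a < 1 \<Longrightarrow> tau a * (1 - (cmod (\<phi> a))\<^sup>2) = cmod (u a) * bderiv \<phi> a"
  using norm_sq_bounds(1)[OF \<phi>1[of a]] by (simp add: tau_def)

lemma bderiv_u_le: "cmod a < 1 \<Longrightarrow> bderiv u a \<le> 2 * bL a"
  unfolding bL_def using mult_left_mono[OF logw_ge(2)[OF \<phi>1[of a]] bderiv_nonneg[of a u]] by simp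

text \<open>Testing on \<open>z ^ n\<close>, where \<open>n\<close> is chosen of order \<open>1 / (1 - \<bar>\<phi> a\<bar>)\<close> so that
  \<open>n x ^ (n - 1) (1 - x\<^sup>2)\<close> stays away from \<open>0\<close> at \<open>x = \<bar>\<phi> a\<bar>\<close>.\<close>

lemma tau_le:
  assumes a: "cmod a < 1"
  defines "n \<equiv> Suc (nat \<lfloor>1 / (2 * (1 - cmod (\<phi> a)))\<rfloor>)"
  shows "tau a \<le> 4 * (bnorm (T (\<lambda>z. z ^ n)) + bderiv u a)"
proof -
  define x where "x = cmod (\<phi> a)"
  define d where "d = 1 - x"
  define m where "m = nat \<lfloor>1 / (2 * d)\<rfloor>"
  have x: "0 \<le> x" "x < 1" using \<phi>1[OF a] by (auto simp: x_def)
  have d: "0 < d" "d \<le> 1" using x by (auto simp: d_def)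
  have n: "n = Suc m" by (simp add: n_def m_def d_def x_def)
  have "real m \<le> 1 / (2 * d)" unfolding m_def using d by simp
  then have md: "real m * d \<le> 1 / 2" using d by (simp add: field_simps)
  have "1 / (2 * d) \<le> real m + 1" unfolding m_def using d by linarith
  then have nd: "1 / 2 \<le> real n * d" using d by (simp add: n field_simps)
  \<comment> \<open>Since \<open>m \<le> 1 / (2 * d) \<le> n\<close>, Bernoulli keeps
    \<open>x^m \<ge> 1/2\<close> while \<open>n * d \<ge> 1/2\<close>; the product
    \<open>1/4\<close> is the origin of the factor 4.\<close>
  have "1 + real m * (- d) \<le> (1 + (- d)) ^ m" using d by (intro Bernoulli_inequality) auto
  moreover have "1 + (- d) = x" by (simp add: d_def)
  ultimately have "1 - real m * d \<le> x ^ m" by simp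
  then have xm: "1 / 2 \<le> x ^ m" using md by linarith
  have "(1/2) * (1/2) \<le> (real n * d) * x ^ m" using nd xm by (intro mult_mono) auto
  also have "\<dots> \<le> real n * (1 - x\<^sup>2) * x ^ m"
    using one_minus_sq_bounds(2)[OF x] x by (intro mult_right_mono mult_left_mono) (auto simp: d_def)
  finally have q: "1/4 \<le> real n * (1 - x\<^sup>2) * x ^ m" by simp
  let ?f = "\<lambda>z::complex. z ^ n"
  have "(?f has_field_derivative of_nat n * (1 * \<phi> a ^ (n - Suc 0))) (at (\<phi> a))"
    by (rule DERIV_power[OF DERIV_ident])
  then have df: "deriv ?f (\<phi> a) = of_nat n * \<phi> a ^ m" using n by (simp add: DERIV_imp_deriv)
  have dT: "deriv (T ?f) a = deriv u a * \<phi> a ^ n + u a * (of_nat n * \<phi> a ^ m * deriv \<phi> a)"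
    unfolding df[symmetric] by (rule deriv_T[OF bloch_space_holomorphic[OF monomial_bloch(1)] a])
  have "cmod (u a * (of_nat n * \<phi> a ^ m * deriv \<phi> a)) \<le> cmod (deriv (T ?f) a) + cmod (deriv u a * \<phi> a ^ n)"
    using norm_triangle_ineq4[of "deriv (T ?f) a" "deriv u a * \<phi> a ^ n"] unfolding dT by simp
  also have "cmod (deriv u a * \<phi> a ^ n) \<le> cmod (deriv u a)"
    using x by (simp add: norm_mult norm_power x_def[symmetric] mult_left_le power_le_one)
  finally have "(1 - (cmod a)\<^sup>2) * cmod (u a * (of_nat n * \<phi> a ^ m * deriv \<phi> a))
     \<le> (1 - (cmod a)\<^sup>2) * (cmod (deriv (T ?f) a) + cmod (deriv u a))"
    using norm_sq_bounds(1)[OF a] by (intro mult_left_mono) auto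
  also have "\<dots> = bderiv (T ?f) a + bderiv u a" by (simp add: algebra_simps)
  also have "bderiv (T ?f) a \<le> bnorm (T ?f)"
    using bnorm_bound[OF T_mem[OF monomial_bloch(1)] a, of n] norm_ge_zero[of "T ?f 0"] by linarith
  also have "(1 - (cmod a)\<^sup>2) * cmod (u a * (of_nat n * \<phi> a ^ m * deriv \<phi> a)) = (cmod (u a) * bderiv \<phi> a) * (real n * x ^ m)"
    by (simp add: norm_mult norm_power x_def mult_ac)
  also have "\<dots> = tau a * (real n * (1 - x\<^sup>2) * x ^ m)"
    unfolding tau_eq[OF a, symmetric] x_def by (simp add: mult_ac)
  finally have "tau a * (real n * (1 - x\<^sup>2) * x ^ m) \<le> bnorm (T ?f) + bderiv u a" by simp
  moreover have "tau a * (1/4) \<le> tau a * (real n * (1 - x\<^sup>2) * x ^ m)" using q tau_nonneg[OF a] by (intro mult_left_mono) auto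
  ultimately show ?thesis by simp
qed

text \<open>In the product rule at \<open>a\<close> the value of the test function at
  \<open>\<phi> a\<close> is exactly \<open>logw (\<phi> a)\<close>, which produces
  \<open>bL a\<close>, and its derivative there is at most
  \<open>2 / (1 - \<bar>\<phi> a\<bar>^2)\<close>, which produces the error
  \<open>2 * tau a\<close>.\<close>

lemma bL_le:
  assumes a: "cmod a < 1"
  shows "bL a \<le> bnorm (T (log_test (\<phi> a))) + 2 * tau a"
proof -
  let ?w = "\<phi> a"
  have w: "cmod ?w < 1" by (rule \<phi>1[OF a])
  note L = logw_ge(3)[OF w]
  have Ln: "Ln (2 / (1 - cnj ?w * ?w)) = complex_of_real (logw ?w)"
  proof -
    have "2 / (1 - cnj ?w * ?w) = complex_of_real (2 / (1 - (cmod ?w)\<^sup>2))"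
      by (simp add: complex_norm_square mult.commute del: of_real_power)
    then show ?thesis using Ln_of_real[of "2 / (1 - (cmod ?w)\<^sup>2)"] norm_sq_bounds(1)[OF w] by (simp add: logw_def)
  qed
  have f: "log_test ?w ?w = complex_of_real (logw ?w)"
    using L unfolding log_test_def Ln by (simp add: power2_eq_square)
  have df: "deriv (log_test ?w) ?w = 2 * (cnj ?w / (1 - cnj ?w * ?w))"
    unfolding DERIV_imp_deriv[OF has_derivative_log_test[OF w w]] Ln using L by simp
  have "cmod (1 - cnj ?w * ?w) = 1 - (cmod ?w)\<^sup>2"
  proof -
    have "1 - cnj ?w * ?w = complex_of_real (1 - (cmod ?w)\<^sup>2)"
      by (simp add: complex_norm_square mult.commute del: of_real_power)
    then show ?thesis using norm_sq_bounds(1)[OF w] by (simp only: norm_of_real)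
  qed
  then have ndf: "cmod (deriv (log_test ?w) ?w) \<le> 2 / (1 - (cmod ?w)\<^sup>2)"
    unfolding df using w norm_sq_bounds(1)[OF w] by (simp add: norm_mult norm_divide divide_right_mono)
  let ?F = "T (log_test ?w)"
  have dT: "deriv ?F a = deriv u a * complex_of_real (logw ?w) + u a * (deriv (log_test ?w) ?w * deriv \<phi> a)"
    unfolding f[symmetric] by (rule deriv_T[OF log_test_holomorphic[OF w] a])
  have "cmod (deriv u a * complex_of_real (logw ?w)) \<le> cmod (deriv ?F a) + cmod (u a * (deriv (log_test ?w) ?w * deriv \<phi> a))"
    using norm_triangle_ineq4[of "deriv ?F a" "u a * (deriv (log_test ?w) ?w * deriv \<phi> a)"] unfolding dT by simp
  then have "cmod (deriv u a) * logw ?w \<le> cmod (deriv ?F a) + cmod (u a) * (cmod (deriv (log_test ?w) ?w) * cmod (deriv \<phi> a))"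
    using L by (simp add: norm_mult)
  also have "\<dots> \<le> cmod (deriv ?F a) + cmod (u a) * (2 / (1 - (cmod ?w)\<^sup>2) * cmod (deriv \<phi> a))"
    using ndf by (intro add_left_mono mult_left_mono mult_right_mono) auto
  finally have "(1 - (cmod a)\<^sup>2) * (cmod (deriv u a) * logw ?w)
     \<le> (1 - (cmod a)\<^sup>2) * (cmod (deriv ?F a) + cmod (u a) * (2 / (1 - (cmod ?w)\<^sup>2) * cmod (deriv \<phi> a)))"
    using norm_sq_bounds(1)[OF a] by (intro mult_left_mono) auto
  then have "bL a \<le> bderiv ?F a + 2 * tau a" by (simp add: bL_def tau_def algebra_simps)
  moreover have "bderiv ?F a \<le> bnorm ?F"
    using bnorm_bound[OF T_mem[OF log_test_bloch(1)[OF w]] a] norm_ge_zero[of "?F 0"] by linarith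
  ultimately show ?thesis by simp
qed

text \<open>The crude global bound, from boundedness of the operator on the test functions. It takes
  over at points whose image under \<open>\<phi>\<close> is not known to be near the circle.\<close>

lemma tau_bL_bounded:
  obtains M where "0 < M" "\<And>a. cmod a < 1 \<Longrightarrow> tau a \<le> M" "\<And>a. cmod a < 1 \<Longrightarrow> bL a \<le> M"
proof -
  obtain C where C: "0 \<le> C" "\<And>f. f \<in> bloch_space \<Longrightarrow> bnorm (T f) \<le> C * bnorm f" using T_bound by blast
  have ub: "u \<in> bloch_space" using T_mem[OF bloch_const(1)[of 1]] by (simp add: wcomp_def)
  have mon: "bnorm (T (\<lambda>z. z ^ n)) \<le> C * 3" for n
    using C(2)[OF monomial_bloch(1)] mult_left_mono[OF monomial_bloch(2) C(1)] by (rule order_trans)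
  define M1 where "M1 = 4 * (C * 3 + bnorm u)"
  have M1: "tau a \<le> M1" if a: "cmod a < 1" for a
  proof -
    have "bderiv u a \<le> bnorm u" using bnorm_bound[OF ub a] norm_ge_zero[of "u 0"] by linarith
    then show ?thesis using tau_le[OF a] mon unfolding M1_def by (meson add_mono mult_left_mono order_trans zero_le_numeral)
  qed
  define M2 where "M2 = C * 45 + 2 * M1"
  have M2: "bL a \<le> M2" if a: "cmod a < 1" for a
  proof -
    have "bnorm (T (log_test (\<phi> a))) \<le> C * 45"
      using C(2)[OF log_test_bloch(1)[OF \<phi>1[OF a]]] mult_left_mono[OF log_test_bloch(2)[OF \<phi>1[OF a]] C(1)] by (rule order_trans)
    then show ?thesis using bL_le[OF a] M1[OF a] unfolding M2_def by linarith
  qed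
  show thesis by (rule that[of "\<bar>M1\<bar> + \<bar>M2\<bar> + 1"]) (use M1 M2 in fastforce)+
qed

section \<open>From the right-hand sides to bounds on \<open>tau\<close> and \<open>bL\<close> near
  the circle\<close>

lemma tau_bdry_from_powers:
  assumes lim: "Limsup sequentially (\<lambda>n. bloch_norm (\<lambda>z. u z * \<phi> z ^ n)) < ennreal K" and K: "0 < K"
  shows "\<exists>s\<in>{0<..<1}. \<forall>a. cmod a < 1 \<longrightarrow> s < cmod (\<phi> a) \<longrightarrow> tau a \<le> 8 * K"
proof -
  have "\<forall>\<^sub>F n in sequentially. bloch_norm (\<lambda>z. u z * \<phi> z ^ n) < ennreal K"
    by (rule Limsup_lessD[OF lim])
  then obtain N where N: "\<And>n. N \<le> n \<Longrightarrow> bloch_norm (\<lambda>z. u z * \<phi> z ^ n) < ennreal K"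
    unfolding eventually_sequentially by blast
  have N': "bnorm (T (\<lambda>z. z ^ n)) \<le> K" if "N \<le> n" for n
    using N[OF that] bloch_norm_eq_bnorm[OF T_mem[OF monomial_bloch(1)[of n]]] by (simp add: wcomp_def ennreal_less_iff)
  obtain M where M: "0 < M" "\<And>a. cmod a < 1 \<Longrightarrow> tau a \<le> M" "\<And>a. cmod a < 1 \<Longrightarrow> bL a \<le> M" using tau_bL_bounded by blast
  obtain s1 where s1: "s1 \<in> {0<..<1::real}" "\<And>w. s1 < cmod w \<Longrightarrow> cmod w < 1 \<Longrightarrow> M / K < logw w" using logw_large[of "M / K"] by blast
  \<comment> \<open>The second entry makes the exponent of \<open>tau_le\<close> at least
    \<open>N\<close>; the first makes \<open>logw (\<phi> a)\<close> exceed \<open>M / K\<close>, so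
    that the remainder \<open>bderiv u a\<close> in \<open>tau_le\<close> is at most
    \<open>K\<close>. Together \<open>4 * (K + K)\<close>.\<close>
  define s where "s = max s1 (1 - 1 / (2 * (real N + 1)))"
  have "tau a \<le> 8 * K" if a: "cmod a < 1" and sa: "s < cmod (\<phi> a)" for a
  proof -
    have x: "cmod (\<phi> a) < 1" by (rule \<phi>1[OF a])
    have "M / K < logw (\<phi> a)" using s1(2)[OF _ x] sa by (simp add: s_def)
    then have "bderiv u a * (M / K) \<le> bderiv u a * logw (\<phi> a)" using bderiv_nonneg[OF a, of u] by (intro mult_left_mono) auto
    also have "\<dots> \<le> M" using M(3)[OF a] by (simp add: bL_def)
    finally have "bderiv u a * M / K \<le> M" by (simp only: times_divide_eq_right)
    then have "bderiv u a * M \<le> M * K" using K by (simp only: pos_divide_le_eq)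
    then have "M * bderiv u a \<le> M * K" by (subst mult.commute)
    then have bu: "bderiv u a \<le> K" using M(1) by (rule mult_left_le_imp_le)
    have "1 - cmod (\<phi> a) < 1 / (2 * (real N + 1))" using sa by (simp add: s_def)
    then have "real N < 1 / (2 * (1 - cmod (\<phi> a)))" using x by (simp add: field_simps)
    then have nN: "N \<le> Suc (nat \<lfloor>1 / (2 * (1 - cmod (\<phi> a)))\<rfloor>)" by linarith
    have "tau a \<le> 4 * (K + K)"
      by (rule order_trans[OF tau_le[OF a] mult_left_mono[OF add_mono[OF N'[OF nN] bu]]]) simp
    then show ?thesis by simp
  qed
  moreover have "s \<in> {0<..<1}" using s1(1) by (auto simp: s_def)
  ultimately show ?thesis by blast
qed

text \<open>By the equality in \<open>Schwarz_Pick\<close>, \<open>tau a\<close> is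
  \<open>cmod (u a)\<close> times the derivative at 0 of the conjugated self-map, and a Bergman norm
  dominates a derivative at the origin.\<close>

lemma tau_bdry_from_alpha:
  assumes "alpha_t u \<phi> < ennreal K"
  shows "\<exists>s\<in>{0<..<1}. \<forall>a. cmod a < 1 \<longrightarrow> s < cmod (\<phi> a) \<longrightarrow> tau a \<le> 3 * K"
proof -
  obtain s where s: "s \<in> {0<..<1::real}" "\<And>a. cmod a < 1 \<Longrightarrow> s < cmod (\<phi> a) \<Longrightarrow>
     ennreal (cmod (u a)) * A2_norm (sigma (\<phi> a) \<circ> \<phi> \<circ> sigma a) < ennreal K"
    using limsup_bdry_lessE[OF assms[unfolded alpha_t_def]] by blast
  have "tau a \<le> 3 * K" if a: "cmod a < 1" and sa: "s < cmod (\<phi> a)" for a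
  proof -
    let ?\<psi> = "sigma (\<phi> a) \<circ> \<phi> \<circ> sigma a"
    note lt = s(2)[OF a sa]
    have "0 < ennreal K" using lt by (rule order_le_less_trans[OF zero_le])
    then have K: "0 < K" by simp
    have "tau a = cmod (u a) * cmod (deriv ?\<psi> 0)" unfolding tau_def by (simp only: Schwarz_Pick(1)[OF \<phi> a])
    then have "ennreal (tau a) = ennreal (cmod (u a)) * ennreal (cmod (deriv ?\<psi> 0))" by (simp only: ennreal_mult'[OF norm_ge_zero])
    also have "\<dots> \<le> ennreal (cmod (u a)) * (3 * A2_norm ?\<psi>)"
      by (intro mult_left_mono norm_deriv_0_le_A2 conjugate_self_map(1)[OF \<phi> a]) simp
    also have "\<dots> = 3 * (ennreal (cmod (u a)) * A2_norm ?\<psi>)" by (simp only: mult.left_commute)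
    also have "\<dots> \<le> 3 * ennreal K" using lt by (intro mult_left_mono) auto
    also have "\<dots> = ennreal (3 * K)" using ennreal_mult'[of 3 K] by simp
    finally show ?thesis using K by simp
  qed
  then show ?thesis using s(1) by blast
qed

lemma bL_bdry_from_beta:
  assumes "beta_t u \<phi> < ennreal K"
  shows "\<exists>s\<in>{0<..<1}. \<forall>a. cmod a < 1 \<longrightarrow> s < cmod (\<phi> a) \<longrightarrow> bL a \<le> 3 * K"
proof -
  obtain s where s: "s \<in> {0<..<1::real}" "\<And>a. cmod a < 1 \<Longrightarrow> s < cmod (\<phi> a) \<Longrightarrow>
     ennreal (ln (2 / (1 - (cmod (\<phi> a))\<^sup>2))) * A2_norm (\<lambda>z. u (sigma a z) - u a) < ennreal K"
    using limsup_bdry_lessE[OF assms[unfolded beta_t_def]] by blast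
  have "bL a \<le> 3 * K" if a: "cmod a < 1" and sa: "s < cmod (\<phi> a)" for a
  proof -
    let ?f = "\<lambda>z. u (sigma a z) - u a"
    have lt: "ennreal (logw (\<phi> a)) * A2_norm ?f < ennreal K" using s(2)[OF a sa] by (simp only: logw_def)
    have "0 < ennreal K" using lt by (rule order_le_less_trans[OF zero_le])
    then have K: "0 < K" by simp
    have h: "(\<lambda>z. u (sigma a z)) holomorphic_on unit_disc"
      by (rule holomorphic_compose_disc[OF u sigma_holomorphic[OF a]]) (simp add: a)
    have "deriv ?f 0 = deriv (\<lambda>z. u (sigma a z)) 0"
      using deriv_diff[OF differentiable_disc[OF h, of 0], of "\<lambda>_. u a"] by simp
    then have "cmod (deriv ?f 0) = bderiv u a"
      using norm_deriv_compose_sigma[OF u a, of 0] by simp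
    then have "ennreal (bL a) = ennreal (logw (\<phi> a)) * ennreal (cmod (deriv ?f 0))"
      unfolding bL_def using ennreal_mult'[OF less_imp_le[OF logw_ge(3)[OF \<phi>1[OF a]]], of "bderiv u a"] by (simp only: mult.commute)
    also have "\<dots> \<le> ennreal (logw (\<phi> a)) * (3 * A2_norm ?f)"
      by (intro mult_left_mono norm_deriv_0_le_A2 holomorphic_intros h) simp
    also have "\<dots> = 3 * (ennreal (logw (\<phi> a)) * A2_norm ?f)" by (simp only: mult.left_commute)
    also have "\<dots> \<le> 3 * ennreal K" using lt by (intro mult_left_mono) auto
    also have "\<dots> = ennreal (3 * K)" using ennreal_mult'[of 3 K] by simp
    finally show ?thesis using K by simp
  qed
  then show ?thesis using s(1) by blast
qed

lemma log_test_bdry: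
  assumes "limsup_bdry \<phi> (\<lambda>a. bloch_norm (T (g_fun \<phi> a))) < ennreal K"
  shows "\<exists>s\<in>{0<..<1}. \<forall>a. cmod a < 1 \<longrightarrow> s < cmod (\<phi> a) \<longrightarrow> bL a \<le> K + 2 * tau a"
proof -
  obtain s where s: "s \<in> {0<..<1::real}" "\<And>a. cmod a < 1 \<Longrightarrow> s < cmod (\<phi> a) \<Longrightarrow>
     bloch_norm (T (g_fun \<phi> a)) < ennreal K"
    using limsup_bdry_lessE[OF assms] by blast
  have "bL a \<le> K + 2 * tau a" if a: "cmod a < 1" and sa: "s < cmod (\<phi> a)" for a
  proof -
    have "bnorm (T (log_test (\<phi> a))) < K"
      using s(2)[OF a sa] by (simp add: g_fun_eq_log_test bloch_norm_eq_bnorm[OF T_mem[OF log_test_bloch(1)[OF \<phi>1[OF a]]]] ennreal_less_iff)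
    then show ?thesis using bL_le[OF a] by linarith
  qed
  then show ?thesis using s(1) by blast
qed

text \<open>Testing on \<open>g_a\<close> controls \<open>bL\<close> only up to
  \<open>2 * tau\<close>, so the bound on \<open>tau\<close> has to be fed in; hence
  \<open>K2 + 2 * K1\<close>.\<close>

lemma bdryI:
  assumes "\<exists>s\<in>{0<..<1}. \<forall>a. cmod a < 1 \<longrightarrow> s < cmod (\<phi> a) \<longrightarrow> tau a \<le> K1"
    and "\<exists>s\<in>{0<..<1}. \<forall>a. cmod a < 1 \<longrightarrow> s < cmod (\<phi> a) \<longrightarrow> bL a \<le> K2 + 2 * tau a"
    and "K1 \<le> K" "K2 + 2 * K1 \<le> K"
  shows "bdry K"
proof -
  obtain s1 s2 where s: "s1 \<in> {0<..<1}" "\<And>a. cmod a < 1 \<Longrightarrow> s1 < cmod (\<phi> a) \<Longrightarrow> tau a \<le> K1"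
    "s2 \<in> {0<..<1}" "\<And>a. cmod a < 1 \<Longrightarrow> s2 < cmod (\<phi> a) \<Longrightarrow> bL a \<le> K2 + 2 * tau a"
    using assms(1,2) by blast
  have "tau a \<le> K \<and> bL a \<le> K" if "cmod a < 1" "max s1 s2 < cmod (\<phi> a)" for a
    using s(2)[of a] s(4)[of a] that assms(3,4) by auto
  moreover have "max s1 s2 \<in> {0<..<1}" using s by auto
  ultimately show ?thesis unfolding bdry_def by blast
qed

end

section \<open>Bounding the Bergman norm quantities\<close>

lemma ln_le_root8:
  assumes "1 \<le> (y::real)"
  shows "ln y \<le> 8 * y powr (1/8)"
proof -
  have "ln (y powr (1/8)) \<le> y powr (1/8) - 1" using assms by (intro ln_le_minus_one) simp
  moreover have "ln (y powr (1/8)) = ln y / 8" using assms by (simp add: ln_powr)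
  ultimately show ?thesis by linarith
qed

text \<open>The constant is \<open>1 + 2 * 16\<close>, where 16 is 8 from \<open>ln_le_root8\<close>
  times 2, a bound for \<open>4 powr (1/8)\<close>; the leading 1 is absorbed because the weight is
  at least 1.\<close>

lemma ln_weight_le:
  fixes x :: real
  assumes "0 \<le> x" "x < 1"
  shows "1 + 2 * ln (4 / (1 - x\<^sup>2)) \<le> 33 * (1 - x) powr (- 1/8)"
proof -
  note b = one_minus_sq_bounds[OF assms]
  define d where "d = 1 - x"
  have d: "0 < d" "d \<le> 1" using assms by (auto simp: d_def)
  have "ln (4 / (1 - x\<^sup>2)) \<le> ln (4 / d)" using b d by (subst ln_le_cancel_iff) (auto simp: d_def intro!: divide_left_mono)
  also have "\<dots> \<le> 8 * (4 / d) powr (1/8)" using d by (intro ln_le_root8) (simp add: field_simps)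
  finally have 1: "ln (4 / (1 - x\<^sup>2)) \<le> 8 * (4 / d) powr (1/8)" .
  have "(4::real) powr (1/8) \<le> 4 powr (1/2)" by (rule powr_mono) auto
  also have "(4::real) powr (1/2) = 2" by (simp add: powr_half_sqrt)
  finally have "4 powr (1/8) * d powr (- 1/8) \<le> 2 * d powr (- 1/8)" by (rule mult_right_mono) simp
  moreover have "(4 / d) powr (1/8) = 4 powr (1/8) * d powr (- 1/8)" using d by (simp add: powr_divide powr_minus_divide)
  ultimately have 1: "ln (4 / (1 - x\<^sup>2)) \<le> 16 * d powr (- 1/8)" using 1 by linarith
  have "d powr 0 \<le> d powr (- 1/8)" using d by (intro powr_mono') auto
  then have "1 \<le> d powr (- 1/8)" using d by simp
  then show ?thesis using 1 unfolding d_def by linarith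
qed

lemma one_le_weight: "0 \<le> x \<Longrightarrow> x < (1::real) \<Longrightarrow> 1 \<le> (1 - x) powr (- 1/8)"
  using powr_mono'[of "-1/8" 0 "1 - x"] by simp

text \<open>The bounds are placed on \<open>c * cmod (F z)\<close> because \<open>c\<close> will be
  \<open>cmod (u a)\<close>, which may vanish.\<close>

lemma A2_norm_scaled_split:
  assumes c: "0 \<le> c" and K: "0 \<le> K" and M: "0 \<le> M" and R: "R < 1"
    and F1: "\<And>z. cmod z < 1 \<Longrightarrow> cmod z \<le> R \<Longrightarrow> c * cmod (F z) \<le> K * (1 - cmod z) powr (- 1/8)"
    and F2: "\<And>z. cmod z < 1 \<Longrightarrow> c * cmod (F z) \<le> M * (1 - cmod z) powr (- 1/8)"
  shows "ennreal c * A2_norm F \<le> ennreal (sqrt (8 * (K\<^sup>2 + M\<^sup>2 * (1 - R) powr (1/4))))"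
proof (cases "c = 0")
  case False
  then have c0: "0 < c" using c by simp
  have "A2_norm F \<le> ennreal (sqrt (8 * ((K / c)\<^sup>2 + (M / c)\<^sup>2 * (1 - R) powr (1/4))))"
  proof (rule A2_norm_split[OF _ _ R])
    show "cmod (F z) \<le> K / c * (1 - cmod z) powr (- 1/8)" if "cmod z < 1" "cmod z \<le> R" for z
      using F1[OF that] c0 by (simp add: field_simps)
    show "cmod (F z) \<le> M / c * (1 - cmod z) powr (- 1/8)" if "cmod z < 1" for z
      using F2[OF that] c0 by (simp add: field_simps)
  qed (use c0 K M in auto)
  then have "ennreal c * A2_norm F \<le> ennreal c * ennreal (sqrt (8 * ((K / c)\<^sup>2 + (M / c)\<^sup>2 * (1 - R) powr (1/4))))"
    by (rule mult_left_mono) simp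
  also have "\<dots> = ennreal (c * sqrt (8 * ((K / c)\<^sup>2 + (M / c)\<^sup>2 * (1 - R) powr (1/4))))"
    using c by (rule ennreal_mult'[symmetric])
  also have "c * sqrt (8 * ((K / c)\<^sup>2 + (M / c)\<^sup>2 * (1 - R) powr (1/4)))
      = sqrt (c\<^sup>2 * (8 * ((K / c)\<^sup>2 + (M / c)\<^sup>2 * (1 - R) powr (1/4))))"
    using c by (simp only: real_sqrt_mult real_sqrt_abs abs_of_nonneg)
  also have "c\<^sup>2 * (8 * ((K / c)\<^sup>2 + (M / c)\<^sup>2 * (1 - R) powr (1/4))) = 8 * (K\<^sup>2 + M\<^sup>2 * (1 - R) powr (1/4))"
    using c0 by (simp add: power_divide distrib_left)
  finally show ?thesis .
qed simp

text \<open>\<open>R\<close> depends on \<open>K\<close> and \<open>M\<close> only, not on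
  \<open>c\<close> or \<open>F\<close>. It can therefore be fixed before the points \<open>a\<close>
  are restricted to a neighbourhood of the circle.\<close>

lemma A2_norm_scaled_small:
  assumes K: "0 < K" and M: "0 \<le> M"
  obtains R where "0 \<le> R" "R < 1"
    "\<forall>c\<ge>0. \<forall>F. (\<forall>z. cmod z \<le> R \<longrightarrow> c * cmod (F z) \<le> K * (1 - cmod z) powr (- 1/8)) \<longrightarrow>
      (\<forall>z. cmod z < 1 \<longrightarrow> c * cmod (F z) \<le> M * (1 - cmod z) powr (- 1/8)) \<longrightarrow>
      ennreal c * A2_norm F \<le> ennreal (4 * K)"
proof -
  \<comment> \<open>Chosen so that \<open>M^2 * d powr (1/4) \<le> K^2\<close> for
    \<open>d \<le> q powr 4\<close>; the added 1 covers \<open>M = 0\<close>. Then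
    \<open>8 * (K^2 + K^2)\<close> is the square of \<open>4 * K\<close>.\<close>
  define q where "q = K\<^sup>2 / (M\<^sup>2 + 1)"
  have M1: "0 < M\<^sup>2 + 1" using zero_le_power2[of M] by linarith
  have q: "0 < q" using K M1 by (simp add: q_def)
  define d where "d = min 1 (q powr 4)"
  have d: "0 < d" "d \<le> 1" using q by (auto simp: d_def)
  have "d powr (1/4) \<le> (q powr 4) powr (1/4)" using d by (intro powr_mono2) (auto simp: d_def)
  also have "\<dots> = q" unfolding powr_powr using q by simp
  finally have "M\<^sup>2 * d powr (1/4) \<le> (M\<^sup>2 + 1) * q" using q by (intro mult_mono) auto
  also have "\<dots> = K\<^sup>2" using M1 by (simp add: q_def)
  finally have "8 * (K\<^sup>2 + M\<^sup>2 * d powr (1/4)) \<le> (4 * K)\<^sup>2" by (simp add: power_mult_distrib)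
  then have le: "sqrt (8 * (K\<^sup>2 + M\<^sup>2 * d powr (1/4))) \<le> 4 * K"
    using K by (intro real_le_lsqrt) auto
  show thesis
  proof (rule that[of "1 - d"])
    show "\<forall>c\<ge>0. \<forall>F. (\<forall>z. cmod z \<le> 1 - d \<longrightarrow> c * cmod (F z) \<le> K * (1 - cmod z) powr (- 1/8)) \<longrightarrow>
      (\<forall>z. cmod z < 1 \<longrightarrow> c * cmod (F z) \<le> M * (1 - cmod z) powr (- 1/8)) \<longrightarrow>
      ennreal c * A2_norm F \<le> ennreal (4 * K)"
    proof (intro allI impI)
      fix c :: real and F :: "complex \<Rightarrow> complex"
      assume c: "0 \<le> c"
        and F1: "\<forall>z. cmod z \<le> 1 - d \<longrightarrow> c * cmod (F z) \<le> K * (1 - cmod z) powr (- 1/8)"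
        and F2: "\<forall>z. cmod z < 1 \<longrightarrow> c * cmod (F z) \<le> M * (1 - cmod z) powr (- 1/8)"
      have "ennreal c * A2_norm F \<le> ennreal (sqrt (8 * (K\<^sup>2 + M\<^sup>2 * (1 - (1 - d)) powr (1/4))))"
        using F1 F2 K d by (intro A2_norm_scaled_split c M) auto
      also have "\<dots> \<le> ennreal (4 * K)" using le by (intro ennreal_leI) simp
      finally show "ennreal c * A2_norm F \<le> ennreal (4 * K)" .
    qed
  qed (use d in auto)
qed

section \<open>Transporting bounds between \<open>sigma a w\<close> and \<open>a\<close>\<close>

context bloch_wcomp
begin

text \<open>The logarithm of \<open>Schwarz_Pick_distance\<close> gives an additive loss
  \<open>ln (4 / (1 - \<bar>w\<bar>^2))\<close>. It becomes a factor because the logarithm on the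
  right is at least \<open>1/2\<close>.\<close>

lemma logw_compare:
  assumes a: "cmod a < 1" and w: "cmod w < 1"
  shows "logw (\<phi> a) \<le> 33 * (1 - cmod w) powr (- 1/8) * logw (\<phi> (sigma a w))"
proof -
  define P Q A where "P = 1 - (cmod (\<phi> a))\<^sup>2" and "Q = 1 - (cmod (\<phi> (sigma a w)))\<^sup>2" and "A = 1 - (cmod w)\<^sup>2"
  have q: "cmod (\<phi> (sigma a w)) < 1" using a w by (simp add: \<phi>1)
  have pos: "0 < P" "0 < Q" "0 < A" "A \<le> 1"
    using norm_sq_bounds[OF \<phi>1[OF a]] norm_sq_bounds[OF q] norm_sq_bounds[OF w] by (auto simp: P_def Q_def A_def)
  have QAP: "Q * A \<le> 4 * P" unfolding P_def Q_def A_def by (rule Schwarz_Pick_distance[OF \<phi> a w])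
  have "2 / P \<le> (2 / Q) * (4 / A)"
  proof -
    have "8 / (4 * P) \<le> 8 / (Q * A)" using pos by (intro divide_left_mono QAP) auto
    then show ?thesis by simp
  qed
  then have "ln (2 / P) \<le> ln ((2 / Q) * (4 / A))" using pos by (subst ln_le_cancel_iff) auto
  also have "\<dots> = ln (2 / Q) + ln (4 / A)" using pos by (subst ln_mult) auto
  finally have 1: "logw (\<phi> a) \<le> logw (\<phi> (sigma a w)) + ln (4 / A)" by (simp add: logw_def P_def Q_def)
  have A4: "0 \<le> ln (4 / A)" using pos by (intro ln_ge_zero) (simp add: field_simps)
  have L: "1/2 \<le> logw (\<phi> (sigma a w))" by (rule logw_ge(2)[OF q])
  have "ln (4 / A) * (1/2) \<le> ln (4 / A) * logw (\<phi> (sigma a w))" using L A4 by (rule mult_left_mono)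
  then have "logw (\<phi> (sigma a w)) + ln (4 / A) \<le> (1 + 2 * ln (4 / A)) * logw (\<phi> (sigma a w))"
    by (simp add: distrib_right)
  also have "\<dots> \<le> (33 * (1 - cmod w) powr (- 1/8)) * logw (\<phi> (sigma a w))"
    using ln_weight_le[of "cmod w"] w L by (intro mult_right_mono) (auto simp: A_def)
  finally show ?thesis using 1 by linarith
qed

text \<open>A hyperbolic disc of fixed radius around \<open>a\<close> is mapped near the circle as
  soon as its centre is. The 8 in the choice of \<open>e\<close> is 4 from
  \<open>Schwarz_Pick_distance\<close> times 2 from
  \<open>1 - x^2 \<le> 2 * (1 - x)\<close>.\<close>

lemma near_boundary:
  assumes s: "s \<in> {0<..<1}" and R: "0 \<le> R" "R < 1"
  obtains s' where "s' \<in> {0<..<1}"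
    "\<forall>a w. cmod a < 1 \<longrightarrow> s' < cmod (\<phi> a) \<longrightarrow> cmod w \<le> R \<longrightarrow> s < cmod (\<phi> (sigma a w))"
proof -
  have s2: "0 < 1 - s\<^sup>2" "1 - s\<^sup>2 \<le> 1" using one_minus_sq_bounds[of s] s by auto
  define e where "e = (1 - s\<^sup>2) * (1 - R) / 8"
  have "(1 - s\<^sup>2) * (1 - R) \<le> 1 * 1" using s2 R by (intro mult_mono) auto
  then have e: "0 < e" "e < 1" using s2 R by (auto simp: e_def)
  show thesis
  proof (rule that[of "1 - e"])
    show "1 - e \<in> {0<..<1}" using e by simp
    show "\<forall>a w. cmod a < 1 \<longrightarrow> 1 - e < cmod (\<phi> a) \<longrightarrow> cmod w \<le> R \<longrightarrow> s < cmod (\<phi> (sigma a w))"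
    proof (intro allI impI)
      fix a w assume a: "cmod a < 1" and ae: "1 - e < cmod (\<phi> a)" and w: "cmod w \<le> R"
      have w1: "cmod w < 1" using w R by simp
      have q: "cmod (\<phi> (sigma a w)) < 1" using a w1 by (simp add: \<phi>1)
      let ?Q = "1 - (cmod (\<phi> (sigma a w)))\<^sup>2"
      have "?Q * (1 - R) \<le> ?Q * (1 - (cmod w)\<^sup>2)"
        using norm_sq_bounds(1)[OF q] norm_sq_bounds(2)[OF w1] w by (intro mult_left_mono) auto
      also have "\<dots> \<le> 4 * (1 - (cmod (\<phi> a))\<^sup>2)" by (rule Schwarz_Pick_distance[OF \<phi> a w1])
      also have "\<dots> \<le> 8 * (1 - cmod (\<phi> a))" using norm_sq_bounds(3)[OF \<phi>1[OF a]] by simp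
      also have "\<dots> < 8 * e" using ae by simp
      also have "\<dots> = (1 - s\<^sup>2) * (1 - R)" by (simp add: e_def)
      finally have "?Q < 1 - s\<^sup>2" using R by (simp add: mult_less_cancel_right)
      then have "s\<^sup>2 < (cmod (\<phi> (sigma a w)))\<^sup>2" by simp
      then show "s < cmod (\<phi> (sigma a w))" by (rule power_less_imp_less_base) simp
    qed
  qed
qed

text \<open>\<open>logw_compare\<close> moves the logarithm from \<open>sigma a w\<close> to
  \<open>a\<close>, after which the derivative bound is integrated along the radius;
  \<open>264 = 8 * 33\<close>. Asking for the bound \<open>N\<close> only on
  \<open>cmod w \<le> cmod z\<close> allows a small \<open>N\<close> inside \<open>R\<close> and the
  global one outside.\<close>

lemma u_oscillation:
  assumes a: "cmod a < 1" and z: "cmod z < 1" and N: "0 \<le> N"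
    and bd: "\<And>w. cmod w \<le> cmod z \<Longrightarrow> bL (sigma a w) \<le> N"
  shows "logw (\<phi> a) * cmod (u (sigma a z) - u a) \<le> 264 * N * (1 - cmod z) powr (- 1/8)"
proof -
  note L = logw_ge(3)[OF \<phi>1[OF a]]
  have h: "(\<lambda>z. u (sigma a z)) holomorphic_on unit_disc"
    by (rule holomorphic_compose_disc[OF u sigma_holomorphic[OF a]]) (simp add: a)
  have "cmod ((\<lambda>z. u (sigma a z)) z - (\<lambda>z. u (sigma a z)) 0) \<le> 8 * (33 * N / logw (\<phi> a)) * (1 - cmod z) powr (- 1/8)"
  proof (rule power_growth[OF h z])
    show "0 \<le> 33 * N / logw (\<phi> a)" using N L by simp
    fix w assume wz: "cmod w \<le> cmod z"
    have w: "cmod w < 1" using wz z by simp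
    have q: "cmod (\<phi> (sigma a w)) < 1" using a w by (simp add: \<phi>1)
    have b0: "0 \<le> bderiv u (sigma a w)" using a w by (intro bderiv_nonneg) simp
    have "bderiv u (sigma a w) * logw (\<phi> a) \<le> bderiv u (sigma a w) * (33 * (1 - cmod w) powr (- 1/8) * logw (\<phi> (sigma a w)))"
      using logw_compare[OF a w] b0 by (rule mult_left_mono)
    also have "\<dots> = 33 * (1 - cmod w) powr (- 1/8) * bL (sigma a w)" by (simp add: bL_def)
    also have "\<dots> \<le> 33 * (1 - cmod w) powr (- 1/8) * N" using bd[OF wz] by (intro mult_left_mono) auto
    finally have "bderiv u (sigma a w) * logw (\<phi> a) \<le> 33 * N * (1 - cmod w) powr (- 1/8)" by (simp only: mult_ac)
    then have "bderiv u (sigma a w) \<le> 33 * N / logw (\<phi> a) * (1 - cmod w) powr (- 1/8)"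
      using L by (simp only: times_divide_eq_left pos_le_divide_eq)
    then show "(1 - (cmod w)\<^sup>2) * cmod (deriv (\<lambda>z. u (sigma a z)) w) \<le> 33 * N / logw (\<phi> a) * (1 - cmod w) powr (- 1/8)"
      by (simp only: norm_deriv_compose_sigma[OF u a w])
  qed
  then have "logw (\<phi> a) * cmod (u (sigma a z) - u a) \<le> logw (\<phi> a) * (8 * (33 * N / logw (\<phi> a)) * (1 - cmod z) powr (- 1/8))"
    using L by (intro mult_left_mono) auto
  also have "\<dots> = 264 * N * (1 - cmod z) powr (- 1/8)" using L by simp
  finally show ?thesis .
qed

lemma beta_le:
  assumes "bdry K" and K: "0 < K"
  shows "beta_t u \<phi> \<le> ennreal (1056 * K)"
proof -
  obtain s where s: "s \<in> {0<..<1}" "\<And>a. cmod a < 1 \<Longrightarrow> s < cmod (\<phi> a) \<Longrightarrow> bL a \<le> K"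
    using assms(1) unfolding bdry_def by blast
  obtain M where M': "0 < M" "\<And>a. cmod a < 1 \<Longrightarrow> tau a \<le> M" "\<And>a. cmod a < 1 \<Longrightarrow> bL a \<le> M"
    using tau_bL_bounded by blast
  note M = M'(1,3)
  have pos: "0 < 264 * K" "0 \<le> 264 * M" using K M(1) by auto
  \<comment> \<open>Order of choices: \<open>R\<close> from \<open>K\<close> and \<open>M\<close>,
    then \<open>s'\<close> from \<open>R\<close>, and only then the point \<open>a\<close>.\<close>
  obtain R where R: "0 \<le> R" "R < 1"
    "\<forall>c\<ge>0. \<forall>F. (\<forall>z. cmod z \<le> R \<longrightarrow> c * cmod (F z) \<le> (264 * K) * (1 - cmod z) powr (- 1/8)) \<longrightarrow>
      (\<forall>z. cmod z < 1 \<longrightarrow> c * cmod (F z) \<le> (264 * M) * (1 - cmod z) powr (- 1/8)) \<longrightarrow>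
      ennreal c * A2_norm F \<le> ennreal (4 * (264 * K))"
    by (rule A2_norm_scaled_small[OF pos])
  obtain s' where s': "s' \<in> {0<..<1}"
    "\<forall>a w. cmod a < 1 \<longrightarrow> s' < cmod (\<phi> a) \<longrightarrow> cmod w \<le> R \<longrightarrow> s < cmod (\<phi> (sigma a w))"
    by (rule near_boundary[OF s(1) R(1,2)])
  show ?thesis unfolding beta_t_def logw_def[symmetric]
  proof (rule limsup_bdry_le[OF s'(1)])
    fix a assume a: "cmod a < 1" and sa: "s' < cmod (\<phi> a)"
    have f1: "logw (\<phi> a) * cmod (u (sigma a z) - u a) \<le> 264 * K * (1 - cmod z) powr (- 1/8)" if z: "cmod z \<le> R" for z
    proof (rule u_oscillation[OF a])
      show "cmod z < 1" using z R by simp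
      show "0 \<le> K" using K by simp
      fix w assume "cmod w \<le> cmod z"
      then have w: "cmod w \<le> R" "cmod w < 1" using z R(2) by auto
      show "bL (sigma a w) \<le> K"
        by (rule s(2)[OF norm_sigma_less_1[OF a w(2)] s'(2)[rule_format, OF a sa w(1)]])
    qed
    have f2: "logw (\<phi> a) * cmod (u (sigma a z) - u a) \<le> 264 * M * (1 - cmod z) powr (- 1/8)" if z: "cmod z < 1" for z
    proof (rule u_oscillation[OF a z])
      show "0 \<le> M" using M(1) by simp
      show "bL (sigma a w) \<le> M" if "cmod w \<le> cmod z" for w
        using that z by (intro M(2) norm_sigma_less_1 a) simp
    qed
    have f0: "0 \<le> logw (\<phi> a)" using logw_ge(3)[OF \<phi>1[OF a]] by simp
    have "ennreal (logw (\<phi> a)) * A2_norm (\<lambda>z. u (sigma a z) - u a) \<le> ennreal (4 * (264 * K))"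
      by (rule R(3)[rule_format, OF f0 f1 f2])
    then show "ennreal (logw (\<phi> a)) * A2_norm (\<lambda>z. u (sigma a z) - u a) \<le> ennreal (1056 * K)" by simp
  qed
qed

text \<open>\<open>tau (sigma a w)\<close> contains \<open>u (sigma a w)\<close>, whereas
  \<open>alpha_t\<close> contains \<open>u a\<close>. Once \<open>logw (\<phi> a)\<close> is large,
  the oscillation of \<open>u\<close> is at most \<open>K\<close> times the weight, and it
  multiplies a hyperbolic derivative that is at most 1 by Schwarz--Pick. Replacing one value by the
  other thus costs only the summand \<open>K\<close>.\<close>

lemma self_map_growth:
  assumes a: "cmod a < 1" and z: "cmod z < 1" and N: "0 \<le> N" and K: "0 < K"
    and M: "0 < M" "\<And>a. cmod a < 1 \<Longrightarrow> bL a \<le> M" and La: "264 * M / K \<le> logw (\<phi> a)"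
    and bd: "\<And>w. cmod w \<le> cmod z \<Longrightarrow> tau (sigma a w) \<le> N"
  shows "cmod (u a) * cmod ((sigma (\<phi> a) \<circ> \<phi> \<circ> sigma a) z) \<le> 8 * (N + K) * (1 - cmod z) powr (- 1/8)"
proof (cases "u a = 0")
  case True
  then show ?thesis using N K by simp
next
  case False
  then have ua: "0 < cmod (u a)" by simp
  let ?S = "sigma (\<phi> a) \<circ> \<phi> \<circ> sigma a"
  note L = logw_ge(3)[OF \<phi>1[OF a]]
  have "cmod (?S z - ?S 0) \<le> 8 * ((N + K) / cmod (u a)) * (1 - cmod z) powr (- 1/8)"
  proof (rule power_growth[OF conjugate_self_map(1)[OF \<phi> a] z])
    show "0 \<le> (N + K) / cmod (u a)" using N K by simp
    fix w assume wz: "cmod w \<le> cmod z"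
    have w: "cmod w < 1" using wz z by simp
    define p where "p = sigma a w"
    have p: "cmod p < 1" using a w by (simp add: p_def)
    define t where "t = bderiv \<phi> p / (1 - (cmod (\<phi> p))\<^sup>2)"
    have t: "0 \<le> t" "t \<le> 1" unfolding t_def
      using Schwarz_Pick(2)[OF \<phi> p] bderiv_nonneg[OF p, of \<phi>] norm_sq_bounds(1)[OF \<phi>1[OF p]] by auto
    define W where "W = (1 - cmod w) powr (- 1/8)"
    have W: "1 \<le> W" unfolding W_def using w by (intro one_le_weight) auto
    \<comment> \<open>The outer automorphism is a hyperbolic isometry, so the only loss in passing
      to \<open>t\<close> is the factor \<open>1 - \<bar>?S w\<bar>^2 \<le> 1\<close>.\<close>
    have "bderiv ?S w = (1 - (cmod (?S w))\<^sup>2) * t"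
      unfolding conjugate_self_map(2)[OF \<phi> a w] t_def p_def by simp
    also have "\<dots> \<le> 1 * t" using t by (intro mult_right_mono) auto
    finally have 1: "bderiv ?S w \<le> t" by simp
    have "logw (\<phi> a) * cmod (u p - u a) \<le> 264 * M * W"
      unfolding p_def W_def
    proof (rule u_oscillation[OF a w])
      show "0 \<le> M" using M(1) by simp
      show "bL (sigma a v) \<le> M" if "cmod v \<le> cmod w" for v
        using that w by (intro M(2) norm_sigma_less_1 a) simp
    qed
    then have "cmod (u p - u a) \<le> 264 * M * W / logw (\<phi> a)" using L by (simp only: pos_le_divide_eq mult.commute)
    also have "\<dots> \<le> K * W"
    proof -
      have "264 * M \<le> K * logw (\<phi> a)" using La K by (simp add: field_simps)
      then have "264 * M * W \<le> (K * logw (\<phi> a)) * W" using W by (intro mult_right_mono) auto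
      then show ?thesis using L by (simp add: pos_divide_le_eq mult_ac)
    qed
    finally have 2: "cmod (u p - u a) \<le> K * W" .
    have "cmod (u a) \<le> cmod (u p) + cmod (u p - u a)" using norm_triangle_ineq4[of "u p" "u p - u a"] by simp
    then have "cmod (u a) * t \<le> (cmod (u p) + cmod (u p - u a)) * t" using t by (intro mult_right_mono) auto
    also have "\<dots> = tau p + cmod (u p - u a) * t" by (simp add: tau_def t_def distrib_right add_divide_distrib)
    also have "\<dots> \<le> N + cmod (u p - u a) * 1" using t bd[OF wz] by (intro add_mono mult_left_mono) (auto simp: p_def)
    also have "\<dots> \<le> N * W + K * W" using 2 W N mult_left_mono[of 1 W N] by simp
    finally have "cmod (u a) * t \<le> (N + K) * W" by (simp add: distrib_right)
    then have "t \<le> (N + K) / cmod (u a) * W" using ua by (simp add: field_simps)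
    with 1 show "bderiv ?S w \<le> (N + K) / cmod (u a) * (1 - cmod w) powr (- 1/8)" unfolding W_def by linarith
  qed
  then have "cmod (?S z) \<le> 8 * ((N + K) / cmod (u a)) * (1 - cmod z) powr (- 1/8)"
    by (simp only: conjugate_self_map(5)[OF \<phi> a] diff_zero)
  then have "cmod (u a) * cmod (?S z) \<le> cmod (u a) * (8 * ((N + K) / cmod (u a)) * (1 - cmod z) powr (- 1/8))"
    by (rule mult_left_mono) simp
  also have "\<dots> = 8 * (N + K) * (1 - cmod z) powr (- 1/8)" using ua by simp
  finally show ?thesis .
qed

lemma alpha_le:
  assumes "bdry K" and K: "0 < K"
  shows "alpha_t u \<phi> \<le> ennreal (64 * K)"
proof -
  obtain s where s: "s \<in> {0<..<1}" "\<And>a. cmod a < 1 \<Longrightarrow> s < cmod (\<phi> a) \<Longrightarrow> tau a \<le> K"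
    using assms(1) unfolding bdry_def by blast
  obtain M where M: "0 < M" "\<And>a. cmod a < 1 \<Longrightarrow> tau a \<le> M" "\<And>a. cmod a < 1 \<Longrightarrow> bL a \<le> M"
    using tau_bL_bounded by blast
  \<comment> \<open>\<open>self_map_growth\<close> is used with \<open>N = K\<close> inside
    \<open>R\<close> and with \<open>N = M\<close> on the whole disc; \<open>4 * 8 * 2\<close> gives
    the constant 64.\<close>
  have pos: "0 < 8 * (K + K)" "0 \<le> 8 * (M + K)" using K M(1) by auto
  obtain R where R: "0 \<le> R" "R < 1"
    "\<forall>c\<ge>0. \<forall>F. (\<forall>z. cmod z \<le> R \<longrightarrow> c * cmod (F z) \<le> (8 * (K + K)) * (1 - cmod z) powr (- 1/8)) \<longrightarrow>
      (\<forall>z. cmod z < 1 \<longrightarrow> c * cmod (F z) \<le> (8 * (M + K)) * (1 - cmod z) powr (- 1/8)) \<longrightarrow>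
      ennreal c * A2_norm F \<le> ennreal (4 * (8 * (K + K)))"
    by (rule A2_norm_scaled_small[OF pos])
  obtain s' where s': "s' \<in> {0<..<1}"
    "\<forall>a w. cmod a < 1 \<longrightarrow> s' < cmod (\<phi> a) \<longrightarrow> cmod w \<le> R \<longrightarrow> s < cmod (\<phi> (sigma a w))"
    by (rule near_boundary[OF s(1) R(1,2)])
  obtain s1 where s1: "s1 \<in> {0<..<1::real}" "\<And>w. s1 < cmod w \<Longrightarrow> cmod w < 1 \<Longrightarrow> 264 * M / K < logw w"
    using logw_large[of "264 * M / K"] by blast
  have ss: "max s' s1 \<in> {0<..<1}" using s'(1) s1(1) by auto
  show ?thesis unfolding alpha_t_def
  proof (rule limsup_bdry_le[OF ss])
    fix a assume a: "cmod a < 1" and sa: "max s' s1 < cmod (\<phi> a)"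
    have La: "264 * M / K \<le> logw (\<phi> a)" using s1(2)[OF _ \<phi>1[OF a]] sa by simp
    let ?S = "sigma (\<phi> a) \<circ> \<phi> \<circ> sigma a"
    have sa': "s' < cmod (\<phi> a)" using sa by simp
    have f1: "cmod (u a) * cmod (?S z) \<le> 8 * (K + K) * (1 - cmod z) powr (- 1/8)" if z: "cmod z \<le> R" for z
    proof (rule self_map_growth[OF a _ _ K M(1,3) La])
      show "cmod z < 1" using z R by simp
      show "0 \<le> K" using K by simp
      fix w assume "cmod w \<le> cmod z"
      then have w: "cmod w \<le> R" "cmod w < 1" using z R(2) by auto
      show "tau (sigma a w) \<le> K"
        by (rule s(2)[OF norm_sigma_less_1[OF a w(2)] s'(2)[rule_format, OF a sa' w(1)]])
    qed
    have f2: "cmod (u a) * cmod (?S z) \<le> 8 * (M + K) * (1 - cmod z) powr (- 1/8)" if z: "cmod z < 1" for z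
    proof (rule self_map_growth[OF a z _ K M(1,3) La])
      show "0 \<le> M" using M(1) by simp
      show "tau (sigma a w) \<le> M" if "cmod w \<le> cmod z" for w
        using that z by (intro M(2) norm_sigma_less_1 a) simp
    qed
    have "ennreal (cmod (u a)) * A2_norm ?S \<le> ennreal (4 * (8 * (K + K)))"
      by (rule R(3)[rule_format, OF norm_ge_zero f1 f2])
    then show "ennreal (cmod (u a)) * A2_norm ?S \<le> ennreal (64 * K)" by simp
  qed
qed

end

section \<open>Upper estimate of the essential norm\<close>

text \<open>Integration of the derivative bound gives \<open>M * logw z\<close>; the value at 0 adds
  another \<open>2 * M * logw z\<close> because \<open>logw z \<ge> 1/2\<close>.\<close>

lemma bloch_growth_le:
  assumes f: "f \<in> bloch_space" and fM: "bnorm f \<le> M" and z: "cmod z < 1"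
  shows "cmod (f z) \<le> 3 * M * logw z"
proof -
  have M: "0 \<le> M" using bnorm_nonneg[of f] fM by linarith
  have bd: "cmod (f 0) + bderiv f w \<le> M" if "cmod w < 1" for w using bnorm_bound[OF f that] fM by linarith
  have "cmod (f z - f 0) \<le> - M * ln (1 - cmod z) - (- M * ln (1 - 0))"
  proof (rule growth_comparison[OF bloch_space_holomorphic[OF f] z, where G' = "\<lambda>t. M / (1 - t)"])
    fix t :: real assume t: "0 \<le> t" "t \<le> cmod z"
    then have "1 - t > 0" using z by simp
    then show "((\<lambda>t. - M * ln (1 - t)) has_real_derivative M / (1 - t)) (at t)"
      by (auto intro!: derivative_eq_intros)
  next
    fix w assume w: "cmod w \<le> cmod z"
    then have w1: "cmod w < 1" using z by simp
    have "(1 - cmod w) * cmod (deriv f w) \<le> bderiv f w"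
      using norm_sq_bounds[OF w1] by (intro mult_right_mono) auto
    also have "\<dots> \<le> M" using bd[OF w1] norm_ge_zero[of "f 0"] by linarith
    finally show "cmod (deriv f w) \<le> M / (1 - cmod w)" using w1 by (simp add: pos_le_divide_eq mult.commute)
  qed
  moreover have "- ln (1 - cmod z) \<le> logw z"
  proof -
    have "1 / (1 - cmod z) \<le> 2 / (1 - (cmod z)\<^sup>2)"
      using norm_sq_bounds(1,3)[OF z] z by (simp add: field_simps)
    then have "ln (1 / (1 - cmod z)) \<le> ln (2 / (1 - (cmod z)\<^sup>2))"
      using norm_sq_bounds(1)[OF z] z by (subst ln_le_cancel_iff) auto
    then show ?thesis using z by (simp add: logw_def ln_div)
  qed
  ultimately have 1: "cmod (f z - f 0) \<le> M * logw z"
    using M mult_left_mono[of "- ln (1 - cmod z)" "logw z" M] by simp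
  have "cmod (f 0) + cmod (deriv f 0) \<le> M" using bd[of 0] by simp
  then have "cmod (f 0) \<le> M" using norm_ge_zero[of "deriv f 0"] by linarith
  also have "M \<le> M * (2 * logw z)" using logw_ge(2)[OF z] M mult_left_mono[of 1 "2 * logw z" M] by simp
  finally have "cmod (f 0) \<le> M * (2 * logw z)" .
  moreover have "cmod (f z) \<le> cmod (f z - f 0) + cmod (f 0)" using norm_triangle_ineq[of "f z - f 0" "f 0"] by simp
  ultimately show ?thesis using 1 by (simp add: algebra_simps)
qed

lemma logw_mono: "cmod w \<le> cmod z \<Longrightarrow> cmod z < 1 \<Longrightarrow> logw w \<le> logw z"
proof -
  assume wz: "cmod w \<le> cmod z" and z: "cmod z < 1"
  have w: "cmod w < 1" using wz z by simp
  have "(cmod w)\<^sup>2 \<le> (cmod z)\<^sup>2" using wz by (intro power_mono) auto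
  then have "2 / (1 - (cmod w)\<^sup>2) \<le> 2 / (1 - (cmod z)\<^sup>2)"
    using norm_sq_bounds(1)[OF z] norm_sq_bounds(1)[OF w] by (intro divide_left_mono) auto
  then show ?thesis unfolding logw_def using norm_sq_bounds(1)[OF z] norm_sq_bounds(1)[OF w]
    by (subst ln_le_cancel_iff) auto
qed

section \<open>Cauchy estimates and dilations\<close>

lemma Cauchy_deriv_bound:
  assumes h: "h holomorphic_on unit_disc" and st: "0 \<le> s" "s < t" "t < 1"
    and bd: "\<And>w. cmod w \<le> t \<Longrightarrow> cmod (h w) \<le> B" and z: "cmod z \<le> s"
  shows "cmod (deriv h z) \<le> B / (t - s)"
proof -
  have sub: "cball z (t - s) \<subseteq> unit_disc"
  proof
    fix w assume "w \<in> cball z (t - s)"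
    then have "cmod (w - z) \<le> t - s" by (simp add: dist_norm norm_minus_commute)
    then have "cmod w \<le> t" using norm_triangle_ineq[of "w - z" z] z by simp
    then show "w \<in> unit_disc" using st by simp
  qed
  have "cmod ((deriv ^^ 1) h z) \<le> fact 1 * B / (t - s) ^ 1"
  proof (rule Cauchy_inequality)
    show "h holomorphic_on ball z (t - s)" using holomorphic_on_subset[OF h] sub ball_subset_cball by blast
    show "continuous_on (cball z (t - s)) h" using holomorphic_on_imp_continuous_on[OF holomorphic_on_subset[OF h sub]] .
    show "0 < t - s" using st by simp
    fix x assume "cmod (z - x) = t - s"
    then have "cmod x \<le> t" using norm_triangle_ineq[of "x - z" z] z by (simp add: norm_minus_commute)
    then show "cmod (h x) \<le> B" by (rule bd)
  qed
  then show ?thesis by simp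
qed

lemma dilation_holomorphic:
  assumes f: "f holomorphic_on unit_disc" and r: "0 \<le> r" "r < 1"
  shows "(\<lambda>z. f (of_real r * z)) holomorphic_on unit_disc"
    and "\<And>z. cmod z < 1 \<Longrightarrow> deriv (\<lambda>z. f (of_real r * z)) z = deriv f (of_real r * z) * of_real r"
proof -
  have l: "(\<lambda>z. of_real r * z) holomorphic_on unit_disc" by (intro holomorphic_intros)
  have n: "cmod (of_real r * z) < 1" if "cmod z < 1" for z
  proof -
    have "cmod (of_real r * z) = r * cmod z" using r by (simp add: norm_mult)
    also have "\<dots> \<le> cmod z" using r by (intro mult_left_le_one_le) auto
    finally show ?thesis using that by simp
  qed
  show "(\<lambda>z. f (of_real r * z)) holomorphic_on unit_disc" by (rule holomorphic_compose_disc[OF f l n])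
  fix z :: complex assume z: "cmod z < 1"
  have "deriv (\<lambda>z. of_real r * z) z = of_real r" by (rule DERIV_imp_deriv) (auto intro!: derivative_eq_intros)
  then show "deriv (\<lambda>z. f (of_real r * z)) z = deriv f (of_real r * z) * of_real r"
    using deriv_compose_disc[OF f l n z] by simp
qed

lemma norm_dilation:
  assumes "0 \<le> r" "r < 1" "cmod z \<le> x"
  shows "cmod (of_real r * z) \<le> x" "cmod (of_real r * z) \<le> r * x"
proof -
  have "cmod (of_real r * z) = r * cmod z" using assms by (simp add: norm_mult)
  moreover have "r * cmod z \<le> cmod z" using assms by (intro mult_left_le_one_le) auto
  moreover have "r * cmod z \<le> r * x" using assms by (intro mult_left_mono) auto
  ultimately show "cmod (of_real r * z) \<le> x" "cmod (of_real r * z) \<le> r * x" using assms by linarith+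
qed

text \<open>Cauchy's estimate uses only a bound up to \<open>(1 + r) / 2\<close>, midway between
  \<open>r\<close> and the circle. No Bloch bound on \<open>f\<close> is assumed, so the lemma also
  applies to a locally uniform limit that is known only to be holomorphic.\<close>

lemma dilation_bloch:
  assumes f: "f holomorphic_on unit_disc" and r: "0 \<le> r" "r < 1" and bd: "\<And>w. cmod w \<le> (1 + r) / 2 \<Longrightarrow> cmod (f w) \<le> B"
  shows "(\<lambda>z. f (of_real r * z)) \<in> bloch_space" "bnorm (\<lambda>z. f (of_real r * z)) \<le> B + B / ((1 + r) / 2 - r)"
proof -
  have d: "bderiv (\<lambda>z. f (of_real r * z)) z \<le> B / ((1 + r) / 2 - r)" if z: "cmod z < 1" for z
  proof -
    have rz: "cmod (of_real r * z) \<le> r" using norm_dilation(2)[OF r, of z 1] z by simp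
    have c: "cmod (deriv f (of_real r * z)) \<le> B / ((1 + r) / 2 - r)"
      using r by (intro Cauchy_deriv_bound[OF f r(1) _ _ bd rz]) auto
    have "bderiv (\<lambda>z. f (of_real r * z)) z = (1 - (cmod z)\<^sup>2) * r * cmod (deriv f (of_real r * z))"
      unfolding dilation_holomorphic(2)[OF f r z] using r by (simp add: norm_mult)
    also have "\<dots> \<le> 1 * cmod (deriv f (of_real r * z))"
      using r norm_sq_bounds[OF z] by (intro mult_right_mono mult_le_one) auto
    finally show ?thesis using c by simp
  qed
  show A: "(\<lambda>z. f (of_real r * z)) \<in> bloch_space" by (rule bloch_spaceI[OF dilation_holomorphic(1)[OF f r] d])
  show "bnorm (\<lambda>z. f (of_real r * z)) \<le> B + B / ((1 + r) / 2 - r)"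
  proof (rule bnorm_le[OF A])
    fix z :: complex assume "cmod z < 1"
    moreover have "cmod (f (of_real r * 0)) \<le> B" using r by (intro bd) simp
    ultimately show "cmod (f (of_real r * 0)) + bderiv (\<lambda>z. f (of_real r * z)) z \<le> B + B / ((1 + r) / 2 - r)"
      using d by (intro add_mono) auto
  qed
qed

lemma dilation_bloch':
  assumes f: "f \<in> bloch_space" and r: "0 \<le> r" "r < 1"
  shows "(\<lambda>z. f (of_real r * z)) \<in> bloch_space"
proof (rule dilation_bloch(1)[OF bloch_space_holomorphic[OF f] r])
  fix w assume w: "cmod w \<le> (1 + r) / 2"
  define p where "p = complex_of_real ((1 + r) / 2)"
  have p: "cmod p < 1" "cmod w \<le> cmod p" using w r unfolding p_def norm_of_real by auto
  have "cmod (f w) \<le> 3 * bnorm f * logw w" using p by (intro bloch_growth_le[OF f]) auto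
  also have "\<dots> \<le> 3 * bnorm f * logw p" using logw_mono[OF p(2,1)] by (intro mult_left_mono) auto
  finally show "cmod (f w) \<le> 3 * bnorm f * logw p" .
qed

section \<open>Approximation of the operator by dilated ones\<close>

context bloch_wcomp
begin

text \<open>Logarithmic growth makes a norm-bounded sequence a normal family. Montel gives uniform
  convergence on a slightly larger disc than the one of radius \<open>r\<close>, dilation upgrades
  it to convergence in Bloch norm, and the bounded operator preserves that.\<close>

lemma dilated_compact:
  assumes r: "0 \<le> r" "r < 1"
  shows "compact_bloch_op (\<lambda>f. T (\<lambda>z. f (of_real r * z)))"
  unfolding compact_bloch_op_def
proof (intro conjI ballI allI impI)
  show "T (\<lambda>z. f (of_real r * z)) \<in> bloch_space" if "f \<in> bloch_space" for f
    by (rule T_mem[OF dilation_bloch'[OF that r]])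
  show "T (\<lambda>z. a * f (of_real r * z) + b * g (of_real r * z)) z =
       a * T (\<lambda>z. f (of_real r * z)) z + b * T (\<lambda>z. g (of_real r * z)) z" for f g a b z
    by (simp add: wcomp_def algebra_simps)
  fix F :: "nat \<Rightarrow> complex \<Rightarrow> complex"
  assume "(\<forall>n. F n \<in> bloch_space) \<and> (\<exists>M::real. \<forall>n. bloch_norm (F n) \<le> ennreal M)"
  then obtain M :: real where FB: "\<And>n. F n \<in> bloch_space" and FM: "\<And>n. bloch_norm (F n) \<le> ennreal M" by blast
  have bn: "bnorm (F n) \<le> max M 0" for n
  proof -
    have "ennreal (bnorm (F n)) \<le> ennreal (max M 0)"
      using order_trans[OF FM[of n] ennreal_leI[of M "max M 0"]] unfolding bloch_norm_eq_bnorm[OF FB] by simp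
    then show ?thesis by (simp only: ennreal_le_iff max.cobounded2)
  qed
  obtain g \<rho> where g: "g holomorphic_on unit_disc" "strict_mono (\<rho> :: nat \<Rightarrow> nat)"
    "\<And>K. compact K \<Longrightarrow> K \<subseteq> unit_disc \<Longrightarrow> uniform_limit K (F \<circ> \<rho>) g sequentially"
  proof (rule Montel[of unit_disc "range F" F])
    show "h holomorphic_on unit_disc" if "h \<in> range F" for h using that FB bloch_space_holomorphic by auto
    fix K assume K: "compact K" "K \<subseteq> unit_disc"
    show "\<exists>B. \<forall>h\<in>range F. \<forall>z\<in>K. cmod (h z) \<le> B"
    proof (cases "K = {}")
      case False
      have "compact (cmod ` K)" using K(1) by (intro compact_continuous_image continuous_intros)
      \<comment> \<open>A point of largest modulus: since \<open>logw\<close> increases with the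
        modulus, \<open>logw p\<close> serves the whole compact set.\<close>
      then obtain p where p: "p \<in> K" "\<And>z. z \<in> K \<Longrightarrow> cmod z \<le> cmod p"
        using compact_attains_sup[of "cmod ` K"] False by auto
      have p1: "cmod p < 1" using p(1) K(2) by auto
      have "cmod (F n z) \<le> 3 * max M 0 * logw p" if z: "z \<in> K" for n z
      proof -
        have "cmod (F n z) \<le> 3 * max M 0 * logw z" using z K(2) by (intro bloch_growth_le[OF FB bn]) auto
        also have "\<dots> \<le> 3 * max M 0 * logw p" using logw_mono[OF p(2)[OF z] p1] by (intro mult_left_mono) auto
        finally show ?thesis .
      qed
      then show ?thesis by blast
    qed simp
  qed auto
  define t where "t = (1 + r) / 2"
  have t: "r < t" "t < 1" using r by (auto simp: t_def)
  have ul: "uniform_limit (cball 0 t) (F \<circ> \<rho>) g sequentially"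
    using t by (intro g(3)) auto
  obtain C where C: "0 \<le> C" "\<And>f. f \<in> bloch_space \<Longrightarrow> bnorm (T f) \<le> C * bnorm f" using T_bound by blast
  have gB: "(\<lambda>z. g (of_real r * z)) \<in> bloch_space"
  proof -
    have "compact (g ` cball 0 t)"
      using t by (intro compact_continuous_image holomorphic_on_imp_continuous_on[OF holomorphic_on_subset[OF g(1)]]) auto
    then obtain B where B: "\<And>x. x \<in> g ` cball 0 t \<Longrightarrow> cmod x \<le> B" using compact_imp_bounded bounded_iff by metis
    show ?thesis by (rule dilation_bloch(1)[OF g(1) r, of B]) (use B in \<open>auto simp: t_def\<close>)
  qed
  have lim: "(\<lambda>n. bloch_norm (\<lambda>z. T (\<lambda>z. F (\<rho> n) (of_real r * z)) z - T (\<lambda>z. g (of_real r * z)) z)) \<longlonglongrightarrow> 0"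
  proof -
    define H where "H n z = F (\<rho> n) z - g z" for n z
    have Hh: "H n holomorphic_on unit_disc" for n
      unfolding H_def[abs_def] by (intro holomorphic_intros g(1) bloch_space_holomorphic FB)
    have eq: "(\<lambda>z. T (\<lambda>z. F (\<rho> n) (of_real r * z)) z - T (\<lambda>z. g (of_real r * z)) z)
       = T (\<lambda>z. H n (of_real r * z))" for n by (simp add: wcomp_def H_def fun_eq_iff algebra_simps)
    define c where "c = C * (1 + 1 / (t - r))"
    have c: "0 \<le> c" using C t by (simp add: c_def)
    have main: "\<forall>\<^sub>F n in sequentially. bnorm (T (\<lambda>z. H n (of_real r * z))) \<le> c * e" if e: "0 < e" for e
    proof -
      have "\<forall>\<^sub>F n in sequentially. \<forall>x\<in>cball 0 t. dist ((F \<circ> \<rho>) n x) (g x) < e"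
        using ul e unfolding uniform_limit_iff by blast
      then show ?thesis
      proof eventually_elim
        case (elim n)
        have bd: "cmod (H n w) \<le> e" if "cmod w \<le> (1 + r) / 2" for w
          using elim that by (simp add: H_def dist_norm t_def less_imp_le)
        note db = dilation_bloch[OF Hh r bd]
        have "bnorm (T (\<lambda>z. H n (of_real r * z))) \<le> C * bnorm (\<lambda>z. H n (of_real r * z))" by (rule C(2)[OF db(1)])
        also have "\<dots> \<le> C * (e + e / ((1 + r) / 2 - r))" by (rule mult_left_mono[OF db(2) C(1)])
        also have "\<dots> = c * e" by (simp add: c_def t_def distrib_left distrib_right)
        finally show ?case .
      qed
    qed
    have memb: "T (\<lambda>z. H n (of_real r * z)) \<in> bloch_space" for n
      unfolding eq[symmetric] by (intro bloch_diff(1) T_mem gB dilation_bloch'[OF FB r])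
    have "(\<lambda>n. bnorm (T (\<lambda>z. H n (of_real r * z)))) \<longlonglongrightarrow> 0"
    proof (rule tendstoI)
      fix e :: real assume e: "0 < e"
      \<comment> \<open>The 1 added to \<open>c\<close> covers \<open>c = 0\<close>; the factor 2
        turns the weak inequality of \<open>main\<close> into a strict one.\<close>
      define d where "d = e / (2 * (c + 1))"
      have c1: "0 < c + 1" using c by simp
      have d: "0 < d" using e c by (simp add: d_def)
      have "(c + 1) * d = e / 2" using c1 unfolding d_def by (simp add: divide_simps)
      then have "c * d < e" using d e by (simp add: distrib_right)
      then show "\<forall>\<^sub>F n in sequentially. dist (bnorm (T (\<lambda>z. H n (of_real r * z)))) 0 < e"
        using main[OF d] by (auto elim: eventually_mono)
    qed
    then have "(\<lambda>n. ennreal (bnorm (T (\<lambda>z. H n (of_real r * z))))) \<longlonglongrightarrow> ennreal 0" by (rule tendsto_ennrealI)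
    then show ?thesis unfolding eq bloch_norm_eq_bnorm[OF memb] by simp
  qed
  show "\<exists>\<rho> G. strict_mono \<rho> \<and> G \<in> bloch_space \<and>
      (\<lambda>n. bloch_norm (\<lambda>z. T (\<lambda>z. F (\<rho> n) (of_real r * z)) z - G z)) \<longlonglongrightarrow> 0"
    using g(2) T_mem[OF gB] lim by blast
qed

text \<open>Let \<open>h\<close> be \<open>f\<close> minus its dilation. Where
  \<open>\<phi> z\<close> is near the circle, the growth bounds \<open>6 * logw\<close> and 2 for
  \<open>h\<close> meet \<open>bL \<le> K\<close> and \<open>tau \<le> K\<close>, giving
  \<open>8 * K\<close>. Elsewhere \<open>h\<close> and its derivative are uniformly small once
  \<open>r\<close> is close to 1, so those contributions and the value at 0 can be made at most
  \<open>K\<close>.\<close>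

lemma ess_le:
  assumes "bdry K" and K: "0 < K"
  shows "bloch_ess_norm (T) \<le> ennreal (10 * K)"
proof -
  obtain s where s: "s \<in> {0<..<1}" "\<And>a. cmod a < 1 \<Longrightarrow> s < cmod (\<phi> a) \<Longrightarrow> tau a \<le> K"
    "\<And>a. cmod a < 1 \<Longrightarrow> s < cmod (\<phi> a) \<Longrightarrow> bL a \<le> K"
    using assms(1) unfolding bdry_def by blast
  obtain M where M: "0 < M" "\<And>a. cmod a < 1 \<Longrightarrow> tau a \<le> M" "\<And>a. cmod a < 1 \<Longrightarrow> bL a \<le> M"
    using tau_bL_bounded by blast
  \<comment> \<open>Including \<open>cmod (\<phi> 0)\<close> puts the value of \<open>T h\<close> at
    the origin under the same smallness estimate.\<close>
  define m where "m = max s (cmod (\<phi> 0))"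
  have m: "0 \<le> m" "m < 1" using s(1) \<phi>1[of 0] by (auto simp: m_def)
  define t where "t = (1 + m) / 2"
  have t: "m < t" "t < 1" using m by (auto simp: t_def)
  \<comment> \<open>\<open>c\<close> collects every coefficient of \<open>e\<close>: the value at 0,
    the bound \<open>2 * M\<close> for \<open>bderiv u\<close>, and \<open>tau\<close> times
    Cauchy's estimate across the gap \<open>t - m\<close>.\<close>
  define c where "c = cmod (u 0) + 2 * M + M / (t - m)"
  have c: "0 < c" using M(1) t by (simp add: c_def add_nonneg_pos add_pos_nonneg)
  define e where "e = K / c"
  have e: "0 < e" using K c by (simp add: e_def)
  \<comment> \<open>On \<open>cmod w \<le> t\<close> the mean value inequality bounds
    \<open>h\<close> by \<open>(1 - r) / (1 - t)\<close>, which is to be at most \<open>e\<close>;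
    the maximum with 0 covers large \<open>e\<close>.\<close>
  define r where "r = max 0 (1 - e * (1 - t))"
  have r: "0 \<le> r" "r < 1" "1 - r \<le> e * (1 - t)" using e t by (auto simp: r_def)
  let ?K = "\<lambda>f. T (\<lambda>z. f (of_real r * z))"
  have "bloch_opnorm_diff (T) ?K \<le> ennreal (10 * K)"
    unfolding bloch_opnorm_diff_def
  proof (rule SUP_least)
    fix f assume "f \<in> {f \<in> bloch_space. bloch_norm f \<le> 1}"
    then have fB: "f \<in> bloch_space" and f1: "bloch_norm f \<le> 1" by auto
    have bn: "bnorm f \<le> 1" using f1 ennreal_le_iff[of 1 "bnorm f"] by (simp add: bloch_norm_eq_bnorm[OF fB])
    note fh = bloch_space_holomorphic[OF fB]
    have bdf: "bderiv f w \<le> 1" if "cmod w < 1" for w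
      using bnorm_bound[OF fB that] bn norm_ge_zero[of "f 0"] by linarith
    define h where "h = (\<lambda>z. f z - f (of_real r * z))"
    have hh: "h holomorphic_on unit_disc"
      unfolding h_def by (intro holomorphic_intros fh dilation_holomorphic(1)[OF fh r(1,2)])
    have h_small: "cmod (h w) \<le> e" if w: "cmod w \<le> t" for w
    proof -
      have "cmod (f w - f (of_real r * w)) \<le> 1 / (1 - t) * cmod (w - of_real r * w)"
      proof (rule field_differentiable_bound[of "cball 0 t" f "deriv f"])
        fix z :: complex assume z: "z \<in> cball 0 t"
        then have z1: "cmod z \<le> t" "cmod z < 1" using t by auto
        show "(f has_field_derivative deriv f z) (at z within cball 0 t)"
          using field_differentiable_derivI[OF differentiable_disc[OF fh z1(2)]] by (rule has_field_derivative_at_within)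
        have "(1 - t) * cmod (deriv f z) \<le> bderiv f z"
          using norm_sq_bounds(2)[OF z1(2)] z1 by (intro mult_right_mono) auto
        also have "\<dots> \<le> 1" by (rule bdf[OF z1(2)])
        finally show "cmod (deriv f z) \<le> 1 / (1 - t)" using t by (simp add: pos_le_divide_eq mult.commute)
      qed (use w norm_dilation(1)[OF r(1,2) w] in auto)
      also have "w - of_real r * w = of_real (1 - r) * w" by (simp add: algebra_simps)
      also have "cmod (of_real (1 - r) * w) = (1 - r) * cmod w"
        using r by (simp only: norm_mult norm_of_real abs_of_nonneg diff_ge_0_iff_ge less_imp_le)
      also have "1 / (1 - t) * ((1 - r) * cmod w) \<le> 1 / (1 - t) * (e * (1 - t) * 1)"
        using r t w e by (intro mult_left_mono mult_mono) auto
      also have "\<dots> = e" using t by simp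
      finally show ?thesis by (simp add: h_def)
    qed
    have h'_small: "cmod (deriv h w) \<le> e / (t - m)" if w: "cmod w \<le> m" for w
      by (rule Cauchy_deriv_bound[OF hh m(1) t h_small w])
    have hB: "h \<in> bloch_space" unfolding h_def by (intro bloch_diff(1) fB dilation_bloch'[OF fB r(1,2)])
    have h_growth: "cmod (h w) \<le> 6 * logw w" if w: "cmod w < 1" for w
    proof -
      have "cmod (f w) \<le> 3 * 1 * logw w" by (rule bloch_growth_le[OF fB bn w])
      moreover have "cmod (f (of_real r * w)) \<le> 3 * 1 * logw (of_real r * w)"
        using norm_dilation(1)[OF r(1,2), of w "cmod w"] w by (intro bloch_growth_le[OF fB bn]) auto
      moreover have "logw (of_real r * w) \<le> logw w" using norm_dilation(1)[OF r(1,2), of w "cmod w"] w by (intro logw_mono) auto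
      ultimately show ?thesis unfolding h_def using norm_triangle_ineq4[of "f w" "f (of_real r * w)"] by linarith
    qed
    have h'_growth: "(1 - (cmod w)\<^sup>2) * cmod (deriv h w) \<le> 2" if w: "cmod w < 1" for w
    proof -
      let ?v = "of_real r * w"
      have v: "cmod ?v \<le> cmod w" "cmod ?v < 1" using norm_dilation(1)[OF r(1,2), of w "cmod w"] w by auto
      have "deriv h w = deriv f w - deriv f ?v * of_real r"
        unfolding h_def dilation_holomorphic(2)[OF fh r(1,2) w, symmetric]
        by (rule deriv_diff[OF differentiable_disc[OF fh w] differentiable_disc[OF dilation_holomorphic(1)[OF fh r(1,2)] w]])
      then have "cmod (deriv h w) \<le> cmod (deriv f w) + cmod (deriv f ?v) * r"
        using norm_triangle_ineq4[of "deriv f w" "deriv f ?v * of_real r"] r by (simp add: norm_mult)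
      also have "\<dots> \<le> cmod (deriv f w) + cmod (deriv f ?v) * 1" using r by (intro add_left_mono mult_left_mono) auto
      finally have "bderiv h w \<le> (1 - (cmod w)\<^sup>2) * (cmod (deriv f w) + cmod (deriv f ?v) * 1)"
        using norm_sq_bounds(1)[OF w] by (intro mult_left_mono) auto
      also have "\<dots> = bderiv f w + (1 - (cmod w)\<^sup>2) * cmod (deriv f ?v)" by (simp add: distrib_left)
      also have "\<dots> \<le> bderiv f w + bderiv f ?v" using v by (intro add_left_mono mult_right_mono) (auto intro!: power_mono)
      also have "\<dots> \<le> 2" using bdf[OF w] bdf[OF v(2)] by linarith
      finally show ?thesis .
    qed
    have eq: "(\<lambda>z. T f z - ?K f z) = T h" by (simp add: wcomp_def h_def fun_eq_iff algebra_simps)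
    have split: "bderiv (T h) z \<le> bderiv u z * cmod (h (\<phi> z)) + tau z * ((1 - (cmod (\<phi> z))\<^sup>2) * cmod (deriv h (\<phi> z)))"
      if z: "cmod z < 1" for z
    proof -
      have "cmod (deriv (T h) z) \<le> cmod (deriv u z) * cmod (h (\<phi> z)) + cmod (u z) * (cmod (deriv h (\<phi> z)) * cmod (deriv \<phi> z))"
        unfolding deriv_T[OF hh z] using norm_triangle_ineq[of "deriv u z * h (\<phi> z)" "u z * (deriv h (\<phi> z) * deriv \<phi> z)"]
        by (simp add: norm_mult)
      then have "bderiv (T h) z \<le> (1 - (cmod z)\<^sup>2) * (cmod (deriv u z) * cmod (h (\<phi> z)) + cmod (u z) * (cmod (deriv h (\<phi> z)) * cmod (deriv \<phi> z)))"
        using norm_sq_bounds(1)[OF z] by (intro mult_left_mono) auto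
      also have "\<dots> = bderiv u z * cmod (h (\<phi> z)) + (cmod (u z) * bderiv \<phi> z) * cmod (deriv h (\<phi> z))" by (simp add: algebra_simps)
      also have "\<dots> = bderiv u z * cmod (h (\<phi> z)) + tau z * ((1 - (cmod (\<phi> z))\<^sup>2) * cmod (deriv h (\<phi> z)))"
        unfolding tau_eq[OF z, symmetric] by (simp only: mult.assoc)
      finally show ?thesis .
    qed
    have b: "bderiv (T h) z \<le> 8 * K + (2 * M * e + M * (e / (t - m)))" if z: "cmod z < 1" for z
    proof (cases "s < cmod (\<phi> z)")
      case True
      have "bderiv u z * cmod (h (\<phi> z)) \<le> bderiv u z * (6 * logw (\<phi> z))"
        using h_growth[OF \<phi>1[OF z]] bderiv_nonneg[OF z] by (rule mult_left_mono)
      also have "\<dots> = 6 * bL z" by (simp add: bL_def)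
      also have "\<dots> \<le> 6 * K" using s(3)[OF z True] by simp
      finally have 1: "bderiv u z * cmod (h (\<phi> z)) \<le> 6 * K" .
      have "tau z * ((1 - (cmod (\<phi> z))\<^sup>2) * cmod (deriv h (\<phi> z))) \<le> K * 2"
        using s(2)[OF z True] h'_growth[OF \<phi>1[OF z]] tau_nonneg[OF z] K bderiv_nonneg[OF \<phi>1[OF z], of h]
        by (intro mult_mono) auto
      moreover have "0 \<le> 2 * M * e + M * (e / (t - m))" using M(1) e t by simp
      ultimately show ?thesis using 1 split[OF z] by linarith
    next
      case False
      then have fm: "cmod (\<phi> z) \<le> m" by (simp add: m_def)
      then have ft: "cmod (\<phi> z) \<le> t" using t by simp
      have "bderiv u z \<le> 2 * M" using bderiv_u_le[OF z] M(3)[OF z] by linarith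
      from mult_mono[OF this h_small[OF ft]]
      have 1: "bderiv u z * cmod (h (\<phi> z)) \<le> 2 * M * e" using M(1) by simp
      have "bderiv h (\<phi> z) \<le> 1 * cmod (deriv h (\<phi> z))"
        using norm_sq_bounds[OF \<phi>1[OF z]] by (intro mult_right_mono) auto
      also have "\<dots> \<le> e / (t - m)" using h'_small[OF fm] by simp
      finally have bh: "bderiv h (\<phi> z) \<le> e / (t - m)" .
      have "tau z * bderiv h (\<phi> z) \<le> M * (e / (t - m))"
        using M(1) by (intro mult_mono[OF M(2)[OF z] bh] bderiv_nonneg \<phi>1 z) simp
      then show ?thesis using 1 split[OF z] K by linarith
    qed
    have z0: "cmod (T h 0) \<le> cmod (u 0) * e"
    proof -
      have "cmod (\<phi> 0) \<le> t" using t by (simp add: m_def)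
      from h_small[OF this] show ?thesis unfolding wcomp_def norm_mult by (intro mult_left_mono) auto
    qed
    have ce: "cmod (u 0) * e + (2 * M * e + M * (e / (t - m))) = K"
    proof -
      have "cmod (u 0) * e + (2 * M * e + M * (e / (t - m))) = c * e" by (simp add: c_def distrib_right add_divide_distrib)
      then show ?thesis using c by (simp add: e_def)
    qed
    have "cmod (T h 0) + bderiv (T h) z \<le> 10 * K" if z: "cmod z < 1" for z
      using b[OF z] z0 ce K by linarith
    then show "bloch_norm (\<lambda>z. T f z - ?K f z) \<le> ennreal (10 * K)"
      unfolding eq using K by (simp add: bloch_norm_le_iff)
  qed
  then show ?thesis unfolding bloch_ess_norm_def
    using dilated_compact[OF r(1,2)] by (intro INF_lower2[of ?K]) auto
qed

end

section \<open>Lower estimates of the essential norm\<close>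

text \<open>For finite \<open>X\<close> one lets \<open>k\<close> decrease to it; for infinite
  \<open>X\<close> the right side is infinite because \<open>C > 0\<close>. Starting from a strict
  bound is what lets infima and limsups be replaced by witnesses.\<close>

lemma ennreal_scaled_leI:
  assumes C: "0 < C" and le: "\<And>k. 0 < k \<Longrightarrow> X < ennreal k \<Longrightarrow> Y \<le> ennreal (C * k)"
  shows "Y \<le> ennreal C * X"
proof (cases X)
  case (real x)
  have "Y \<le> ennreal (C * x)"
  proof (rule ennreal_le_epsilon)
    fix e :: real assume e: "0 < e"
    have k: "0 < x + e / C" using real(1) e C by (simp add: add_nonneg_pos)
    have "X < ennreal (x + e / C)" unfolding real(2) using real(1) e C by (simp add: ennreal_less_iff)
    then have "Y \<le> ennreal (C * (x + e / C))" by (rule le[OF k])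
    also have "C * (x + e / C) = C * x + e" using C by (simp add: distrib_left)
    also have "ennreal (C * x + e) = ennreal (C * x) + ennreal e" using real(1) e C by (intro ennreal_plus) auto
    finally show "Y \<le> ennreal (C * x) + ennreal e" .
  qed
  also have "\<dots> = ennreal C * X" unfolding real(2) using C by (intro ennreal_mult') simp
  finally show ?thesis .
next
  case top
  then show ?thesis using C by (simp add: ennreal_mult_top)
qed

context bloch_wcomp
begin

lemma powers_le:
  assumes ess: "bloch_ess_norm (T) < ennreal k"
  shows "Limsup sequentially (\<lambda>n. bloch_norm (\<lambda>z. u z * \<phi> z ^ n)) \<le> ennreal (4 * k)"
proof (rule Limsup_bounded)
  have W: "weakly_null 3 (\<lambda>n z. sigma 0 z ^ n)" by (rule sigma_power_weakly_null[of "\<lambda>_. 0" 0]) auto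
  have "\<forall>\<^sub>F n in sequentially. bnorm (T (\<lambda>z. sigma 0 z ^ n)) \<le> (3 + 1) * k"
    by (rule ess_norm_weakly_null[OF bounded ess W]) simp
  then show "\<forall>\<^sub>F n in sequentially. bloch_norm (\<lambda>z. u z * \<phi> z ^ n) \<le> ennreal (4 * k)"
  proof eventually_elim
    case (elim n)
    have B: "T (\<lambda>z. sigma 0 z ^ n) \<in> bloch_space" by (rule T_mem[OF sigma_power_bloch(1)]) simp
    have eq: "(\<lambda>z. u z * \<phi> z ^ n) = (\<lambda>z. (-1) ^ n * T (\<lambda>z. sigma 0 z ^ n) z)"
      by (simp add: wcomp_def sigma_zero_left fun_eq_iff mult.left_commute flip: power_mult_distrib)
    have "bnorm (\<lambda>z. u z * \<phi> z ^ n) \<le> cmod ((-1) ^ n) * bnorm (T (\<lambda>z. sigma 0 z ^ n))"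
      unfolding eq by (rule bloch_scale(2)[OF B])
    then have "bnorm (\<lambda>z. u z * \<phi> z ^ n) \<le> 4 * k" using elim by (simp add: norm_power)
    moreover have "(\<lambda>z. u z * \<phi> z ^ n) \<in> bloch_space" unfolding eq by (rule bloch_scale(1)[OF B])
    ultimately show ?case by (simp add: bloch_norm_eq_bnorm ennreal_leI)
  qed
qed

text \<open>Failure of a uniform bound near the circle would give points with
  \<open>logw (\<phi> (a n)) > n\<close>, hence a weakly null sequence of test functions with large
  images. The constant is \<open>45 + 1\<close>.\<close>

lemma log_le:
  assumes ess: "bloch_ess_norm (T) < ennreal k"
  shows "limsup_bdry \<phi> (\<lambda>a. bloch_norm (T (g_fun \<phi> a))) \<le> ennreal (46 * k)"
proof -
  have "\<exists>s\<in>{0<..<1}. \<forall>a. cmod a < 1 \<longrightarrow> s < cmod (\<phi> a) \<longrightarrow> bnorm (T (log_test (\<phi> a))) \<le> 46 * k"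
  proof (rule ccontr)
    assume contra: "\<not> ?thesis"
    have "\<exists>a. cmod a < 1 \<and> real n < logw (\<phi> a) \<and> 46 * k < bnorm (T (log_test (\<phi> a)))" for n :: nat
    proof -
      obtain s where s: "s \<in> {0<..<1::real}" "\<And>w. s < cmod w \<Longrightarrow> cmod w < 1 \<Longrightarrow> real n < logw w"
        using logw_large[of "real n"] by blast
      obtain a where a: "cmod a < 1" "s < cmod (\<phi> a)" "\<not> bnorm (T (log_test (\<phi> a))) \<le> 46 * k"
        using contra s(1) by blast
      then show ?thesis using s(2)[OF a(2) \<phi>1[OF a(1)]] by (auto simp: not_le)
    qed
    then obtain a :: "nat \<Rightarrow> complex" where a: "\<And>n. cmod (a n) < 1" "\<And>n. real n < logw (\<phi> (a n))"
      "\<And>n. 46 * k < bnorm (T (log_test (\<phi> (a n))))" by metis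
    have "filterlim (\<lambda>n. logw (\<phi> (a n))) at_top sequentially"
      by (rule filterlim_at_top_mono[OF filterlim_real_sequentially]) (simp add: less_imp_le[OF a(2)])
    then have W: "weakly_null 45 (\<lambda>n. log_test (\<phi> (a n)))" by (rule log_test_weakly_null[OF \<phi>1[OF a(1)]])
    have "\<forall>\<^sub>F n in sequentially. bnorm (T (log_test (\<phi> (a n)))) \<le> (45 + 1) * k"
      by (rule ess_norm_weakly_null[OF bounded ess W]) simp
    then obtain n where "bnorm (T (log_test (\<phi> (a n)))) \<le> 46 * k"
      by (auto simp: eventually_sequentially)
    then show False using a(3)[of n] by simp
  qed
  then obtain s where s: "s \<in> {0<..<1}"
    "\<And>a. cmod a < 1 \<Longrightarrow> s < cmod (\<phi> a) \<Longrightarrow> bnorm (T (log_test (\<phi> a))) \<le> 46 * k" by blast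
  show ?thesis
  proof (rule limsup_bdry_le[OF s(1)])
    fix a assume a: "cmod a < 1" "s < cmod (\<phi> a)"
    show "bloch_norm (T (g_fun \<phi> a)) \<le> ennreal (46 * k)"
      unfolding g_fun_eq_log_test bloch_norm_eq_bnorm[OF T_mem[OF log_test_bloch(1)[OF \<phi>1[OF a(1)]]]]
      by (rule ennreal_leI[OF s(2)[OF a]])
  qed
qed

text \<open>If every exponent had a bad point \<open>a n\<close>, the functions
  \<open>sigma (\<phi> (a n)) ^ n\<close> would form a weakly null sequence with varying centres in
  \<open>cmod w \<le> r\<close>, and their images could not stay large.\<close>

lemma sigma_power_uniform:
  assumes ess: "bloch_ess_norm (T) < ennreal k" and r: "r < 1"
  obtains n where "n \<noteq> 0"
    "\<forall>a. cmod a < 1 \<longrightarrow> cmod (\<phi> a) \<le> r \<longrightarrow> bnorm (T (\<lambda>z. sigma (\<phi> a) z ^ n)) \<le> 4 * k"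
proof -
  have "\<exists>n. n \<noteq> 0 \<and> (\<forall>a. cmod a < 1 \<longrightarrow> cmod (\<phi> a) \<le> r \<longrightarrow> bnorm (T (\<lambda>z. sigma (\<phi> a) z ^ n)) \<le> 4 * k)"
  proof (rule ccontr)
    assume contra: "\<not> ?thesis"
    have ex: "\<exists>a. cmod a < 1 \<and> cmod (\<phi> a) \<le> r \<and> 4 * k < bnorm (T (\<lambda>z. sigma (\<phi> a) z ^ n))" if "n \<noteq> 0" for n
    proof -
      have "\<not> (\<forall>a. cmod a < 1 \<longrightarrow> cmod (\<phi> a) \<le> r \<longrightarrow> bnorm (T (\<lambda>z. sigma (\<phi> a) z ^ n)) \<le> 4 * k)"
        using contra that by blast
      then show ?thesis by (auto simp: not_le)
    qed
    \<comment> \<open>At index 0 the bad point for exponent 1 is reused, so that the bound on the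
      centres holds for every index.\<close>
    have "\<exists>a. cmod a < 1 \<and> cmod (\<phi> a) \<le> r \<and> (n \<noteq> 0 \<longrightarrow> 4 * k < bnorm (T (\<lambda>z. sigma (\<phi> a) z ^ n)))" for n
      using ex[of n] ex[of 1] by (cases "n = 0") auto
    then obtain a :: "nat \<Rightarrow> complex" where a: "\<And>n. cmod (\<phi> (a n)) \<le> r"
      "\<And>n. n \<noteq> 0 \<Longrightarrow> 4 * k < bnorm (T (\<lambda>z. sigma (\<phi> (a n)) z ^ n))" by metis
    have "\<forall>\<^sub>F n in sequentially. bnorm (T (\<lambda>z. sigma (\<phi> (a n)) z ^ n)) \<le> (3 + 1) * k"
      by (rule ess_norm_weakly_null[OF bounded ess sigma_power_weakly_null[OF a(1) r]]) simp
    then obtain N where N: "\<And>n. N \<le> n \<Longrightarrow> bnorm (T (\<lambda>z. sigma (\<phi> (a n)) z ^ n)) \<le> 4 * k"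
      by (auto simp: eventually_sequentially)
    show False using N[of "Suc N"] a(2)[of "Suc N"] by simp
  qed
  then show thesis using that by blast
qed

text \<open>On \<open>E_set \<phi> a t\<close> the function \<open>u \<circ> sigma a\<close> is comparable with the image of
  \<open>sigma (\<phi> a) ^ n\<close> precomposed with \<open>sigma a\<close>; the latter vanishes at \<open>0\<close>, so its growth is
  controlled by its Bloch norm alone although \<open>u a\<close> need not be bounded.\<close>

lemma E_set_bound:
  assumes a: "cmod a < 1" and n: "n \<noteq> 0" and t: "0 < t" "1/2 < t ^ n" and k: "0 < k"
    and F: "bnorm (T (\<lambda>z. sigma (\<phi> a) z ^ n)) \<le> 4 * k" and z: "z \<in> E_set \<phi> a t"
  shows "cmod (u (sigma a z)) \<le> 64 * k * (1 - cmod z) powr (- 1/8)"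
proof -
  let ?F = "T (\<lambda>z. sigma (\<phi> a) z ^ n)"
  have z1: "cmod z < 1" and zt: "t < cmod (sigma (\<phi> a) (\<phi> (sigma a z)))" using z by (auto simp: E_set_def)
  have FB: "?F \<in> bloch_space" by (rule T_mem[OF sigma_power_bloch(1)[OF \<phi>1[OF a]]])
  note Fh = bloch_space_holomorphic[OF FB]
  have h: "(\<lambda>z. ?F (sigma a z)) holomorphic_on unit_disc"
    by (rule holomorphic_compose_disc[OF Fh sigma_holomorphic[OF a]]) (simp add: a)
  have "cmod ((\<lambda>z. ?F (sigma a z)) z - (\<lambda>z. ?F (sigma a z)) 0) \<le> 8 * (4 * k) * (1 - cmod z) powr (- 1/8)"
  proof (rule power_growth[OF h z1])
    show "0 \<le> 4 * k" using k by simp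
    fix w assume "cmod w \<le> cmod z"
    then have w: "cmod w < 1" using z1 by simp
    have "bderiv ?F (sigma a w) \<le> bnorm ?F"
      using bnorm_bound[OF FB norm_sigma_less_1[OF a w]] norm_ge_zero[of "?F 0"] by linarith
    also have "\<dots> \<le> 4 * k * 1" using F by simp
    also have "\<dots> \<le> 4 * k * (1 - cmod w) powr (- 1/8)" using k w by (intro mult_left_mono one_le_weight) auto
    finally show "bderiv (\<lambda>z. ?F (sigma a z)) w \<le> 4 * k * (1 - cmod w) powr (- 1/8)"
      unfolding norm_deriv_compose_sigma[OF Fh a w] .
  qed
  moreover have "?F (sigma a 0) = 0" using n by (simp add: wcomp_def)
  ultimately have 1: "cmod (?F (sigma a z)) \<le> 32 * k * (1 - cmod z) powr (- 1/8)" by simp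
  \<comment> \<open>On \<open>E_set\<close> the power has modulus at least \<open>1/2\<close>, so
    dividing by it doubles \<open>32 * k\<close>.\<close>
  have "1/2 \<le> cmod (sigma (\<phi> a) (\<phi> (sigma a z))) ^ n"
    using t zt power_mono[of t "cmod (sigma (\<phi> a) (\<phi> (sigma a z)))" n] by linarith
  then have "cmod (u (sigma a z)) * (1/2) \<le> cmod (u (sigma a z)) * cmod (sigma (\<phi> a) (\<phi> (sigma a z))) ^ n"
    by (intro mult_left_mono) auto
  also have "\<dots> = cmod (?F (sigma a z))" by (simp add: wcomp_def norm_mult norm_power)
  finally show ?thesis using 1 by linarith
qed

text \<open>The fourth power of the weight has exponent \<open>- 1/2\<close>, whose integral is at
  most 8; since \<open>8 \<le> 2^4\<close>, taking the fourth root at most doubles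
  \<open>64 * k\<close>.\<close>

lemma E_set_integral:
  assumes k: "0 < k" and bd: "\<And>z. z \<in> E_set \<phi> a t \<Longrightarrow> cmod (u (sigma a z)) \<le> 64 * k * (1 - cmod z) powr (- 1/8)"
  shows "enn_powr (set_nn_integral lborel (E_set \<phi> a t) (\<lambda>z. ennreal ((cmod (u (sigma a z))) ^ 4 / pi))) (1/4) \<le> ennreal (128 * k)"
proof -
  define c where "c = (64 * k) ^ 4"
  have c: "0 \<le> c" by (simp add: c_def)
  have [measurable]: "unit_disc \<in> sets borel" by simp
  have "set_nn_integral lborel (E_set \<phi> a t) (\<lambda>z. ennreal ((cmod (u (sigma a z))) ^ 4 / pi))
     \<le> (\<integral>\<^sup>+z. ennreal c * (ennreal ((1 - cmod z) powr (- 1/2) / pi) * indicator unit_disc z) \<partial>lborel)"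
  proof (rule nn_integral_mono)
    fix z
    show "ennreal ((cmod (u (sigma a z))) ^ 4 / pi) * indicator (E_set \<phi> a t) z
       \<le> ennreal c * (ennreal ((1 - cmod z) powr (- 1/2) / pi) * indicator unit_disc z)"
    proof (cases "z \<in> E_set \<phi> a t")
      case True
      then have z: "cmod z < 1" by (simp add: E_set_def)
      have "(cmod (u (sigma a z))) ^ 4 \<le> (64 * k * (1 - cmod z) powr (- 1/8)) ^ 4"
        using bd[OF True] by (intro power_mono) auto
      also have "\<dots> = c * ((1 - cmod z) powr (- 1/8)) ^ 4" unfolding c_def by (rule power_mult_distrib)
      also have "((1 - cmod z) powr (- 1/8)) ^ 4 = (1 - cmod z) powr (- 1/2)"
        using z by (simp add: powr_powr flip: powr_numeral)
      finally have "(cmod (u (sigma a z))) ^ 4 / pi \<le> c * ((1 - cmod z) powr (- 1/2) / pi)"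
        by (simp add: divide_right_mono)
      then have "ennreal ((cmod (u (sigma a z))) ^ 4 / pi) \<le> ennreal (c * ((1 - cmod z) powr (- 1/2) / pi))" by (rule ennreal_leI)
      also have "\<dots> = ennreal c * ennreal ((1 - cmod z) powr (- 1/2) / pi)" by (rule ennreal_mult'[OF c])
      finally show ?thesis using True z by simp
    qed simp
  qed
  also have "\<dots> = ennreal c * (\<integral>\<^sup>+z. ennreal ((1 - cmod z) powr (- 1/2) / pi) * indicator unit_disc z \<partial>lborel)"
    by (rule nn_integral_cmult) measurable
  also have "\<dots> \<le> ennreal c * ennreal 8" by (intro mult_left_mono nn_integral_disc_weight) simp
  also have "\<dots> = ennreal (c * 8)" by (rule ennreal_mult'[OF c, symmetric])
  also have "\<dots> \<le> ennreal ((128 * k) powr 4)"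
  proof (rule ennreal_leI)
    have "(128 * k) powr 4 = (128 * k) ^ 4" using k by (simp add: powr_numeral)
    also have "\<dots> = c * 16" by (simp add: c_def power_mult_distrib)
    finally show "c * 8 \<le> (128 * k) powr 4" using c by simp
  qed
  finally show ?thesis using k by (subst enn_powr_le_iff) auto
qed

text \<open>The order of the two limits matters: the exponent \<open>n\<close> depends on
  \<open>r\<close>, and with \<open>r\<close> fixed \<open>t\<close> tends to 1 until
  \<open>t^n > 1/2\<close>.\<close>

lemma gamma_le:
  assumes ess: "bloch_ess_norm (T) < ennreal k"
  shows "gamma_t u \<phi> \<le> ennreal (128 * k)"
  unfolding gamma_t_def
proof (rule Limsup_bounded)
  have "0 < ennreal k" using ess by (rule order_le_less_trans[OF zero_le])
  then have k: "0 < k" by simp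
  let ?I = "\<lambda>a t. enn_powr (set_nn_integral lborel (E_set \<phi> a t) (\<lambda>z. ennreal ((cmod (u (sigma a z))) ^ 4 / pi))) (1/4)"
  have main: "Limsup (at_left 1) (\<lambda>t. SUP a\<in>{a\<in>unit_disc. cmod (\<phi> a) \<le> r}. ?I a t) \<le> ennreal (128 * k)" if r: "r < 1" for r
  proof (rule Limsup_bounded)
    obtain n where n: "n \<noteq> 0"
      "\<forall>a. cmod a < 1 \<longrightarrow> cmod (\<phi> a) \<le> r \<longrightarrow> bnorm (T (\<lambda>z. sigma (\<phi> a) z ^ n)) \<le> 4 * k"
      by (rule sigma_power_uniform[OF ess r])
    have "((\<lambda>t::real. t ^ n) \<longlongrightarrow> 1 ^ n) (at_left 1)" by (intro tendsto_intros)
    then have "\<forall>\<^sub>F t in at_left 1. 1/2 < (t::real) ^ n" by (rule order_tendstoD(1)) simp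
    moreover have "((\<lambda>t::real. t) \<longlongrightarrow> 1) (at_left 1)" by (intro tendsto_intros)
    then have "\<forall>\<^sub>F t in at_left 1. 0 < (t::real)" by (rule order_tendstoD(1)) simp
    ultimately show "\<forall>\<^sub>F t in at_left 1. (SUP a\<in>{a\<in>unit_disc. cmod (\<phi> a) \<le> r}. ?I a t) \<le> ennreal (128 * k)"
    proof eventually_elim
      case (elim t)
      show ?case
      proof (rule SUP_least)
        fix a assume "a \<in> {a\<in>unit_disc. cmod (\<phi> a) \<le> r}"
        then have a: "cmod a < 1" "cmod (\<phi> a) \<le> r" by auto
        show "?I a t \<le> ennreal (128 * k)"
          by (rule E_set_integral[OF k E_set_bound[OF a(1) n(1) elim(2,1) k n(2)[rule_format, OF a]]])
      qed
    qed
  qed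
  have "\<forall>\<^sub>F r in at_left 1. r < (1::real)" by (simp add: eventually_at_filter)
  then show "\<forall>\<^sub>F r in at_left 1. Limsup (at_left 1) (\<lambda>t. SUP a\<in>{a\<in>unit_disc. cmod (\<phi> a) \<le> r}. ?I a t) \<le> ennreal (128 * k)"
    by eventually_elim (rule main)
qed

section \<open>Chaining the estimates and their constants\<close>

lemma bdry_of_ess:
  assumes ess: "bloch_ess_norm (T) < ennreal k"
  shows "bdry (127 * k)" "0 < k"
proof -
  have "0 < ennreal k" using ess by (rule order_le_less_trans[OF zero_le])
  then show k: "0 < k" by simp
  \<comment> \<open>The converse estimates ask for strict bounds, so 4 is raised to 5 here and 46 to
    47 below.\<close>
  have "ennreal (4 * k) < ennreal (5 * k)" using k by (intro ennreal_lessI) auto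
  then have "Limsup sequentially (\<lambda>n. bloch_norm (\<lambda>z. u z * \<phi> z ^ n)) < ennreal (5 * k)"
    by (rule order_le_less_trans[OF powers_le[OF ess]])
  then have 1: "\<exists>s\<in>{0<..<1}. \<forall>a. cmod a < 1 \<longrightarrow> s < cmod (\<phi> a) \<longrightarrow> tau a \<le> 8 * (5 * k)"
    by (rule tau_bdry_from_powers) (use k in simp)
  have "ennreal (46 * k) < ennreal (47 * k)" using k by (intro ennreal_lessI) auto
  then have "limsup_bdry \<phi> (\<lambda>a. bloch_norm (T (g_fun \<phi> a))) < ennreal (47 * k)"
    by (rule order_le_less_trans[OF log_le[OF ess]])
  note 2 = log_test_bdry[OF this]
  \<comment> \<open>\<open>tau \<le> 40 * k\<close> and \<open>bL \<le> 47 * k + 2 * tau\<close>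
    give \<open>47 + 80 = 127\<close>.\<close>
  show "bdry (127 * k)" by (rule bdryI[OF 1 2]) (use k in auto)
qed

lemma quantities_le_ess:
  defines "ess \<equiv> bloch_ess_norm (T)"
  shows "Limsup sequentially (\<lambda>n. bloch_norm (\<lambda>z. u z * \<phi> z ^ n)) \<le> ennreal 4 * ess"
    and "limsup_bdry \<phi> (\<lambda>a. bloch_norm (T (g_fun \<phi> a))) \<le> ennreal 46 * ess"
    and "gamma_t u \<phi> \<le> ennreal 128 * ess"
    and "alpha_t u \<phi> \<le> ennreal 8128 * ess"
    and "beta_t u \<phi> \<le> ennreal 134112 * ess"
proof -
  show "Limsup sequentially (\<lambda>n. bloch_norm (\<lambda>z. u z * \<phi> z ^ n)) \<le> ennreal 4 * ess"
    unfolding ess_def by (rule ennreal_scaled_leI[OF _ powers_le]) auto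
  show "limsup_bdry \<phi> (\<lambda>a. bloch_norm (T (g_fun \<phi> a))) \<le> ennreal 46 * ess"
    unfolding ess_def by (rule ennreal_scaled_leI[OF _ log_le]) auto
  show "gamma_t u \<phi> \<le> ennreal 128 * ess"
    unfolding ess_def by (rule ennreal_scaled_leI[OF _ gamma_le]) auto
  show "alpha_t u \<phi> \<le> ennreal 8128 * ess"
    unfolding ess_def
  proof (rule ennreal_scaled_leI)
    fix k assume "bloch_ess_norm (T) < ennreal k"
    from alpha_le[OF bdry_of_ess(1)[OF this]] bdry_of_ess(2)[OF this]
    show "alpha_t u \<phi> \<le> ennreal (8128 * k)" by simp
  qed simp
  show "beta_t u \<phi> \<le> ennreal 134112 * ess"
    unfolding ess_def
  proof (rule ennreal_scaled_leI)
    fix k assume "bloch_ess_norm (T) < ennreal k"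
    from beta_le[OF bdry_of_ess(1)[OF this]] bdry_of_ess(2)[OF this]
    show "beta_t u \<phi> \<le> ennreal (134112 * k)" by simp
  qed simp
qed

text \<open>19 covers all four right-hand sides. The worst case pairs powers with
  \<open>beta_t\<close>: \<open>tau \<le> 8 * K\<close> and \<open>bL \<le> 3 * K + 2 * tau\<close>.
  The factor 10 comes from \<open>ess_le\<close>.\<close>

lemma ess_le_quantity:
  assumes "\<And>K. 0 < K \<Longrightarrow> Q < ennreal K \<Longrightarrow> bdry (19 * K)"
  shows "bloch_ess_norm (T) \<le> ennreal 190 * Q"
proof (rule ennreal_scaled_leI)
  fix K :: real assume K: "0 < K" "Q < ennreal K"
  show "bloch_ess_norm (T) \<le> ennreal (190 * K)"
    using ess_le[OF assms[OF K]] K(1) by simp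
qed simp

lemma ess_le_quantities:
  defines "Ln0 \<equiv> Limsup sequentially (\<lambda>n. bloch_norm (\<lambda>z. u z * \<phi> z ^ n))"
    and "Lg \<equiv> limsup_bdry \<phi> (\<lambda>a. bloch_norm (T (g_fun \<phi> a)))"
  shows "bloch_ess_norm (T) \<le> ennreal 190 * (Ln0 + Lg)"
    and "bloch_ess_norm (T) \<le> ennreal 190 * (alpha_t u \<phi> + beta_t u \<phi> + gamma_t u \<phi>)"
    and "bloch_ess_norm (T) \<le> ennreal 190 * (alpha_t u \<phi> + Lg + gamma_t u \<phi>)"
    and "bloch_ess_norm (T) \<le> ennreal 190 * (Ln0 + beta_t u \<phi>)"
proof -
  have beta': "\<exists>s\<in>{0<..<1}. \<forall>a. cmod a < 1 \<longrightarrow> s < cmod (\<phi> a) \<longrightarrow> bL a \<le> 3 * K + 2 * tau a"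
    if lt: "beta_t u \<phi> < ennreal K" for K
  proof -
    obtain s where s: "s \<in> {0<..<1}" "\<And>a. cmod a < 1 \<Longrightarrow> s < cmod (\<phi> a) \<Longrightarrow> bL a \<le> 3 * K"
      using bL_bdry_from_beta[OF lt] by blast
    have "bL a \<le> 3 * K + 2 * tau a" if a: "cmod a < 1" "s < cmod (\<phi> a)" for a
      using s(2)[OF a] tau_nonneg[OF a(1)] by linarith
    then show ?thesis using s(1) by blast
  qed
  show "bloch_ess_norm (T) \<le> ennreal 190 * (Ln0 + Lg)"
  proof (rule ess_le_quantity)
    fix K :: real assume K: "0 < K" and lt: "Ln0 + Lg < ennreal K"
    have "Ln0 < ennreal K" "Lg < ennreal K" by (rule order_le_less_trans[OF _ lt], simp)+
    then show "bdry (19 * K)" unfolding Ln0_def Lg_def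
      by (intro bdryI[OF tau_bdry_from_powers[OF _ K] log_test_bdry]) (use K in auto)
  qed
  show "bloch_ess_norm (T) \<le> ennreal 190 * (alpha_t u \<phi> + beta_t u \<phi> + gamma_t u \<phi>)"
  proof (rule ess_le_quantity)
    fix K :: real assume K: "0 < K" and lt: "alpha_t u \<phi> + beta_t u \<phi> + gamma_t u \<phi> < ennreal K"
    have "alpha_t u \<phi> < ennreal K" "beta_t u \<phi> < ennreal K"
      by (rule order_le_less_trans[OF _ lt], simp add: add_increasing add_increasing2)+
    then show "bdry (19 * K)"
      by (intro bdryI[OF tau_bdry_from_alpha beta']) (use K in auto)
  qed
  show "bloch_ess_norm (T) \<le> ennreal 190 * (alpha_t u \<phi> + Lg + gamma_t u \<phi>)"
  proof (rule ess_le_quantity)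
    fix K :: real assume K: "0 < K" and lt: "alpha_t u \<phi> + Lg + gamma_t u \<phi> < ennreal K"
    have "alpha_t u \<phi> < ennreal K" "Lg < ennreal K"
      by (rule order_le_less_trans[OF _ lt], simp add: add_increasing add_increasing2)+
    then show "bdry (19 * K)" unfolding Lg_def
      by (intro bdryI[OF tau_bdry_from_alpha log_test_bdry]) (use K in auto)
  qed
  show "bloch_ess_norm (T) \<le> ennreal 190 * (Ln0 + beta_t u \<phi>)"
  proof (rule ess_le_quantity)
    fix K :: real assume K: "0 < K" and lt: "Ln0 + beta_t u \<phi> < ennreal K"
    have "Ln0 < ennreal K" "beta_t u \<phi> < ennreal K" by (rule order_le_less_trans[OF _ lt], simp)+
    then show "bdry (19 * K)" unfolding Ln0_def
      by (intro bdryI[OF tau_bdry_from_powers[OF _ K] beta']) (use K in auto)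
  qed
qed

end

lemma ennreal_inverse_scale:
  assumes "0 < C" "Q \<le> ennreal C * X"
  shows "ennreal (1 / C) * Q \<le> X"
proof -
  have "ennreal (1 / C) * Q \<le> ennreal (1 / C) * (ennreal C * X)" using assms(2) by (rule mult_left_mono) simp
  also have "\<dots> = ennreal (1 / C * C) * X" using assms(1) by (subst ennreal_mult') (auto simp: mult.assoc)
  also have "\<dots> = X" using assms(1) by simp
  finally show ?thesis .
qed

lemma ennreal_bound_add:
  assumes "A \<le> ennreal a * X" "B \<le> ennreal b * X" "0 \<le> a" "0 \<le> b"
  shows "A + B \<le> ennreal (a + b) * X"
  using add_mono[OF assms(1,2)] assms(3,4) by (simp add: ennreal_plus distrib_right)

lemma ennreal_bound_weaken:
  assumes "A \<le> ennreal a * X" "a \<le> b"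
  shows "A \<le> ennreal b * X"
  using assms(1) mult_right_mono[OF ennreal_leI[OF assms(2)], of X] by (rule order_trans) simp

theorem theorem3p2:
  "\<exists>c C :: real. c > 0 \<and> C > 0 \<and>
    (\<forall>u \<phi> :: complex \<Rightarrow> complex.
       u holomorphic_on unit_disc \<and> \<phi> holomorphic_on unit_disc \<and> \<phi> ` unit_disc \<subseteq> unit_disc \<and>
       wcomp_bounded_bloch u \<phi> \<longrightarrow>
       (let ess = bloch_ess_norm (wcomp u \<phi>);
            Ln0 = Limsup sequentially (\<lambda>n. bloch_norm (\<lambda>z. u z * \<phi> z ^ n));
            Lg = limsup_bdry \<phi> (\<lambda>a. bloch_norm (wcomp u \<phi> (g_fun \<phi> a)));
            Q1 = Ln0 + Lg;
            Q2 = alpha_t u \<phi> + beta_t u \<phi> + gamma_t u \<phi>;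
            Q3 = alpha_t u \<phi> + Lg + gamma_t u \<phi>;
            Q4 = Ln0 + beta_t u \<phi>
        in ennreal c * Q1 \<le> ess \<and> ess \<le> ennreal C * Q1 \<and>
           ennreal c * Q2 \<le> ess \<and> ess \<le> ennreal C * Q2 \<and>
           ennreal c * Q3 \<le> ess \<and> ess \<le> ennreal C * Q3 \<and>
           ennreal c * Q4 \<le> ess \<and> ess \<le> ennreal C * Q4))"
proof (rule exI[of _ "1 / 150000"], rule exI[of _ 190], intro conjI allI impI)
  fix u \<phi> :: "complex \<Rightarrow> complex"
  assume "u holomorphic_on unit_disc \<and> \<phi> holomorphic_on unit_disc \<and> \<phi> ` unit_disc \<subseteq> unit_disc \<and>
       wcomp_bounded_bloch u \<phi>"
  then interpret bloch_wcomp u \<phi> by unfold_locales auto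
  note q = quantities_le_ess
  let ?X = "bloch_ess_norm (wcomp u \<phi>)"
  \<comment> \<open>The largest sum of constants is \<open>8128 + 134112 + 128 = 142368\<close>, for
    \<open>alpha_t + beta_t + gamma_t\<close>, so 150000 serves all four.\<close>
  have lower: "ennreal (1 / 150000) * Q \<le> ?X" if "Q \<le> ennreal a * ?X" "a \<le> 150000" for Q a
    by (rule ennreal_inverse_scale[OF _ ennreal_bound_weaken[OF that]]) simp
  note L1 = lower[OF ennreal_bound_add[OF q(1) q(2)]]
  note L2 = lower[OF ennreal_bound_add[OF ennreal_bound_add[OF q(4) q(5)] q(3)]]
  note L3 = lower[OF ennreal_bound_add[OF ennreal_bound_add[OF q(4) q(2)] q(3)]]
  note L4 = lower[OF ennreal_bound_add[OF q(1) q(5)]]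
  show "let ess = bloch_ess_norm (wcomp u \<phi>);
            Ln0 = Limsup sequentially (\<lambda>n. bloch_norm (\<lambda>z. u z * \<phi> z ^ n));
            Lg = limsup_bdry \<phi> (\<lambda>a. bloch_norm (wcomp u \<phi> (g_fun \<phi> a)));
            Q1 = Ln0 + Lg;
            Q2 = alpha_t u \<phi> + beta_t u \<phi> + gamma_t u \<phi>;
            Q3 = alpha_t u \<phi> + Lg + gamma_t u \<phi>;
            Q4 = Ln0 + beta_t u \<phi>
        in ennreal (1 / 150000) * Q1 \<le> ess \<and> ess \<le> ennreal 190 * Q1 \<and>
           ennreal (1 / 150000) * Q2 \<le> ess \<and> ess \<le> ennreal 190 * Q2 \<and>
           ennreal (1 / 150000) * Q3 \<le> ess \<and> ess \<le> ennreal 190 * Q3 \<and>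
           ennreal (1 / 150000) * Q4 \<le> ess \<and> ess \<le> ennreal 190 * Q4"
    unfolding Let_def
    by (intro conjI ess_le_quantities L1 L2 L3 L4) simp_all
qed simp_all

end
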